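(* Let $\mathbf{T}=(T_t\colon t\ge 0)$ be a subordinator with the Laplace exponent $\phi$. Suppose that $-\phi''\in\mathrm{WLSC}(\alpha-2,c,x_0)$ for some $c\in(0,1]$, $x_0\ge 0$, and $\alpha>0$, and assume that one of the following conditions holds true: (i) $-\phi''\in\mathrm{WUSC}(\beta-2,C,x_0)$ for some $C\ge 1$ and $\alpha\le\beta<1$; or (ii) $-\phi''$ is a function regularly varying at infinity with index $-1$; if $x_0=0$, it is also assumed that $-\phi''$ is regularly varying at zero with index $-1$. Then there exists $\rho_0>0$ such that for all $0<\rho_1<\rho_0$ and $0<\rho_2$ there is $C>0$ such that for all $t\in(0,1/\varphi(x_0))$ and all $x>0$ satisfying $$-\frac{\rho_1}{\varphi^{-1}(1/t)}\le x-t\,\phi'\big(\varphi^{-1}(1/t)\big)\le\frac{\rho_2}{\varphi^{-1}(1/t)},$$ we have $$p(t,x)\ge C\,\varphi^{-1}(1/t),$$ where $p(t,\cdot)$ is the density of $T_t$.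
   Context: A subordinator is a one-dimensional Lévy process $\mathbf{T}=(T_t\colon t\ge 0)$ with $T_0=0$ and nondecreasing paths. Its Laplace exponent $\phi\colon[0,\infty)\to[0,\infty)$ is defined by $\mathbb{E}\,e^{-\lambda T_t}=e^{-t\phi(\lambda)}$, and $\phi(\lambda)=b\lambda+\int_{(0,\infty)}(1-e^{-\lambda s})\,\nu(\mathrm{d}s)$, where $b\ge 0$ and $\nu$ (the Lévy measure) satisfies $\int_{(0,\infty)}\min\{1,s\}\,\nu(\mathrm{d}s)<\infty$. It is assumed that $\phi''\not\equiv 0$. Under the $\mathrm{WLSC}$ hypothesis below, $T_t$ has a density for every $t>0$, and $p(t,\cdot)$ denotes its continuous version. For $\tau\in\mathbb{R}$, $x_0\ge 0$, a nonnegative function $f$ on $(0,\infty)$ belongs to $\mathrm{WLSC}(\tau,c,x_0)$, $c\in(0,1]$, if $f(\lambda x)\ge c\lambda^{\tau}f(x)$ for all $\lambda\ge 1$ and $x>x_0$; it belongs to $\mathrm{WUSC}(\tau,C,x_0)$, $C\ge1$, if $f(\lambda x)\le C\lambda^{\tau}f(x)$ for all $\lambda\ge1$ and $x>x_0$. $f$ is regularly varying at infinity (respectively at zero) with index $\tau$ if $\lim f(\lambda x)/f(x)=\lambda^{\tau}$ for all $\lambda\ge 1$ as $x\to\infty$ (respectively $x\to0^+$). Notation: $\varphi(x)=x^2(-\phi''(x))$ for $x>0$, $\varphi^*(r)=\sup_{0<x\le r}\varphi(x)$, $\varphi^{-1}(x)=\sup\{r>0\colon\varphi^*(r)=x\}$.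 Convention when $x_0=0$: $\varphi(x_0)=0$ and $1/\varphi(x_0)=\infty$. *)

theory Defs
  imports "HOL-Probability.Probability"
begin

text \<open>No path regularity beyond stochastic continuity is required of a Levy process; for processes
  with cadlag paths stochastic continuity is automatic. Time runs over \<open>{0..}\<close>: the values
  \<open>T t\<close> for \<open>t < 0\<close> are irrelevant.\<close>

locale levy_process = prob_space M for M :: "'w measure" +
  fixes T :: "real \<Rightarrow> 'w \<Rightarrow> real"
  assumes random_variable: "\<And>t. 0 \<le> t \<Longrightarrow> random_variable borel (T t)"
    and start_zero: "AE \<omega> in M. T 0 \<omega> = 0"
    and independent_increments:
      "\<And>(s :: nat \<Rightarrow> real) n. 0 \<le> s 0 \<Longrightarrow> strict_mono_on {..n} s \<Longrightarrow>
         indep_vars (\<lambda>_. borel) (\<lambda>i \<omega>. T (s (Suc i)) \<omega> - T (s i) \<omega>) {..<n}"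
    and stationary_increments:
      "\<And>s h. 0 \<le> s \<Longrightarrow> 0 \<le> h \<Longrightarrow>
         distr M borel (\<lambda>\<omega>. T (s + h) \<omega> - T s \<omega>) = distr M borel (T h)"
    and stochastically_continuous:
      "\<And>s \<epsilon>. 0 \<le> s \<Longrightarrow> 0 < \<epsilon> \<Longrightarrow>
         ((\<lambda>t. prob {\<omega> \<in> space M. \<epsilon> < \<bar>T t \<omega> - T s \<omega>\<bar>}) \<longlongrightarrow> 0) (at s within {0..})"

locale subordinator = levy_process +
  assumes nondecreasing_paths: "AE \<omega> in M. mono_on {0..} (\<lambda>t. T t \<omega>)"

definition laplace_exponent ::
  "'w measure \<Rightarrow> (real \<Rightarrow> 'w \<Rightarrow> real) \<Rightarrow> (real \<Rightarrow> real) \<Rightarrow> bool" where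
  "laplace_exponent M T \<phi> \<longleftrightarrow>
     (\<forall>u\<ge>0. 0 \<le> \<phi> u \<and> (\<forall>t\<ge>0. (\<integral>\<omega>. exp (- u * T t \<omega>) \<partial>M) = exp (- t * \<phi> u)))"

text \<open>The Levy measure \<open>\<nu>\<close> has \<open>{0<..}\<close> as its whole space, so that integrals with respect
  to \<open>\<nu>\<close> are integrals over \<open>{0<..}\<close>.\<close>

definition levy_khintchine_repr :: "(real \<Rightarrow> real) \<Rightarrow> real \<Rightarrow> real measure \<Rightarrow> bool" where
  "levy_khintchine_repr \<phi> b \<nu> \<longleftrightarrow>
     0 \<le> b \<and>
     sets \<nu> = sets (restrict_space borel {0<..}) \<and>
     (\<integral>\<^sup>+ s. ennreal (min 1 s) \<partial>\<nu>) < \<infinity> \<and>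
     (\<forall>u\<ge>0. \<phi> u = b * u + (\<integral>s. (1 - exp (- u * s)) \<partial>\<nu>))"

definition WLSC :: "real \<Rightarrow> real \<Rightarrow> real \<Rightarrow> (real \<Rightarrow> real) set" where
  "WLSC \<tau> c x\<^sub>0 =
     {f. (\<forall>x>0. 0 \<le> f x) \<and> (\<forall>l\<ge>1. \<forall>x>x\<^sub>0. c * l powr \<tau> * f x \<le> f (l * x))}"

definition WUSC :: "real \<Rightarrow> real \<Rightarrow> real \<Rightarrow> (real \<Rightarrow> real) set" where
  "WUSC \<tau> C x\<^sub>0 =
     {f. (\<forall>x>0. 0 \<le> f x) \<and> (\<forall>l\<ge>1. \<forall>x>x\<^sub>0. f (l * x) \<le> C * l powr \<tau> * f x)}"

definition regularly_varying_at_infinity :: "real \<Rightarrow> (real \<Rightarrow> real) \<Rightarrow> bool" where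
  "regularly_varying_at_infinity \<tau> f \<longleftrightarrow>
     (\<forall>l\<ge>1. ((\<lambda>x. f (l * x) / f x) \<longlongrightarrow> l powr \<tau>) at_top)"

definition regularly_varying_at_zero :: "real \<Rightarrow> (real \<Rightarrow> real) \<Rightarrow> bool" where
  "regularly_varying_at_zero \<tau> f \<longleftrightarrow>
     (\<forall>l\<ge>1. ((\<lambda>x. f (l * x) / f x) \<longlongrightarrow> l powr \<tau>) (at_right 0))"

text \<open>At \<open>x = 0\<close> the factor \<open>x\<^sup>2\<close> makes \<open>varphi \<phi> 0 = 0\<close>.\<close>

definition varphi :: "(real \<Rightarrow> real) \<Rightarrow> real \<Rightarrow> real" where
  "varphi \<phi> x = x\<^sup>2 * (- deriv (deriv \<phi>) x)"

definition varphi_star :: "(real \<Rightarrow> real) \<Rightarrow> real \<Rightarrow> real" where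
  "varphi_star \<phi> r = (SUP x\<in>{0<..r}. varphi \<phi> x)"

definition varphi_inv :: "(real \<Rightarrow> real) \<Rightarrow> real \<Rightarrow> real" where
  "varphi_inv \<phi> x = Sup {r. 0 < r \<and> varphi_star \<phi> r = x}"

text \<open>The division is that of \<^typ>\<open>ereal\<close>, where \<open>1 / 0 = \<infinity>\<close>; in particular
  the bound is \<open>\<infinity>\<close> for \<open>x\<^sub>0 = 0\<close>.\<close>

definition time_horizon :: "(real \<Rightarrow> real) \<Rightarrow> real \<Rightarrow> ereal" where
  "time_horizon \<phi> x\<^sub>0 = 1 / ereal (varphi \<phi> x\<^sub>0)"

lemma time_horizon_0: "time_horizon \<phi> 0 = \<infinity>"
  by (simp add: time_horizon_def varphi_def)

text \<open>The continuous version of the density of \<open>T t\<close>. Nonnegativity is required because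
  \<^const>\<open>ennreal\<close> truncates negative values; with it, a continuous density is unique.\<close>

definition transition_density ::
  "'w measure \<Rightarrow> (real \<Rightarrow> 'w \<Rightarrow> real) \<Rightarrow> real \<Rightarrow> real \<Rightarrow> real" where
  "transition_density M T t =
     (THE f. continuous_on UNIV f \<and> (\<forall>x. 0 \<le> f x) \<and>
        distributed M lborel (T t) (\<lambda>x. ennreal (f x)))"

end

theory Submission
  imports Defs "HOL-Complex_Analysis.Complex_Analysis" "HOL-Real_Asymp.Real_Asymp"
begin

text \<open>The law of \<open>T t\<close>, rescaled by \<open>w = \<kappa> \<cdot> varphi_inv (1 / t)\<close> and exponentially tilted with rate \<open>1\<close>
  in the new scale, is infinitely divisible, and its variance lies between two constants which do not
  depend on \<open>t\<close>. The lower scaling condition makes its characteristic function decay like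
  \<open>exp (- k \<bar>\<theta>\<bar>\<^sup>\<alpha>)\<close>, so its density \<open>q\<close> is Lipschitz with a uniform constant, and Chebyshev's inequality
  gives a point within two standard deviations of the mean where \<open>q\<close> is bounded below. Since \<open>\<kappa>\<close> is large,
  this point lies to the left of the range required for \<open>x\<close>. Steutel's equation
  \<open>(x - mean) q x = \<integral> (q (x - s) - q x) s exp (- s) N(ds)\<close> carries the lower bound to the right in
  finitely many steps: the jumps of moderate size have mass bounded below, and the contribution of the very
  small jumps is controlled by the Lipschitz constant and the upper scaling condition. Both conditions (i)
  and (ii) enter only through upper scaling with exponent \<open>- 1 / 2\<close>.\<close>

section \<open>Differentiation of Laplace transforms\<close>

text \<open>Chebyshev's inequality locates mass only up to two standard deviations, and Steutel's
  equation carries positivity only in the direction of the jumps. This is why the tilting rate is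
  \<open>w = \<kappa> * r\<close> with \<open>r = varphi_inv \<phi> (1 / t)\<close> instead of
  \<open>r\<close>: the tilted mean \<open>t * deriv \<phi> w\<close> then lies to the left of
  \<open>t * deriv \<phi> r\<close>. In the scale \<open>w\<close> the tilted variance is
  \<open>V = t * varphi \<phi> w\<close> and this displacement is at least \<open>V / 2\<close>,
  which outgrows \<open>2 * sqrt V\<close> as \<kappa> increases and leaves room for the window on
  the left. Undoing the tilt costs a factor
  \<open>exp (- t * (\<phi> w - w * deriv \<phi> w))\<close>. Lower scaling with a positive \<alpha>
  bounds its exponent by a multiple of \<open>V\<close>, up to a small term. Since
  \<open>varphi \<phi>\<close> need not be monotone, \<open>r\<close> can fall below
  \<open>x\<^sub>0\<close> even when \<open>t\<close> is below the time horizon; both scaling bounds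
  are therefore first extended to a smaller threshold. Uniformity in \<open>t\<close> is obtained by
  absorbing \<open>t\<close> and \<open>w\<close> into the Levy measure and proving every estimate
  for a class of laws with fixed parameters.\<close>

lemma has_field_derivative_integral:
  fixes f f' :: "'a::{real_normed_field,banach,second_countable_topology} \<Rightarrow> 'b \<Rightarrow> 'a"
  assumes e: "0 < e"
    and int: "\<And>z. z \<in> ball z0 e \<Longrightarrow> integrable M (f z)"
    and meas: "f' z0 \<in> borel_measurable M"
    and deriv: "AE s in M. \<forall>z\<in>ball z0 e. ((\<lambda>z. f z s) has_field_derivative f' z s) (at z)"
    and bound: "AE s in M. \<forall>z\<in>ball z0 e. norm (f' z s) \<le> g s"
    and g: "integrable M g"
  shows "((\<lambda>z. \<integral>s. f z s \<partial>M) has_field_derivative (\<integral>s. f' z0 s \<partial>M)) (at z0)"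
  unfolding has_field_derivative_iff LIMSEQ_SEQ_conv[symmetric]
proof (intro allI impI)
  fix S :: "nat \<Rightarrow> 'a"
  assume S: "(\<forall>n. S n \<noteq> z0) \<and> S \<longlonglongrightarrow> z0"
  then obtain n0 where n0: "\<And>n. n \<ge> n0 \<Longrightarrow> S n \<in> ball z0 e"
    using e S[THEN conjunct2, THEN tendstoD, of e]
    by (auto simp: eventually_sequentially dist_commute)
  define R where "R n = S (n + n0)" for n
  have R: "R n \<in> ball z0 e" "R n \<noteq> z0" for n
    using n0 S by (auto simp: R_def)
  have Rlim: "R \<longlonglongrightarrow> z0"
    unfolding R_def by (rule LIMSEQ_ignore_initial_segment) (use S in auto)
  have z0: "z0 \<in> ball z0 e" using e by simp
  have meas_f: "f z \<in> borel_measurable M" if "z \<in> ball z0 e" for z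
    using int[OF that] by (rule borel_measurable_integrable)
  have "(\<lambda>n. \<integral>s. (f (R n) s - f z0 s) / (R n - z0) \<partial>M) \<longlonglongrightarrow> (\<integral>s. f' z0 s \<partial>M)"
  proof (rule integral_dominated_convergence[where w = g])
    show "(\<lambda>s. (f (R n) s - f z0 s) / (R n - z0)) \<in> borel_measurable M" for n
      by (intro borel_measurable_divide borel_measurable_diff meas_f R z0 borel_measurable_const)
    show "AE s in M. (\<lambda>n. (f (R n) s - f z0 s) / (R n - z0)) \<longlonglongrightarrow> f' z0 s"
      using deriv
    proof eventually_elim
      case (elim s)
      then have "((\<lambda>z. (f z s - f z0 s) / (z - z0)) \<longlongrightarrow> f' z0 s) (at z0)"
        using z0 by (auto simp: has_field_derivative_iff)
      then show ?case
        unfolding LIMSEQ_SEQ_conv[symmetric] using R Rlim by auto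
    qed
    show "AE s in M. norm ((f (R n) s - f z0 s) / (R n - z0)) \<le> g s" for n
      using deriv bound
    proof eventually_elim
      case (elim s)
      have "norm (f (R n) s - f z0 s) \<le> g s * norm (R n - z0)"
        by (rule field_differentiable_bound[of "ball z0 e" "\<lambda>z. f z s" "\<lambda>z. f' z s"])
          (use elim R z0 in \<open>auto intro: has_field_derivative_at_within\<close>)
      then show ?case
        using R[of n] by (simp add: norm_divide divide_simps)
    qed
  qed (use meas g in auto)
  also have "(\<lambda>n. \<integral>s. (f (R n) s - f z0 s) / (R n - z0) \<partial>M)
      = (\<lambda>n. ((\<integral>s. f (R n) s \<partial>M) - (\<integral>s. f z0 s \<partial>M)) / (R n - z0))"
    by (intro ext) (simp add: Bochner_Integration.integral_diff[OF int[OF R(1)] int[OF z0]])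
  finally show "(\<lambda>n. ((\<integral>s. f (S n) s \<partial>M) - (\<integral>s. f z0 s \<partial>M)) / (S n - z0))
      \<longlonglongrightarrow> (\<integral>s. f' z0 s \<partial>M)"
    unfolding R_def by (rule LIMSEQ_offset)
qed

lemma has_real_derivative_of_complex:
  assumes "(F has_field_derivative complex_of_real d) (at (of_real u))"
    and "open S" "u \<in> S" "\<And>x. x \<in> S \<Longrightarrow> F (of_real x) = of_real (G x)"
  shows "(G has_real_derivative d) (at u)"
proof -
  have "((\<lambda>x. F (of_real x)) has_vector_derivative complex_of_real d) (at u)"
    by (rule has_vector_derivative_real_field[OF assms(1)])
  then have "((\<lambda>x. Re (F (of_real x))) has_vector_derivative Re (complex_of_real d)) (at u)"
    by (rule bounded_linear.has_vector_derivative[OF bounded_linear_Re])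
  then have "((\<lambda>x. Re (F (of_real x))) has_real_derivative d) (at u)"
    by (simp add: has_real_derivative_iff_has_vector_derivative)
  then show ?thesis
    by (rule has_field_derivative_transform_within_open[OF _ assms(2,3)]) (use assms(4) in auto)
qed

lemma pow_exp_bound:
  fixes u :: real
  assumes "0 < u" "0 \<le> x"
  shows "x * exp (- u * x) \<le> 2 / u * exp (- (u / 2) * x)"
proof -
  have "u / 2 * x \<le> exp (u / 2 * x)"
    using exp_ge_add_one_self[of "u / 2 * x"] by linarith
  then have "x * exp (- u * x) \<le> 2 / u * exp (u / 2 * x) * exp (- u * x)"
    using assms by (intro mult_right_mono) (auto simp: field_simps)
  also have "\<dots> = 2 / u * exp (- (u / 2) * x)"
    by (simp add: mult_exp_exp field_simps)
  finally show ?thesis .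
qed

text \<open>One power of \<open>x\<close> is paid for with half of the exponential rate, which is
  why integrability of the lower power is assumed for every positive rate.\<close>

lemma integrable_moment_Suc:
  fixes N :: "real measure"
  assumes sets: "sets N = sets borel" and pos: "AE x in N. 0 \<le> x"
    and int: "\<And>u. 0 < u \<Longrightarrow> integrable N (\<lambda>x. x ^ k * exp (- u * x))"
    and u: "0 < u"
  shows "integrable N (\<lambda>x. x ^ Suc k * exp (- u * x))"
proof (rule Bochner_Integration.integrable_bound)
  show "integrable N (\<lambda>x. 2 / u * (x ^ k * exp (- (u / 2) * x)))"
    using int[of "u / 2"] u by (intro integrable_mult_right) auto
  show "AE x in N. norm (x ^ Suc k * exp (- u * x)) \<le> norm (2 / u * (x ^ k * exp (- (u / 2) * x)))"
    using pos
  proof eventually_elim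
    case (elim x)
    have "x ^ k * (x * exp (- u * x)) \<le> x ^ k * (2 / u * exp (- (u / 2) * x))"
      using elim u pow_exp_bound by (intro mult_left_mono) auto
    then show ?case using elim u by (simp add: abs_mult mult_ac)
  qed
qed (use sets in measurable)

lemma moment_complex:
  fixes N :: "real measure"
  assumes sets: "sets N = sets borel" and pos: "AE x in N. 0 \<le> x"
    and int: "\<And>u. 0 < u \<Longrightarrow> integrable N (\<lambda>x. x ^ k * exp (- u * x))"
    and z: "0 < Re z"
  shows "integrable N (\<lambda>x. of_real (x ^ k) * exp (- z * complex_of_real x))"
proof (rule Bochner_Integration.integrable_bound[OF int[OF z]])
  show "AE x in N. norm (of_real (x ^ k) * exp (- z * complex_of_real x)) \<le> norm (x ^ k * exp (- Re z * x))"
    by (simp add: norm_mult norm_power norm_exp_eq_Re abs_mult power_abs)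
qed (use sets in measurable)

text \<open>On the ball of radius \<open>Re z / 2\<close> all derivatives are dominated by the
  integrand with rate \<open>Re z / 2\<close>. The measure is arbitrary because the lemma serves
  both a law, starting at \<open>k = 0\<close>, and a Levy measure, which may be infinite and has to
  start at \<open>k = 1\<close>.\<close>

lemma moment_has_derivative_complex:
  fixes N :: "real measure"
  assumes sets: "sets N = sets borel" and pos: "AE x in N. 0 \<le> x"
    and int: "\<And>u. 0 < u \<Longrightarrow> integrable N (\<lambda>x. x ^ k * exp (- u * x))"
    and z: "0 < Re z"
  shows "((\<lambda>z. \<integral>x. of_real (x ^ k) * exp (- z * complex_of_real x) \<partial>N) has_field_derivative
    - (\<integral>x. of_real (x ^ Suc k) * exp (- z * complex_of_real x) \<partial>N)) (at z)"
proof -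
  have ball: "Re z / 2 < Re y" if "y \<in> ball z (Re z / 2)" for y
    using that abs_Re_le_cmod[of "z - y"] by (auto simp: dist_norm)
  have "((\<lambda>z. \<integral>x. of_real (x ^ k) * exp (- z * complex_of_real x) \<partial>N) has_field_derivative
    (\<integral>x. - (of_real (x ^ Suc k) * exp (- z * complex_of_real x)) \<partial>N)) (at z)"
  proof (rule has_field_derivative_integral[where e = "Re z / 2"
        and g = "\<lambda>x. x ^ Suc k * exp (- (Re z / 2) * x)"])
    show "integrable N (\<lambda>x. of_real (x ^ k) * exp (- y * complex_of_real x))"
      if "y \<in> ball z (Re z / 2)" for y
      using moment_complex[OF assms(1-3)] ball[OF that] z by auto
    show "integrable N (\<lambda>x. x ^ Suc k * exp (- (Re z / 2) * x))"
      using integrable_moment_Suc[OF assms(1-3), of "Re z / 2"] z by simp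
    show "AE x in N. \<forall>z\<in>ball z (Re z / 2). ((\<lambda>z. of_real (x ^ k) * exp (- z * complex_of_real x))
       has_field_derivative - (of_real (x ^ Suc k) * exp (- z * complex_of_real x))) (at z)"
      by (intro AE_I2 ballI) (auto intro!: derivative_eq_intros)
    show "AE x in N. \<forall>y\<in>ball z (Re z / 2).
        norm (- (of_real (x ^ Suc k) * exp (- y * complex_of_real x))) \<le> x ^ Suc k * exp (- (Re z / 2) * x)"
      using pos
    proof eventually_elim
      case (elim x)
      show ?case
      proof
        fix y assume "y \<in> ball z (Re z / 2)"
        from ball[OF this] have "Re z / 2 * x \<le> Re y * x"
          using elim by (intro mult_right_mono) auto
        then have "x ^ Suc k * exp (- Re y * x) \<le> x ^ Suc k * exp (- (Re z / 2) * x)"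
          using elim by (intro mult_left_mono) auto
        then show "norm (- (of_real (x ^ Suc k) * exp (- y * complex_of_real x)))
            \<le> x ^ Suc k * exp (- (Re z / 2) * x)"
          using elim by (simp add: norm_mult norm_power norm_exp_eq_Re)
      qed
    qed
    show "(\<lambda>x. - (of_real (x ^ Suc k) * exp (- z * complex_of_real x))) \<in> borel_measurable N"
      using sets by measurable
  qed (use z in simp)
  then show ?thesis by (simp only: Bochner_Integration.integral_minus)
qed

lemma moment_of_real:
  "(\<integral>x. of_real (x ^ k) * exp (- complex_of_real u * complex_of_real x) \<partial>N)
    = of_real (\<integral>x. x ^ k * exp (- u * x) \<partial>N)"
proof -
  have "(\<integral>x. of_real (x ^ k) * exp (- complex_of_real u * complex_of_real x) \<partial>N)
    = (\<integral>x. complex_of_real (x ^ k * exp (- u * x)) \<partial>N)"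
    by (simp only: of_real_mult exp_of_real[symmetric] of_real_minus)
  then show ?thesis by (simp only: integral_complex_of_real)
qed

lemma moment_has_derivative:
  fixes N :: "real measure"
  assumes sets: "sets N = sets borel" and pos: "AE x in N. 0 \<le> x"
    and int: "\<And>u. 0 < u \<Longrightarrow> integrable N (\<lambda>x. x ^ k * exp (- u * x))"
    and u: "0 < u"
  shows "((\<lambda>u. \<integral>x. x ^ k * exp (- u * x) \<partial>N) has_real_derivative
    - (\<integral>x. x ^ Suc k * exp (- u * x) \<partial>N)) (at u)"
proof (rule has_real_derivative_of_complex)
  show "((\<lambda>z. \<integral>x. of_real (x ^ k) * exp (- z * complex_of_real x) \<partial>N) has_field_derivative
    of_real (- (\<integral>x. x ^ Suc k * exp (- u * x) \<partial>N))) (at (of_real u))"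
    using moment_has_derivative_complex[OF assms(1-3), of "of_real u"] u
    by (simp only: moment_of_real of_real_minus Re_complex_of_real)
qed (rule open_UNIV UNIV_I moment_of_real)+

section \<open>Levy measures of subordinators\<close>

text \<open>Here the measure lives on the whole Borel line and is merely concentrated on the
  positive half-line, so that dilations and products involve no restricted spaces.\<close>

locale subordinator_levy_measure =
  fixes N :: "real measure"
  assumes sets_N: "sets N = sets borel"
    and pos_N: "AE s in N. 0 < s"
    and fin_N: "(\<integral>\<^sup>+ s. ennreal (min 1 s) \<partial>N) < \<infinity>"
begin

declare sets_N [measurable_cong]

text \<open>On the positive half-line, \<open>moment 1\<close> is \<open>deriv \<phi> - b\<close>
  and \<open>moment 2\<close> is \<open>- deriv (deriv \<phi>)\<close> for the exponent \<phi> with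
  drift \<open>b\<close>; hence \<open>varphi \<phi> x\<close> becomes
  \<open>x\<^sup>2 * moment 2 x\<close>.\<close>

definition moment :: "nat \<Rightarrow> real \<Rightarrow> real" where
  "moment k u = (\<integral>s. s ^ k * exp (- u * s) \<partial>N)"

lemma nonneg_N: "AE s in N. 0 \<le> s"
  using pos_N by eventually_elim simp

lemma integrable_min: "integrable N (\<lambda>s. min 1 s)"
proof (rule integrableI_nonneg)
  show "AE s in N. 0 \<le> min 1 s"
    using nonneg_N by eventually_elim simp
qed (use fin_N in auto)

lemma integrable_N_bound:
  fixes f :: "real \<Rightarrow> 'b::{banach,second_countable_topology}"
  assumes "f \<in> borel_measurable borel" and "\<And>s. 0 < s \<Longrightarrow> norm (f s) \<le> K * min 1 s"
  shows "integrable N f"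
proof (rule Bochner_Integration.integrable_bound)
  show "integrable N (\<lambda>s. K * min 1 s)"
    by (intro integrable_mult_right integrable_min)
  show "AE s in N. norm (f s) \<le> norm (K * min 1 s)"
    using pos_N
  proof eventually_elim
    case (elim s)
    then show ?case using assms(2)[of s] by simp
  qed
qed (use assms in measurable)

lemma integrable_moment:
  assumes "1 \<le> k" "0 < u"
  shows "integrable N (\<lambda>s. s ^ k * exp (- u * s))"
  using assms
proof (induction k arbitrary: u rule: dec_induct)
  case base
  show ?case
  proof (rule integrable_N_bound)
    fix s :: real assume s: "0 < s"
    have "s * exp (- u * s) \<le> s * 1"
      using s base by (intro mult_left_mono) auto
    moreover have "2 / u * exp (- (u / 2) * s) \<le> 2 / u * 1"
      using s base by (intro mult_left_mono) auto
    with pow_exp_bound[OF base, of s] s have "s * exp (- u * s) \<le> 2 / u" by linarith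
    moreover have "s * 1 \<le> (1 + 2 / u) * s" "2 / u \<le> (1 + 2 / u) * 1"
      using s base by (auto simp: field_simps)
    ultimately have "s * exp (- u * s) \<le> (1 + 2 / u) * s" "s * exp (- u * s) \<le> (1 + 2 / u) * 1"
      by linarith+
    then have "s * exp (- u * s) \<le> (1 + 2 / u) * min 1 s"
      unfolding min_def by (cases "1 \<le> s") (simp_all only: if_True if_False)
    then show "norm (s ^ 1 * exp (- u * s)) \<le> (1 + 2 / u) * min 1 s"
      using s by (simp add: abs_mult)
  qed simp
next
  case (step k)
  show ?case
    by (rule integrable_moment_Suc[OF sets_N nonneg_N step.IH \<open>0 < u\<close>])
qed

lemma moment_nonneg: "0 \<le> moment k u"
  unfolding moment_def by (rule integral_nonneg_AE) (use nonneg_N in \<open>eventually_elim, simp\<close>)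

lemma moment_antimono:
  assumes "1 \<le> k" "0 < u" "u \<le> v"
  shows "moment k v \<le> moment k u"
  unfolding moment_def
proof (rule integral_mono_AE)
  show "AE s in N. s ^ k * exp (- v * s) \<le> s ^ k * exp (- u * s)"
    using nonneg_N by eventually_elim (use assms in \<open>auto intro!: mult_left_mono mult_right_mono\<close>)
qed (use assms integrable_moment in auto)

lemma moment_deriv:
  assumes "1 \<le> k" "0 < u"
  shows "(moment k has_real_derivative - moment (Suc k) u) (at u)"
  unfolding moment_def[abs_def]
  by (rule moment_has_derivative[OF sets_N nonneg_N integrable_moment assms(2)]) (use assms in auto)

text \<open>For large \<open>s\<close> the exponential has norm at most 1; for small
  \<open>s\<close> the mean value inequality is applied in the variable \<open>s\<close> along the
  nonnegative real axis, where the derivative has norm at most \<open>cmod z\<close>.\<close>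

lemma one_minus_exp_bound:
  assumes "0 \<le> Re z" "0 < s"
  shows "cmod (1 - exp (- z * complex_of_real s)) \<le> (2 + cmod z) * min 1 s"
proof -
  have "cmod (1 - exp (- z * complex_of_real s)) \<le> 1 + cmod (exp (- z * complex_of_real s))"
    using norm_triangle_ineq4[of 1 "exp (- z * complex_of_real s)"] by simp
  also have "\<dots> \<le> 2 + cmod z"
    using assms by (simp add: norm_exp_eq_Re add_increasing2)
  finally have 1: "cmod (1 - exp (- z * complex_of_real s)) \<le> 2 + cmod z" .
  have "cmod (exp (- z * complex_of_real s) - exp (- z * complex_of_real 0))
    \<le> cmod z * norm (complex_of_real s - complex_of_real 0)"
  proof (rule field_differentiable_bound[where S = "{w. Re w \<ge> 0 \<and> Im w = 0}" and f = "\<lambda>w. exp (- z * w)"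
        and f' = "\<lambda>w. - z * exp (- z * w)"])
    show "convex {w. Re w \<ge> 0 \<and> Im w = 0}"
      by (auto simp: convex_def)
    show "((\<lambda>w. exp (- z * w)) has_field_derivative - z * exp (- z * w))
        (at w within {w. 0 \<le> Re w \<and> Im w = 0})" for w
      by (auto intro!: derivative_eq_intros)
    show "cmod (- z * exp (- z * w)) \<le> cmod z" if "w \<in> {w. Re w \<ge> 0 \<and> Im w = 0}" for w
      using that assms by (simp add: norm_mult norm_exp_eq_Re mult_left_le)
  qed (use assms in auto)
  then have "cmod (1 - exp (- z * complex_of_real s)) \<le> cmod z * s"
    using assms by (simp add: norm_minus_commute)
  also have "\<dots> \<le> (2 + cmod z) * s"
    using assms by simp
  finally show ?thesis using 1 by (auto simp: min_def)
qed

lemma integrable_one_minus_exp_complex: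
  "0 \<le> Re z \<Longrightarrow> integrable N (\<lambda>s. 1 - exp (- z * complex_of_real s))"
  by (rule integrable_N_bound[OF _ one_minus_exp_bound]) auto

lemma one_minus_exp_of_real:
  "(\<integral>s. 1 - exp (- complex_of_real u * complex_of_real s) \<partial>N) = of_real (\<integral>s. 1 - exp (- u * s) \<partial>N)"
proof -
  have "(\<integral>s. 1 - exp (- complex_of_real u * complex_of_real s) \<partial>N)
    = (\<integral>s. complex_of_real (1 - exp (- u * s)) \<partial>N)"
    by (simp only: of_real_diff of_real_1 of_real_mult exp_of_real[symmetric] of_real_minus)
  then show ?thesis by (simp only: integral_complex_of_real)
qed

lemma integrable_one_minus_exp: "0 \<le> u \<Longrightarrow> integrable N (\<lambda>s. 1 - exp (- u * s))"
proof -
  assume u: "0 \<le> u"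
  have "integrable N (\<lambda>s. Re (1 - exp (- of_real u * complex_of_real s)))"
    by (intro integrable_Re integrable_one_minus_exp_complex) (use u in auto)
  then show ?thesis
    by (simp add: Re_exp)
qed

lemma one_minus_exp_has_derivative_complex:
  assumes z: "0 < Re z"
  shows "((\<lambda>z. \<integral>s. 1 - exp (- z * complex_of_real s) \<partial>N) has_field_derivative
    (\<integral>s. of_real s * exp (- z * complex_of_real s) \<partial>N)) (at z)"
proof (rule has_field_derivative_integral[where e = "Re z / 2"
      and g = "\<lambda>x. x ^ 1 * exp (- (Re z / 2) * x)"])
  have ball: "Re z / 2 < Re y" if "y \<in> ball z (Re z / 2)" for y
    using that abs_Re_le_cmod[of "z - y"] by (auto simp: dist_norm)
  show "integrable N (\<lambda>x. 1 - exp (- y * complex_of_real x))" if "y \<in> ball z (Re z / 2)" for y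
    using integrable_one_minus_exp_complex ball[OF that] z by auto
  show "integrable N (\<lambda>x. x ^ 1 * exp (- (Re z / 2) * x))"
    by (rule integrable_moment) (use z in auto)
  show "AE x in N. \<forall>z\<in>ball z (Re z / 2). ((\<lambda>z. 1 - exp (- z * complex_of_real x))
       has_field_derivative of_real x * exp (- z * complex_of_real x)) (at z)"
    by (intro AE_I2 ballI) (auto intro!: derivative_eq_intros)
  show "AE x in N. \<forall>y\<in>ball z (Re z / 2).
        norm (of_real x * exp (- y * complex_of_real x)) \<le> x ^ 1 * exp (- (Re z / 2) * x)"
    using nonneg_N
  proof eventually_elim
    case (elim x)
    show ?case
    proof
      fix y assume "y \<in> ball z (Re z / 2)"
      from ball[OF this] have "Re z / 2 * x \<le> Re y * x"
        using elim by (intro mult_right_mono) auto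
      then have "x * exp (- Re y * x) \<le> x * exp (- (Re z / 2) * x)"
        using elim by (intro mult_left_mono) auto
      then show "norm (of_real x * exp (- y * complex_of_real x)) \<le> x ^ 1 * exp (- (Re z / 2) * x)"
        using elim by (simp add: norm_mult norm_exp_eq_Re)
    qed
  qed
  show "(\<lambda>x. of_real x * exp (- z * complex_of_real x)) \<in> borel_measurable N"
    by measurable
qed (use z in simp)

lemma one_minus_exp_has_derivative:
  assumes "0 < u"
  shows "((\<lambda>u. \<integral>s. 1 - exp (- u * s) \<partial>N) has_real_derivative moment 1 u) (at u)"
proof (rule has_real_derivative_of_complex)
  show "((\<lambda>z. \<integral>s. 1 - exp (- z * complex_of_real s) \<partial>N) has_field_derivative
    of_real (moment 1 u)) (at (of_real u))"
    using one_minus_exp_has_derivative_complex[of "of_real u"] assms moment_of_real[where k = 1 and u = u and N = N]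
    by (simp add: moment_def)
qed (rule open_UNIV UNIV_I one_minus_exp_of_real)+

definition exponent :: "real \<Rightarrow> real \<Rightarrow> real" where
  "exponent b u = b * u + (\<integral>s. (1 - exp (- u * s)) \<partial>N)"

lemma exponent_deriv:
  assumes "0 < u"
  shows "(exponent b has_real_derivative b + moment 1 u) (at u)"
  unfolding exponent_def[abs_def]
    using DERIV_add[OF DERIV_cmult_Id one_minus_exp_has_derivative[OF assms], of b] by simp

lemma exponent_mono:
  assumes "0 \<le> b" "0 \<le> u" "u \<le> v"
  shows "exponent b u \<le> exponent b v"
  unfolding exponent_def
proof (intro add_mono mult_left_mono integral_mono_AE)
  show "AE s in N. 1 - exp (- u * s) \<le> 1 - exp (- v * s)"
    using nonneg_N by eventually_elim (use assms in \<open>auto intro!: mult_right_mono\<close>)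
qed (use assms integrable_one_minus_exp in auto)

lemma exponent_0 [simp]: "exponent b 0 = 0"
  by (simp add: exponent_def)

text \<open>Continuity at 0, by dominated convergence with majorant \<open>min 1 s\<close>. It
  supplies a point at which the exponent is negligible compared with \<open>1 / t\<close>.\<close>

lemma exponent_small:
  assumes "0 \<le> b" "0 < \<delta>"
  obtains u where "0 < u" "exponent b u < \<delta>"
proof -
  let ?r = "\<lambda>n. inverse (real (Suc n))"
  have "(\<lambda>n. \<integral>s. (1 - exp (- ?r n * s)) \<partial>N) \<longlonglongrightarrow> (\<integral>s. 0 \<partial>N)"
  proof (rule integral_dominated_convergence[where w = "\<lambda>s. min 1 s"])
    have "(\<lambda>n. 1 - exp (- ?r n * s)) \<longlonglongrightarrow> 1 - exp (- 0 * s)" for s :: real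
      by (intro tendsto_intros LIMSEQ_inverse_real_of_nat)
    then show "AE s in N. (\<lambda>n. 1 - exp (- ?r n * s)) \<longlonglongrightarrow> 0" by simp
    show "AE s in N. norm (1 - exp (- ?r n * s)) \<le> min 1 s" for n
      using nonneg_N
    proof eventually_elim
      case (elim s)
      have r: "0 < ?r n" "?r n \<le> 1" by (auto simp: divide_simps)
      have "?r n * s \<le> 1 * s" "0 \<le> ?r n * s"
        using r(2) elim by (rule mult_right_mono) (use r(1) elim in simp)
      then have "1 - exp (- ?r n * s) \<le> s" "0 \<le> 1 - exp (- ?r n * s)"
        using exp_ge_add_one_self[of "- ?r n * s"] by auto
      then show ?case by (auto simp: min_def)
    qed
  qed (use integrable_min in auto)
  then have "(\<lambda>n. exponent b (?r n)) \<longlonglongrightarrow> b * 0 + 0"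
    unfolding exponent_def
    by (intro tendsto_intros LIMSEQ_inverse_real_of_nat) auto
  then have "eventually (\<lambda>n. exponent b (?r n) < \<delta>) sequentially"
    using assms by (intro order_tendstoD(2)) auto
  then obtain n where "exponent b (?r n) < \<delta>"
    by (auto simp: eventually_sequentially)
  then show ?thesis by (intro that[of "?r n"]) auto
qed

text \<open>With \<open>v = u * s\<close>, the quadratic Taylor bound for \<open>exp v\<close>,
  multiplied by \<open>exp (- v)\<close>, gives
  \<open>v\<^sup>2 * exp (- v) \<le> 2 * (1 - exp (- v))\<close>. Thus \<open>varphi\<close> is
  dominated by twice the increasing exponent, which keeps its running supremum finite.\<close>

lemma moment_2_le_exponent:
  assumes "0 \<le> b" "0 < u"
  shows "u\<^sup>2 * moment 2 u \<le> 2 * exponent b u"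
proof -
  have "u\<^sup>2 * moment 2 u = (\<integral>s. u\<^sup>2 * (s ^ 2 * exp (- u * s)) \<partial>N)"
    by (simp add: moment_def)
  also have "\<dots> \<le> (\<integral>s. 2 * (1 - exp (- u * s)) \<partial>N)"
  proof (rule integral_mono_AE)
    show "AE s in N. u\<^sup>2 * (s ^ 2 * exp (- u * s)) \<le> 2 * (1 - exp (- u * s))"
      using nonneg_N
    proof eventually_elim
      case (elim s)
      have "0 \<le> u * s" using elim assms by simp
      then have "1 + u * s + (u * s)\<^sup>2 / 2 \<le> exp (u * s)"
        by (rule exp_lower_Taylor_quadratic)
      then have "(u * s)\<^sup>2 \<le> 2 * (exp (u * s) - 1)"
        using \<open>0 \<le> u * s\<close> by argo
      then have "(u * s)\<^sup>2 * exp (- u * s) \<le> 2 * (exp (u * s) - 1) * exp (- u * s)"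
        by (intro mult_right_mono) auto
      then show ?case by (simp add: mult_exp_exp algebra_simps power_mult_distrib)
    qed
  qed (intro integrable_mult_right integrable_moment integrable_one_minus_exp; use assms in simp)+
  also have "\<dots> = 2 * (\<integral>s. (1 - exp (- u * s)) \<partial>N)"
    by (rule integral_mult_right_zero)
  also have "\<dots> \<le> 2 * exponent b u"
    using assms unfolding exponent_def by simp
  finally show ?thesis .
qed

text \<open>A vanishing second moment forces \<open>s = 0\<close> almost everywhere, a condition
  free of \<open>u\<close>.\<close>

lemma moment_2_pos:
  assumes "0 < u" "0 < moment 2 v" "0 < v"
  shows "0 < moment 2 u"
proof (rule ccontr)
  assume "\<not> 0 < moment 2 u"
  then have "moment 2 u = 0" using moment_nonneg[of 2 u] by simp
  then have "AE s in N. s ^ 2 * exp (- u * s) = 0"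
    unfolding moment_def
    by (subst (asm) integral_nonneg_eq_0_iff_AE) (use integrable_moment[of 2 u] assms in auto)
  then have "AE s in N. s ^ 2 * exp (- v * s) = 0"
    by eventually_elim simp
  then have "moment 2 v = 0" unfolding moment_def by (subst integral_cong_AE[where g = "\<lambda>_. 0"]) auto
  with assms show False by simp
qed

end

section \<open>Fourier inversion\<close>

context real_distribution
begin

text \<open>The inverse Fourier integral. By conjugate symmetry of the characteristic function its
  value is already real; \<open>Re\<close> only changes the type.\<close>

definition inverse_char :: "real \<Rightarrow> real" where
  "inverse_char x = Re (1 / (2 * pi) * (CLINT t|lborel. iexp (- (t * x)) * char M t))"

lemma integrable_inverse_char:
  assumes "integrable lborel (char M)"
  shows "integrable lborel (\<lambda>t. iexp (- (t * x)) * char M t)"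
  by (rule Bochner_Integration.integrable_bound[OF assms]) (auto simp: norm_mult)

lemma isCont_inverse_integral:
  assumes "integrable lborel (char M)"
  shows "isCont (\<lambda>x. CLINT t|lborel. iexp (- (t * x)) * char M t) x"
  unfolding continuous_at_sequentially
proof (intro allI impI, unfold comp_def)
  fix X assume X: "X \<longlonglongrightarrow> x"
  show "(\<lambda>n. CLINT t|lborel. iexp (- (t * X n)) * char M t) \<longlonglongrightarrow> (CLINT t|lborel. iexp (- (t * x)) * char M t)"
  proof (rule integral_dominated_convergence[where w = "\<lambda>t. norm (char M t)"])
    show "AE t in lborel. (\<lambda>n. iexp (- (t * X n)) * char M t) \<longlonglongrightarrow> iexp (- (t * x)) * char M t"
      by (intro AE_I2 tendsto_intros X)
  qed (use assms in \<open>auto simp: norm_mult\<close>)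
qed

lemma isCont_inverse_char:
  assumes "integrable lborel (char M)"
  shows "isCont inverse_char x"
  unfolding inverse_char_def
  by (intro isCont_Re isCont_mult isCont_inverse_integral[OF assms] continuous_const)

lemma set_integral_iexp:
  assumes "a \<le> b" "t \<noteq> 0"
  shows "(CLINT x|lborel. indicator {a..b} x *\<^sub>R iexp (- (t * x)))
    = (iexp (- (t * a)) - iexp (- (t * b))) / (\<i> * t)"
proof -
  have "(CLINT x|lborel. indicator {a..b} x *\<^sub>R iexp (- (t * x)))
    = \<i> / t * iexp (- (t * b)) - \<i> / t * iexp (- (t * a))"
  proof (rule integral_FTC_atLeastAtMost[OF assms(1)])
    fix x
    have "((\<lambda>z. \<i> / t * exp (\<i> * (- (t * z)))) has_field_derivative iexp (- (t * x))) (at (complex_of_real x))"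
      using assms(2) by (auto intro!: derivative_eq_intros simp: field_simps)
    from has_vector_derivative_real_field[OF this]
    show "((\<lambda>x. \<i> / t * iexp (- (t * x))) has_vector_derivative iexp (- (t * x))) (at x within {a..b})"
      by simp
  qed (intro continuous_intros)
  also have "\<dots> = (iexp (- (t * a)) - iexp (- (t * b))) / (\<i> * t)"
    using assms(2) by (simp add: divide_simps) (simp add: algebra_simps)
  finally show ?thesis .
qed

text \<open>The kernel of Levy's inversion formula is itself the integral of
  \<open>iexp (- (t * x))\<close> over \<open>{a..b}\<close>, and integrability of
  \<open>char M\<close> permits Fubini.\<close>

lemma inverse_char_interval_aux:
  assumes int: "integrable lborel (char M)" and ab: "a \<le> b"
  shows "(CLINT t|lborel. (iexp (- (t * a)) - iexp (- (t * b))) / (\<i> * t) * char M t)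
    = (CLINT x|lborel. indicator {a..b} x *\<^sub>R (CLINT t|lborel. iexp (- (t * x)) * char M t))"
proof -
  have fub: "integrable (lborel \<Otimes>\<^sub>M lborel)
      (\<lambda>(t, x). indicator {a..b} x *\<^sub>R (iexp (- (t * x)) * char M t))"
  proof (rule Bochner_Integration.integrable_bound)
    have 2: "integrable lborel (\<lambda>x. indicator {a..b} x :: real)"
      by (rule integrable_real_indicator) (auto simp: emeasure_lborel_Icc_eq)
    have "integrable (lborel \<Otimes>\<^sub>M lborel) (\<lambda>(t, x). cmod (char M t) * indicator {a..b} x)"
      by (rule lborel_pair.Fubini_integrable)
        (use int 2 in \<open>auto simp: abs_mult intro!: integrable_mult_left integrable_mult_right\<close>)
    then show "integrable (lborel \<Otimes>\<^sub>M lborel) (\<lambda>(t, x). cmod (char M t) * indicator {a..b} x)" .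
  qed (auto simp: norm_mult split: split_indicator)
  have "(CLINT t|lborel. (iexp (- (t * a)) - iexp (- (t * b))) / (\<i> * t) * char M t)
    = (CLINT t|lborel. CLINT x|lborel. indicator {a..b} x *\<^sub>R (iexp (- (t * x)) * char M t))"
  proof (rule integral_cong_AE)
    have "AE t in lborel. t \<noteq> (0::real)" by (rule AE_lborel_singleton)
    then show "AE t in lborel. (iexp (- (t * a)) - iexp (- (t * b))) / (\<i> * t) * char M t
        = (CLINT x|lborel. indicator {a..b} x *\<^sub>R (iexp (- (t * x)) * char M t))"
    proof eventually_elim
      case (elim t)
      have "(CLINT x|lborel. indicator {a..b} x *\<^sub>R (iexp (- (t * x)) * char M t))
        = (CLINT x|lborel. (indicator {a..b} x *\<^sub>R iexp (- (t * x))) * char M t)"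
        by simp
      also have "\<dots> = (CLINT x|lborel. indicator {a..b} x *\<^sub>R iexp (- (t * x))) * char M t"
        by (rule integral_mult_left_zero)
      finally show ?case by (simp only: set_integral_iexp[OF ab elim])
    qed
  next
    show "(\<lambda>t. CLINT x|lborel. indicator {a..b} x *\<^sub>R (iexp (- (t * x)) * char M t)) \<in> borel_measurable lborel"
      by measurable
  qed measurable
  also have "\<dots> = (CLINT x|lborel. CLINT t|lborel. indicator {a..b} x *\<^sub>R (iexp (- (t * x)) * char M t))"
    by (rule lborel_pair.Fubini_integral[OF fub, symmetric])
  also have "\<dots> = (CLINT x|lborel. indicator {a..b} x *\<^sub>R (CLINT t|lborel. iexp (- (t * x)) * char M t))"
    by (simp only: integral_scaleR_right)
  finally show ?thesis .
qed

text \<open>Levy's formula is a limit over symmetric intervals and excludes atoms at the end points.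
  Dominated convergence turns the limit into one integral; the atoms are dealt with
  afterwards.\<close>

lemma inverse_char_interval_nonatom:
  assumes int: "integrable lborel (char M)" and ab: "a \<le> b"
    and atoms: "measure M {a} = 0" "measure M {b} = 0"
  shows "measure M {a<..b} = (\<integral>x. indicator {a..b} x * inverse_char x \<partial>lborel)"
proof -
  let ?G = "\<lambda>t. (iexp (- (t * a)) - iexp (- (t * b))) / (\<i> * t) * char M t"
  let ?Q = "\<lambda>x. CLINT t|lborel. iexp (- (t * x)) * char M t"
  have Gbound: "norm (?G t) \<le> (b - a) * norm (char M t)" for t
  proof (cases "t = 0")
    case False
    from Levy_Inversion_aux2[of "-b" "-a" t] ab False
    have "norm ((iexp (- (t * a)) - iexp (- (t * b))) / (\<i> * t)) \<le> b - a" by simp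
    then show ?thesis by (subst norm_mult) (intro mult_right_mono, auto)
  qed (use ab in simp)
  have intG: "integrable lborel ?G"
    by (rule Bochner_Integration.integrable_bound[OF integrable_mult_right[OF integrable_norm[OF int], of "b - a"]])
      (use Gbound ab in \<open>auto simp: abs_mult intro: order.trans\<close>)
  have "(\<lambda>n::nat. CLINT t|lborel. indicator {- real n..real n} t *\<^sub>R ?G t) \<longlonglongrightarrow> (CLINT t|lborel. ?G t)"
  proof (rule integral_dominated_convergence[where w = "\<lambda>t. norm (?G t)"])
    show "AE t in lborel. (\<lambda>n. indicator {- real n..real n} t *\<^sub>R ?G t) \<longlonglongrightarrow> ?G t"
    proof (intro AE_I2 tendsto_eventually)
      fix t :: real
      obtain n0 where n0: "\<bar>t\<bar> \<le> real n0" using real_arch_simple by blast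
      show "\<forall>\<^sub>F n in sequentially. indicator {- real n..real n} t *\<^sub>R ?G t = ?G t"
        using eventually_ge_at_top[of n0] by eventually_elim (use n0 in \<open>auto split: split_indicator\<close>)
    qed
    show "integrable lborel (\<lambda>t. norm (?G t))" using intG by (rule integrable_norm)
    show "AE t in lborel. norm (indicator {- real n..real n} t *\<^sub>R ?G t) \<le> norm (?G t)" for n
      by (auto split: split_indicator)
  qed measurable
  moreover have "(CLBINT t=- real n..real n. ?G t) = (CLINT t|lborel. indicator {- real n..real n} t *\<^sub>R ?G t)" for n
    by (subst interval_integral_Icc) (auto simp: set_lebesgue_integral_def)
  ultimately have "(\<lambda>n::nat. 1 / (2 * pi) * (CLBINT t=- real n..real n. ?G t))
      \<longlonglongrightarrow> 1 / (2 * pi) * (CLINT t|lborel. ?G t)"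
    by (intro tendsto_intros) simp
  moreover have "(\<lambda>n::nat. 1 / (2 * pi) * (CLBINT t=- real n..real n. ?G t)) \<longlonglongrightarrow> of_real (measure M {a<..b})"
    using Levy_Inversion[OF ab atoms] by simp
  ultimately have "of_real (measure M {a<..b}) = 1 / (2 * pi) * (CLINT t|lborel. ?G t)"
    by (intro LIMSEQ_unique)
  also have "\<dots> = 1 / (2 * pi) * (CLINT x|lborel. indicator {a..b} x *\<^sub>R ?Q x)"
    by (simp only: inverse_char_interval_aux[OF int ab])
  also have "\<dots> = (CLINT x|lborel. 1 / (2 * pi) * (indicator {a..b} x *\<^sub>R ?Q x))"
    by (rule integral_mult_right_zero[symmetric])
  finally have *: "of_real (measure M {a<..b}) = (CLINT x|lborel. 1 / (2 * pi) * (indicator {a..b} x *\<^sub>R ?Q x))" .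
  have "set_integrable lborel {a..b} ?Q"
  proof (rule borel_integrable_atLeastAtMost')
    show "continuous_on {a..b} ?Q"
      by (intro continuous_at_imp_continuous_on ballI isCont_inverse_integral[OF int])
  qed
  then have "integrable lborel (\<lambda>x. 1 / (2 * pi) * (indicator {a..b} x *\<^sub>R ?Q x))"
    unfolding set_integrable_def by (intro integrable_mult_right) auto
  from integral_Re[OF this] * have
    "measure M {a<..b} = (\<integral>x. Re (1 / (2 * pi) * (indicator {a..b} x *\<^sub>R ?Q x)) \<partial>lborel)"
    by (metis Re_complex_of_real)
  also have "\<dots> = (\<integral>x. indicator {a..b} x * inverse_char x \<partial>lborel)"
    by (intro Bochner_Integration.integral_cong) (auto simp: inverse_char_def split: split_indicator)
  finally show ?thesis .
qed

lemma exists_nonatom_between: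
  assumes "x < (y::real)"
  obtains z where "x < z" "z < y" "measure M {z} = 0"
proof -
  have "uncountable {x<..<y}"
    using assms by (simp add: uncountable_open_interval)
  then have "\<not> {x<..<y} \<subseteq> {z. measure M {z} \<noteq> 0}"
    using countable_support countable_subset by auto
  then show ?thesis using that by auto
qed

lemma inverse_char_bound:
  assumes "integrable lborel (char M)"
  shows "\<bar>inverse_char x\<bar> \<le> (\<integral>t. norm (char M t) \<partial>lborel)"
proof -
  have "\<bar>inverse_char x\<bar> \<le> norm (1 / (2 * pi) * (CLINT t|lborel. iexp (- (t * x)) * char M t))"
    unfolding inverse_char_def by (rule abs_Re_le_cmod)
  also have "\<dots> = 1 / (2 * pi) * norm (CLINT t|lborel. iexp (- (t * x)) * char M t)"
    by (simp add: norm_mult norm_divide)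
  also have "\<dots> \<le> 1 * norm (CLINT t|lborel. iexp (- (t * x)) * char M t)"
    using pi_gt3 by (intro mult_right_mono) auto
  also have "\<dots> \<le> (\<integral>t. norm (iexp (- (t * x)) * char M t) \<partial>lborel)"
    by (simp only: mult_1) (rule integral_norm_bound)
  also have "\<dots> = (\<integral>t. norm (char M t) \<partial>lborel)"
    by (simp add: norm_mult)
  finally show ?thesis .
qed

lemma integrable_indicator_inverse_char:
  assumes "integrable lborel (char M)"
  shows "integrable lborel (\<lambda>x. indicator {a..b} x * inverse_char x)"
  using borel_integrable_atLeastAtMost'[OF continuous_at_imp_continuous_on, of a b inverse_char]
    isCont_inverse_char[OF assms]
  by (simp add: set_integrable_def)

text \<open>As only countably many points are atoms, \<open>x\<close> is enclosed in arbitrarily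
  short intervals with admissible end points, whose mass is at most \<open>K\<close> times their
  length.\<close>

lemma no_atoms_of_integrable_char:
  assumes int: "integrable lborel (char M)"
  shows "measure M {x} = 0"
proof (rule antisym)
  define K where "K = (\<integral>t. norm (char M t) \<partial>lborel)"
  have K: "0 \<le> K" unfolding K_def by (intro Bochner_Integration.integral_nonneg) simp
  show "measure M {x} \<le> 0"
  proof (rule field_le_epsilon)
    fix \<epsilon> :: real assume \<epsilon>: "0 < \<epsilon>"
    define \<delta> where "\<delta> = \<epsilon> / (2 * (K + 1))"
    have \<delta>: "0 < \<delta>" using \<epsilon> K by (simp add: \<delta>_def)
    obtain a where a: "x - \<delta> < a" "a < x" "measure M {a} = 0"
      using exists_nonatom_between[of "x - \<delta>" x] \<delta> by auto
    obtain b where b: "x < b" "b < x + \<delta>" "measure M {b} = 0"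
      using exists_nonatom_between[of x "x + \<delta>"] \<delta> by auto
    have "measure M {x} \<le> measure M {a<..b}"
      by (rule finite_measure_mono) (use a b in auto)
    also have "\<dots> = (\<integral>x. indicator {a..b} x * inverse_char x \<partial>lborel)"
      by (rule inverse_char_interval_nonatom[OF int]) (use a b in auto)
    also have "\<dots> \<le> (\<integral>x. indicator {a..b} x * K \<partial>lborel)"
    proof (rule integral_mono[OF integrable_indicator_inverse_char[OF int]])
      show "integrable lborel (\<lambda>x. indicator {a..b} x * K)"
        by (intro integrable_mult_left integrable_real_indicator) (auto simp: emeasure_lborel_Icc_eq)
      show "indicator {a..b} x * inverse_char x \<le> indicator {a..b} x * K" for x
        using inverse_char_bound[OF int, of x] by (intro mult_left_mono) (auto simp: K_def)
    qed
    also have "\<dots> = (b - a) * K"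
      using a b by simp
    also have "\<dots> \<le> (2 * \<delta>) * (K + 1)"
      using a b K by (intro mult_mono) auto
    also have "\<dots> = \<epsilon>"
      using K by (auto simp: \<delta>_def field_simps add_eq_0_iff)
    finally show "measure M {x} \<le> 0 + \<epsilon>" by simp
  qed
qed simp

lemma measure_Ioc_inverse_char:
  assumes "integrable lborel (char M)" "a \<le> b"
  shows "measure M {a<..b} = (\<integral>x. indicator {a..b} x * inverse_char x \<partial>lborel)"
  by (intro inverse_char_interval_nonatom no_atoms_of_integrable_char assms)

lemma inverse_char_nonneg:
  assumes int: "integrable lborel (char M)"
  shows "0 \<le> inverse_char x"
proof (rule ccontr)
  assume neg: "\<not> 0 \<le> inverse_char x"
  define e where "e = - inverse_char x / 2"
  have e: "0 < e" "inverse_char x < - e" using neg by (auto simp: e_def)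
  have "eventually (\<lambda>y. inverse_char y < - e) (nhds x)"
    using isCont_inverse_char[OF int, of x, unfolded isCont_def tendsto_at_iff_tendsto_nhds] e(2)
    by (rule order_tendstoD(2))
  then obtain d where d: "0 < d" "\<And>y. dist y x < d \<Longrightarrow> inverse_char y < - e"
    by (auto simp: eventually_nhds_metric)
  define b where "b = x + d / 2"
  have "measure M {x<..b} = (\<integral>y. indicator {x..b} y * inverse_char y \<partial>lborel)"
    by (rule measure_Ioc_inverse_char[OF int]) (use d in \<open>simp add: b_def\<close>)
  also have "\<dots> \<le> (\<integral>y. indicator {x..b} y * (- e) \<partial>lborel)"
  proof (rule integral_mono[OF integrable_indicator_inverse_char[OF int]])
    show "integrable lborel (\<lambda>y. indicator {x..b} y * (- e))"
      by (intro integrable_mult_left integrable_real_indicator) (auto simp: emeasure_lborel_Icc_eq)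
    show "indicator {x..b} y * inverse_char y \<le> indicator {x..b} y * (- e)" for y
      using d(2)[of y] d(1) by (auto simp: b_def dist_real_def split: split_indicator)
  qed
  also have "\<dots> = - (d / 2 * e)"
    using d by (simp add: b_def)
  also have "\<dots> < 0" using d e by simp
  finally show False by (simp add: not_less)
qed

text \<open>Right half-lines are exhausted by the intervals \<open>{x<..x + real n}\<close>, to
  which the inversion formula applies.\<close>

theorem density_inverse_char:
  assumes int: "integrable lborel (char M)"
  shows "M = density lborel (\<lambda>x. ennreal (inverse_char x))"
proof (rule measure_eqI_lessThan)
  have [measurable]: "inverse_char \<in> borel_measurable borel"
    by (intro borel_measurable_continuous_onI continuous_at_imp_continuous_on ballI isCont_inverse_char[OF int])
  fix x
  define D where "D = density lborel (\<lambda>x. ennreal (inverse_char x))"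
  have [measurable_cong]: "sets D = sets borel" by (simp add: D_def)
  let ?A = "\<lambda>n::nat. {x<..x + real n}"
  have U: "(\<Union>n. ?A n) = {x<..}"
  proof (intro equalityI subsetI)
    fix y assume "y \<in> {x<..}"
    moreover obtain n where "y - x \<le> real n" using real_arch_simple by blast
    ultimately show "y \<in> (\<Union>n. ?A n)" by (auto intro!: exI[of _ n])
  qed auto
  have inc: "incseq ?A" by (auto simp: incseq_def)
  have "emeasure M (?A n) = emeasure D (?A n)" for n
  proof -
    have "emeasure M (?A n) = ennreal (\<integral>y. indicator {x..x + real n} y * inverse_char y \<partial>lborel)"
      by (simp add: emeasure_eq_measure measure_Ioc_inverse_char[OF int])
    also have "\<dots> = (\<integral>\<^sup>+y. ennreal (indicator {x..x + real n} y * inverse_char y) \<partial>lborel)"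
      by (rule nn_integral_eq_integral[symmetric, OF integrable_indicator_inverse_char[OF int]])
        (auto simp: inverse_char_nonneg[OF int])
    also have "\<dots> = (\<integral>\<^sup>+y. ennreal (inverse_char y) * indicator (?A n) y \<partial>lborel)"
    proof (rule nn_integral_cong_AE)
      have "AE y in lborel. y \<noteq> x" by (rule AE_lborel_singleton)
      then show "AE y in lborel. ennreal (indicator {x..x + real n} y * inverse_char y)
          = ennreal (inverse_char y) * indicator (?A n) y"
        by eventually_elim (auto split: split_indicator)
    qed
    also have "\<dots> = emeasure D (?A n)"
      unfolding D_def by (rule emeasure_density[symmetric]) auto
    finally show ?thesis .
  qed
  then have "(SUP n. emeasure M (?A n)) = (SUP n. emeasure D (?A n))" by simp
  then show "emeasure M {x<..} = emeasure (density lborel (\<lambda>x. ennreal (inverse_char x))) {x<..}"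
    using SUP_emeasure_incseq[of ?A M] SUP_emeasure_incseq[of ?A D] inc
    by (simp add: U D_def image_subset_iff)
  show "emeasure M {x<..} < \<infinity>"
    by (simp add: emeasure_eq_measure)
qed auto

lemma inverse_char_lipschitz:
  assumes int: "integrable lborel (char M)" and int1: "integrable lborel (\<lambda>t. t * char M t)"
  shows "\<bar>inverse_char x - inverse_char y\<bar> \<le> (\<integral>t. \<bar>t\<bar> * norm (char M t) \<partial>lborel) * \<bar>x - y\<bar>"
proof -
  let ?Q = "\<lambda>x. CLINT t|lborel. iexp (- (t * x)) * char M t"
  have "\<bar>inverse_char x - inverse_char y\<bar> = \<bar>Re (1 / (2 * pi) * (?Q x - ?Q y))\<bar>"
    unfolding inverse_char_def by (simp only: right_diff_distrib minus_complex.sel)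
  also have "\<dots> \<le> norm (1 / (2 * pi) * (?Q x - ?Q y))"
    by (rule abs_Re_le_cmod)
  also have "\<dots> = 1 / (2 * pi) * norm (?Q x - ?Q y)"
    by (simp add: norm_mult norm_divide)
  also have "\<dots> \<le> 1 * norm (?Q x - ?Q y)"
    using pi_gt3 by (intro mult_right_mono) auto
  also have "?Q x - ?Q y = (CLINT t|lborel. (iexp (- (t * x)) - iexp (- (t * y))) * char M t)"
    by (simp only: left_diff_distrib)
      (rule Bochner_Integration.integral_diff[symmetric]; rule integrable_inverse_char[OF int])
  also have "1 * norm \<dots> \<le> (\<integral>t. \<bar>x - y\<bar> * (\<bar>t\<bar> * norm (char M t)) \<partial>lborel)"
    unfolding mult_1
  proof (rule order.trans[OF integral_norm_bound Bochner_Integration.integral_mono[OF integrable_norm]])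
    show "integrable lborel (\<lambda>t. (iexp (- (t * x)) - iexp (- (t * y))) * char M t)"
      unfolding left_diff_distrib by (intro Bochner_Integration.integrable_diff integrable_inverse_char int)
    have "integrable lborel (\<lambda>t. \<bar>t\<bar> * norm (char M t))"
      using integrable_norm[OF int1] by (simp add: norm_mult)
    then show "integrable lborel (\<lambda>t. \<bar>x - y\<bar> * (\<bar>t\<bar> * norm (char M t)))"
      by (rule integrable_mult_right)
    fix t :: real
    have "norm (iexp (- (t * x)) - iexp (- (t * y))) \<le> \<bar>t\<bar> * \<bar>x - y\<bar>"
    proof -
      have "iexp (- (t * x)) - iexp (- (t * y)) = iexp (- (t * y)) * (iexp (- (t * (x - y))) - 1)"
        by (simp add: right_diff_distrib mult_exp_exp)
      then have "norm (iexp (- (t * x)) - iexp (- (t * y))) = norm (iexp (- (t * (x - y))) - 1)"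
        by (simp add: norm_mult)
      also have "\<dots> \<le> \<bar>- (t * (x - y))\<bar>"
        using iexp_approx1[of "- (t * (x - y))" 0] by simp
      finally show ?thesis by (simp add: abs_mult)
    qed
    then have "norm (iexp (- (t * x)) - iexp (- (t * y))) * norm (char M t) \<le> \<bar>t\<bar> * \<bar>x - y\<bar> * norm (char M t)"
      by (rule mult_right_mono) simp
    then show "norm ((iexp (- (t * x)) - iexp (- (t * y))) * char M t) \<le> \<bar>x - y\<bar> * (\<bar>t\<bar> * norm (char M t))"
      by (simp only: norm_mult mult_ac)
  qed
  also have "\<dots> = \<bar>x - y\<bar> * (\<integral>t. \<bar>t\<bar> * norm (char M t) \<partial>lborel)"
    by (rule integral_mult_right_zero)
  finally show ?thesis by (simp add: mult.commute)
qed

end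

section \<open>Exponential tilting and Steutel's equation\<close>

context subordinator_levy_measure
begin

text \<open>Needed for Fubini in Steutel's equation. Integrability of \<open>min 1 s\<close> gives
  finite mass to sets bounded away from 0, and the null set \<open>{..0}\<close> completes the
  cover.\<close>

lemma sigma_finite_N: "sigma_finite_measure N"
proof
  define A where "A n = {inverse (real (Suc n))<..}" for n
  have "emeasure N (A n) < \<infinity>" for n
  proof -
    have "integrable N (indicator (A n) :: real \<Rightarrow> real)"
    proof (rule integrable_N_bound)
      show "norm (indicator (A n) s :: real) \<le> real (Suc n) * min 1 s" if "0 < s" for s
        using that by (auto simp: A_def min_def field_simps split: split_indicator)
    qed (simp add: A_def)
    then show ?thesis by (simp add: A_def integrable_indicator_iff less_top)
  qed
  moreover have "emeasure N {..0} = 0"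
    using pos_N by (subst (asm) AE_iff_measurable[where N = "{..0}"]) (auto simp: sets_eq_imp_space_eq[OF sets_N] not_less)
  moreover have "insert {..0} (range A) \<subseteq> sets N"
    by (auto simp: A_def)
  moreover have "x \<in> \<Union> (insert {..0} (range A))" for x
  proof (cases "x \<le> 0")
    case False
    then obtain n where "inverse (real (Suc n)) < x"
      using reals_Archimedean by (metis not_le)
    then show ?thesis by (auto simp: A_def)
  qed auto
  then have "\<Union> (insert {..0} (range A)) = space N"
    by (auto simp: sets_eq_imp_space_eq[OF sets_N])
  ultimately show "\<exists>A. countable A \<and> A \<subseteq> sets N \<and> \<Union> A = space N \<and> (\<forall>a\<in>A. emeasure N a \<noteq> \<infinity>)"
    by (intro exI[of _ "insert {..0} (range A)"]) (auto simp: less_top[symmetric])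
qed

text \<open>The holomorphic continuation of \<open>exponent\<close> to the right half-plane; its
  values on the line \<open>Re z = 1\<close> encode the characteristic function of the tilted
  law.\<close>

definition cexponent :: "real \<Rightarrow> complex \<Rightarrow> complex" where
  "cexponent b z = b * z + (\<integral>s. 1 - exp (- z * complex_of_real s) \<partial>N)"

lemma cexponent_of_real: "cexponent b (of_real u) = of_real (exponent b u)"
  unfolding cexponent_def exponent_def one_minus_exp_of_real by simp

definition cmoment :: "complex \<Rightarrow> complex" where
  "cmoment z = (\<integral>s. of_real s * exp (- z * complex_of_real s) \<partial>N)"

lemma cexponent_deriv:
  assumes "0 < Re z"
  shows "(cexponent b has_field_derivative b + cmoment z) (at z)"
  unfolding cexponent_def[abs_def] cmoment_def
  using DERIV_add[OF DERIV_cmult_Id one_minus_exp_has_derivative_complex[OF assms], of "of_real b"] by simp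

lemma isCont_cmoment:
  assumes "0 < Re z"
  shows "isCont cmoment z"
proof -
  have "((\<lambda>z. \<integral>x. of_real (x ^ 1) * exp (- z * complex_of_real x) \<partial>N) has_field_derivative
    - (\<integral>x. of_real (x ^ Suc 1) * exp (- z * complex_of_real x) \<partial>N)) (at z)"
    by (rule moment_has_derivative_complex[OF sets_N nonneg_N integrable_moment assms]) auto
  from DERIV_isCont[OF this] show ?thesis
    unfolding cmoment_def[abs_def] by simp
qed

lemma norm_cmoment_le:
  assumes "0 < Re z"
  shows "norm (cmoment z) \<le> moment 1 (Re z)"
proof -
  have "norm (cmoment z) \<le> (\<integral>s. norm (of_real s * exp (- z * complex_of_real s)) \<partial>N)"
    unfolding cmoment_def by (rule integral_norm_bound)
  also have "\<dots> = moment 1 (Re z)"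
    unfolding moment_def
  proof (rule integral_cong_AE)
    show "AE s in N. norm (of_real s * exp (- z * complex_of_real s)) = s ^ 1 * exp (- Re z * s)"
      using nonneg_N by eventually_elim (auto simp: norm_mult norm_exp_eq_Re)
  qed measurable
  finally show ?thesis .
qed

end

text \<open>A single law at a single time: both the time and the dilation are absorbed into
  \<open>N\<close> and \<open>b\<close>, so that uniformity in time becomes uniformity over such
  triples.\<close>

locale subordinator_law = subordinator_levy_measure N + real_distribution M
  for N M :: "real measure" +
  fixes b :: real
  assumes b_nonneg: "0 \<le> b"
    and nonneg_M: "AE x in M. 0 \<le> x"
    and laplace: "\<And>u. 0 < u \<Longrightarrow> (\<integral>x. exp (- u * x) \<partial>M) = exp (- exponent b u)"
begin

lemma integrable_exp_M: "0 < u \<Longrightarrow> integrable M (\<lambda>x. x ^ 0 * exp (- u * x))"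
  by (rule integrable_const_bound[where B = 1])
    (use nonneg_M in \<open>auto elim!: eventually_mono\<close>)

lemma integrable_M_moment: "0 < u \<Longrightarrow> integrable M (\<lambda>x. x ^ k * exp (- u * x))"
proof (induction k arbitrary: u)
  case 0
  then show ?case by (rule integrable_exp_M)
next
  case (Suc k)
  show ?case by (rule integrable_moment_Suc[OF events_eq_borel nonneg_M Suc])
qed

text \<open>Both sides are holomorphic for \<open>Re z > 0\<close> and agree on the positive reals,
  which accumulate at 1, so analytic continuation applies.\<close>

lemma laplace_complex:
  assumes "0 < Re z"
  shows "(\<integral>x. exp (- z * complex_of_real x) \<partial>M) = exp (- cexponent b z)"
proof -
  let ?S = "{z. 0 < Re z}" and ?U = "complex_of_real ` {0<..}"
  have S: "open ?S" by (rule open_halfspace_Re_gt)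
  have "(\<integral>x. exp (- z * complex_of_real x) \<partial>M) - exp (- cexponent b z) = 0"
  proof (rule analytic_continuation[where S = ?S and U = ?U and \<xi> = 1
        and f = "\<lambda>z. (\<integral>x. exp (- z * complex_of_real x) \<partial>M) - exp (- cexponent b z)"])
    have 1: "(\<lambda>z. \<integral>x. exp (- z * complex_of_real x) \<partial>M) holomorphic_on ?S"
      unfolding holomorphic_on_open[OF S]
      using moment_has_derivative_complex[OF events_eq_borel nonneg_M integrable_M_moment, of _ 0]
      by (auto simp del: of_real_power)
    have 2: "cexponent b holomorphic_on ?S"
      unfolding holomorphic_on_open[OF S] using cexponent_deriv by auto
    show "(\<lambda>z. (\<integral>x. exp (- z * complex_of_real x) \<partial>M) - exp (- cexponent b z)) holomorphic_on ?S"
      by (intro holomorphic_intros 1 2)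
    show "open ?S" by (rule S)
    show "connected ?S" by (intro convex_connected convex_halfspace_Re_gt)
    show "1 islimpt ?U"
      unfolding islimpt_approachable
    proof (intro allI impI)
      fix e :: real assume "0 < e"
      then show "\<exists>x'\<in>?U. x' \<noteq> 1 \<and> dist x' 1 < e"
        by (intro bexI[OF _ imageI[of "1 + e / 2"]]) (auto simp: dist_norm norm_divide)
    qed
    show "(\<integral>x. exp (- z * complex_of_real x) \<partial>M) - exp (- cexponent b z) = 0" if zU: "z \<in> ?U" for z
    proof -
      obtain u where u: "z = of_real u" "0 < u" using zU by auto
      have "(\<integral>x. exp (- z * complex_of_real x) \<partial>M) = of_real (\<integral>x. exp (- u * x) \<partial>M)"
        using moment_of_real[where k = 0 and u = u and N = M] by (simp add: u)
      then show ?thesis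
        using laplace[OF u(2)] by (simp add: u cexponent_of_real flip: exp_of_real)
    qed
  qed (use assms in auto)
  then show ?thesis by simp
qed

text \<open>Like the second moment below, this comes from computing the derivative of a Laplace
  transform in two ways.\<close>

lemma M_moment_1: "0 < u \<Longrightarrow> (\<integral>x. x * exp (- u * x) \<partial>M) = (b + moment 1 u) * exp (- exponent b u)"
proof -
  assume u: "0 < u"
  have "((\<lambda>u. \<integral>x. x ^ 0 * exp (- u * x) \<partial>M) has_real_derivative
      - (\<integral>x. x ^ Suc 0 * exp (- u * x) \<partial>M)) (at u)"
    by (rule moment_has_derivative[OF events_eq_borel nonneg_M integrable_M_moment u])
  then have "((\<lambda>u. exp (- exponent b u)) has_real_derivative - (\<integral>x. x ^ Suc 0 * exp (- u * x) \<partial>M)) (at u)"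
    by (rule has_field_derivative_transform_within_open[where S = "{0<..}"]) (use u laplace in auto)
  moreover have "((\<lambda>u. exp (- exponent b u)) has_real_derivative - ((b + moment 1 u) * exp (- exponent b u))) (at u)"
    by (auto intro!: derivative_eq_intros exponent_deriv[OF u] simp: algebra_simps)
  ultimately have "- (\<integral>x. x ^ Suc 0 * exp (- u * x) \<partial>M) = - ((b + moment 1 u) * exp (- exponent b u))"
    by (rule DERIV_unique)
  then show ?thesis by (simp only: neg_equal_iff_equal power_Suc0_right)
qed

lemma M_moment_2: "0 < u \<Longrightarrow>
  (\<integral>x. x ^ 2 * exp (- u * x) \<partial>M) = (moment 2 u + (b + moment 1 u)\<^sup>2) * exp (- exponent b u)"
proof -
  assume u: "0 < u"
  have "((\<lambda>u. \<integral>x. x ^ 1 * exp (- u * x) \<partial>M) has_real_derivative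
      - (\<integral>x. x ^ Suc 1 * exp (- u * x) \<partial>M)) (at u)"
    by (rule moment_has_derivative[OF events_eq_borel nonneg_M integrable_M_moment u])
  then have "((\<lambda>u. (b + moment 1 u) * exp (- exponent b u)) has_real_derivative
      - (\<integral>x. x ^ Suc 1 * exp (- u * x) \<partial>M)) (at u)"
    by (rule has_field_derivative_transform_within_open[where S = "{0<..}"]) (use u M_moment_1 in auto)
  moreover have "((\<lambda>u. (b + moment 1 u) * exp (- exponent b u)) has_real_derivative
      - moment (Suc 1) u * exp (- exponent b u) +
      (- (b + moment 1 u) * exp (- exponent b u)) * (b + moment 1 u)) (at u)"
    by (auto intro!: derivative_eq_intros exponent_deriv[OF u] moment_deriv[OF _ u])
  ultimately have "- (\<integral>x. x ^ Suc 1 * exp (- u * x) \<partial>M) = - moment (Suc 1) u * exp (- exponent b u) +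
      (- (b + moment 1 u) * exp (- exponent b u)) * (b + moment 1 u)"
    by (rule DERIV_unique)
  then show ?thesis by (simp add: numeral_2_eq_2 algebra_simps)
qed

text \<open>The Esscher transform at rate 1, normalized by the reciprocal of the Laplace transform
  at 1. After dilation by \<open>w\<close>, rate 1 amounts to rate \<open>w\<close> for the original
  variable.\<close>

definition tilted :: "real measure" where
  "tilted = density M (\<lambda>x. ennreal (exp (exponent b 1) * exp (- x)))"

lemma sets_tilted [measurable_cong]: "sets tilted = sets borel"
  by (simp add: tilted_def)

lemma integral_tilted:
  fixes f :: "real \<Rightarrow> 'b::{banach,second_countable_topology}"
  assumes "f \<in> borel_measurable borel"
  shows "(\<integral>x. f x \<partial>tilted) = (\<integral>x. (exp (exponent b 1) * exp (- x)) *\<^sub>R f x \<partial>M)"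
  unfolding tilted_def using assms by (intro integral_density) auto

lemma integrable_tilted:
  fixes f :: "real \<Rightarrow> 'b::{banach,second_countable_topology}"
  assumes "f \<in> borel_measurable borel"
  shows "integrable tilted f \<longleftrightarrow> integrable M (\<lambda>x. (exp (exponent b 1) * exp (- x)) *\<^sub>R f x)"
  unfolding tilted_def using assms by (intro integrable_density) auto

lemma real_distribution_tilted: "real_distribution tilted"
proof -
  have "emeasure tilted (space tilted) = (\<integral>\<^sup>+x. ennreal (exp (exponent b 1) * exp (- x)) \<partial>M)"
    unfolding tilted_def by (simp add: emeasure_density cong: nn_integral_cong)
  also have "\<dots> = ennreal (\<integral>x. exp (exponent b 1) * exp (- x) \<partial>M)"
    using integrable_exp_M[of 1] by (intro nn_integral_eq_integral integrable_mult_right) auto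
  also have "(\<integral>x. exp (exponent b 1) * exp (- x) \<partial>M) = exp (exponent b 1) * (\<integral>x. exp (- 1 * x) \<partial>M)"
    by simp
  also have "\<dots> = 1"
    by (subst laplace) (auto simp: mult_exp_exp)
  finally interpret tilted: prob_space tilted by (intro prob_spaceI) simp
  show ?thesis by standard (simp add: tilted_def)
qed

sublocale tilted: real_distribution tilted by (rule real_distribution_tilted)

definition mean :: real where "mean = b + moment 1 1"

lemma tilted_variance:
  "integrable tilted (\<lambda>x. (x - mean)\<^sup>2)" "(\<integral>x. (x - mean)\<^sup>2 \<partial>tilted) = moment 2 1"
proof -
  have eq: "(exp (exponent b 1) * exp (- x)) *\<^sub>R (x - mean)\<^sup>2
    = exp (exponent b 1) * (x ^ 2 * exp (- 1 * x) - 2 * mean * (x ^ 1 * exp (- 1 * x)) + mean\<^sup>2 * (x ^ 0 * exp (- 1 * x)))" for x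
    by (simp add: power2_diff algebra_simps)
  have int: "integrable M (\<lambda>x. x ^ k * exp (- 1 * x))" for k
    by (rule integrable_M_moment) simp
  have meas: "(\<lambda>x. (x - mean)\<^sup>2) \<in> borel_measurable borel" by measurable
  show "integrable tilted (\<lambda>x. (x - mean)\<^sup>2)"
    unfolding integrable_tilted[OF meas] eq
    by (intro integrable_mult_right Bochner_Integration.integrable_add Bochner_Integration.integrable_diff int)
  have "(\<integral>x. (x - mean)\<^sup>2 \<partial>tilted) = (\<integral>x. exp (exponent b 1) * (x ^ 2 * exp (- 1 * x) - 2 * mean * (x ^ 1 * exp (- 1 * x)) + mean\<^sup>2 * (x ^ 0 * exp (- 1 * x))) \<partial>M)"
    unfolding integral_tilted[OF meas] eq ..
  also have "\<dots> = exp (exponent b 1) * ((\<integral>x. x ^ 2 * exp (- 1 * x) \<partial>M) - 2 * mean * (\<integral>x. x ^ 1 * exp (- 1 * x) \<partial>M)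
      + mean\<^sup>2 * (\<integral>x. x ^ 0 * exp (- 1 * x) \<partial>M))"
    by (simp only: integral_mult_right_zero Bochner_Integration.integral_add Bochner_Integration.integral_diff
        int integrable_mult_right Bochner_Integration.integrable_diff)
  also have "\<dots> = exp (exponent b 1) * exp (- exponent b 1) * (moment 2 1 + mean\<^sup>2 - 2 * mean * mean + mean\<^sup>2)"
    using M_moment_1[of 1] M_moment_2[of 1] laplace[of 1]
    by (simp add: mean_def algebra_simps)
  also have "\<dots> = moment 2 1"
    by (simp add: mult_exp_exp power2_eq_square)
  finally show "(\<integral>x. (x - mean)\<^sup>2 \<partial>tilted) = moment 2 1" .
qed

lemma char_tilted: "char tilted t = exp (cexponent b 1 - cexponent b (1 - \<i> * t))"
proof -
  have "char tilted t = (\<integral>x. of_real (exp (exponent b 1)) * exp (- (1 - \<i> * t) * complex_of_real x) \<partial>M)"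
    unfolding char_def
  proof (subst integral_tilted)
    have "(exp (exponent b 1) * exp (- x)) *\<^sub>R iexp (t * x)
      = of_real (exp (exponent b 1)) * exp (- (1 - \<i> * t) * complex_of_real x)" for x
    proof -
      have "exp (- (1 - \<i> * t) * complex_of_real x) = exp (- complex_of_real x) * iexp (t * x)"
        by (simp add: mult_exp_exp algebra_simps)
      then show ?thesis by (simp add: scaleR_conv_of_real exp_of_real[symmetric])
    qed
    then show "(\<integral>x. (exp (exponent b 1) * exp (- x)) *\<^sub>R iexp (t * x) \<partial>M)
      = (\<integral>x. of_real (exp (exponent b 1)) * exp (- (1 - \<i> * t) * complex_of_real x) \<partial>M)"
      by (simp only:)
  qed measurable
  also have "\<dots> = of_real (exp (exponent b 1)) * exp (- cexponent b (1 - \<i> * t))"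
    by (simp only: integral_mult_right_zero) (subst laplace_complex, auto)
  also have "\<dots> = exp (cexponent b 1) * exp (- cexponent b (1 - \<i> * t))"
    using cexponent_of_real[of b 1] by (simp add: exp_of_real)
  finally show ?thesis by (simp add: mult_exp_exp)
qed

text \<open>Tilting replaces the Levy measure by \<open>exp (- s) N(ds)\<close>. Only the real part
  of the exponent affects the modulus, and there the drift cancels.\<close>

lemma norm_char_tilted:
  "norm (char tilted t) = exp (- (\<integral>s. (1 - cos (t * s)) * exp (- s) \<partial>N))"
proof -
  have i: "integrable N (\<lambda>s. 1 - exp (- z * complex_of_real s))" if "0 \<le> Re z" for z
    by (rule integrable_one_minus_exp_complex[OF that])
  have "Re (cexponent b z) = b * Re z + (\<integral>s. Re (1 - exp (- z * complex_of_real s)) \<partial>N)" if "0 \<le> Re z" for z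
    unfolding cexponent_def integral_Re[OF i[OF that]]
    by (simp only: plus_complex.sel times_complex.sel Re_complex_of_real Im_complex_of_real mult_zero_left diff_zero)
  from this[of 1] this[of "1 - \<i> * t"]
  have "Re (cexponent b 1 - cexponent b (1 - \<i> * t))
    = (\<integral>s. Re (1 - exp (- 1 * complex_of_real s)) \<partial>N) - (\<integral>s. Re (1 - exp (- (1 - \<i> * t) * complex_of_real s)) \<partial>N)"
    by (simp only: minus_complex.sel(1)[of "cexponent b 1"]) simp
  also have "\<dots> = (\<integral>s. Re (1 - exp (- 1 * complex_of_real s)) - Re (1 - exp (- (1 - \<i> * t) * complex_of_real s)) \<partial>N)"
    by (rule Bochner_Integration.integral_diff[symmetric]; rule integrable_Re; rule i) auto
  also have "\<dots> = (\<integral>s. - ((1 - cos (t * s)) * exp (- s)) \<partial>N)"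
    by (intro Bochner_Integration.integral_cong) (auto simp: Re_exp algebra_simps)
  also have "\<dots> = - (\<integral>s. (1 - cos (t * s)) * exp (- s) \<partial>N)"
    by (rule Bochner_Integration.integral_minus)
  finally show ?thesis unfolding char_tilted norm_exp_eq_Re by (simp only:)
qed

lemma char_tilted_deriv:
  "(char tilted has_vector_derivative (\<i> * (b + cmoment (1 - \<i> * t)) * char tilted t)) (at t)"
proof -
  have "((\<lambda>z. exp (cexponent b 1 - cexponent b (1 - \<i> * z))) has_field_derivative
    exp (cexponent b 1 - cexponent b (1 - \<i> * t)) * (0 - (b + cmoment (1 - \<i> * t)) * (0 - \<i> * 1))) (at (complex_of_real t))"
    by (intro derivative_intros DERIV_chain2[where f = "cexponent b"] cexponent_deriv) auto
  from has_vector_derivative_real_field[OF this] show ?thesis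
    unfolding char_tilted[abs_def] by (simp add: mult_ac)
qed

text \<open>The derivative of \<open>exp (- \<i> t x) char tilted t\<close> integrates to \<open>0\<close> over the real line.\<close>

lemma steutel:
  assumes int: "integrable lborel (char tilted)"
    and lim: "(char tilted \<longlongrightarrow> 0) at_top" "(char tilted \<longlongrightarrow> 0) at_bot"
  shows "x * tilted.inverse_char x = b * tilted.inverse_char x
    + (\<integral>s. s * exp (- s) * tilted.inverse_char (x - s) \<partial>N)"
proof -
  interpret NS: sigma_finite_measure N by (rule sigma_finite_N)
  interpret P: pair_sigma_finite lborel N by unfold_locales
  let ?F = "char tilted" and ?e = "\<lambda>t::real. iexp (- (t * x))"
  let ?H = "\<lambda>t. b + cmoment (1 - \<i> * complex_of_real t)"
  let ?G = "\<lambda>t. \<i> * ((?H t - x) * (?e t * ?F t))"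
  have cF: "isCont ?F t" for t by (rule tilted.isCont_char)
  have cm: "isCont (\<lambda>t. cmoment (1 - \<i> * complex_of_real t)) t" for t
    by (rule isCont_o2[where g = cmoment, OF _ isCont_cmoment]) (auto intro!: continuous_intros)
  have cG: "isCont ?G t" for t
    by (intro continuous_intros cF cm)
  have intE: "integrable lborel (\<lambda>t. ?e t * ?F t)"
    by (rule tilted.integrable_inverse_char[OF int])
  have mcm: "(\<lambda>t. cmoment (1 - \<i> * complex_of_real t)) \<in> borel_measurable borel"
    by (intro borel_measurable_continuous_onI continuous_at_imp_continuous_on ballI cm)
  have intH: "integrable lborel (\<lambda>t. cmoment (1 - \<i> * complex_of_real t) * (?e t * ?F t))"
  proof (rule Bochner_Integration.integrable_bound[OF integrable_mult_right[OF integrable_norm[OF int], of "moment 1 1"]])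
    show "AE t in lborel. norm (cmoment (1 - \<i> * complex_of_real t) * (?e t * ?F t)) \<le> norm (moment 1 1 * norm (?F t))"
      using norm_cmoment_le[of "1 - \<i> * complex_of_real _"] moment_nonneg
      by (auto simp: norm_mult abs_mult intro!: mult_right_mono)
  qed (use mcm in measurable)
  have intG: "integrable lborel ?G"
    unfolding left_diff_distrib distrib_right
    by (intro integrable_mult_right Bochner_Integration.integrable_add Bochner_Integration.integrable_diff intE intH)
  \<comment> \<open>Both boundary values vanish: \<open>?e t\<close> has modulus 1 and the
    characteristic function tends to 0 at either end.\<close>
  have "(LBINT t=-\<infinity>..\<infinity>. ?G t) = 0 - 0"
  proof (rule interval_integral_FTC_integrable)
    show "((\<lambda>t. ?e t * ?F t) has_vector_derivative ?G t) (at t)" for t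
    proof -
      have "((\<lambda>t. exp (\<i> * - (t * x))) has_field_derivative (exp (\<i> * - (t * x)) * (\<i> * - x))) (at (complex_of_real t))"
        by (auto intro!: derivative_eq_intros)
      from has_vector_derivative_real_field[OF this]
      have "(?e has_vector_derivative ?e t * (\<i> * - x)) (at t)" by simp
      from has_vector_derivative_mult[OF this char_tilted_deriv[of t]] show ?thesis
        by (simp add: algebra_simps)
    qed
    show "set_integrable lborel (einterval (- \<infinity>) \<infinity>) ?G"
      using intG by (simp add: set_integrable_def)
    have *: "((\<lambda>t. ?e t * ?F t) \<longlongrightarrow> 0) F" if "(?F \<longlongrightarrow> 0) F" for F
      by (rule tendsto_norm_zero_cancel)
        (use tendsto_norm_zero[OF that] in \<open>simp only: norm_mult norm_exp_i_times mult_1\<close>)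
    show "(((\<lambda>t. ?e t * ?F t) \<circ> real_of_ereal) \<longlongrightarrow> 0) (at_right (- \<infinity>))"
      "(((\<lambda>t. ?e t * ?F t) \<circ> real_of_ereal) \<longlongrightarrow> 0) (at_left \<infinity>)"
      using *[OF lim(2)] *[OF lim(1)] by (simp_all add: ereal_tendsto_simps)
  qed (use cG in auto)
  then have "(CLINT t|lborel. ?G t) = 0"
    by (simp add: interval_lebesgue_integral_def set_lebesgue_integral_def)
  then have "(CLINT t|lborel. (?H t - x) * (?e t * ?F t)) = 0"
    by (simp only: integral_mult_right_zero) simp
  moreover have "(CLINT t|lborel. (?H t - x) * (?e t * ?F t)) = b * (CLINT t|lborel. ?e t * ?F t)
      + (CLINT t|lborel. cmoment (1 - \<i> * complex_of_real t) * (?e t * ?F t)) - x * (CLINT t|lborel. ?e t * ?F t)"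
    unfolding left_diff_distrib distrib_right
    by (subst Bochner_Integration.integral_diff, intro Bochner_Integration.integrable_add integrable_mult_right intE intH,
        intro integrable_mult_right intE, subst Bochner_Integration.integral_add,
        intro integrable_mult_right intE, rule intH, simp only: integral_mult_right_zero)
  ultimately have eq1: "x * (CLINT t|lborel. ?e t * ?F t) = b * (CLINT t|lborel. ?e t * ?F t)
      + (CLINT t|lborel. cmoment (1 - \<i> * complex_of_real t) * (?e t * ?F t))"
    by (simp only: right_minus_eq)
  \<comment> \<open>The oscillating factor inside \<open>cmoment (1 - \<i> * t)\<close> combines
    with \<open>?e t\<close> into a shift from \<open>x\<close> to \<open>x - s\<close>; after
    Fubini the inner integral is, up to \<open>2 * pi\<close>, the density at
    \<open>x - s\<close>.\<close>
  let ?K = "\<lambda>t s. complex_of_real (s * exp (- s)) * (iexp (- (t * (x - s))) * ?F t)"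
  have fub: "integrable (lborel \<Otimes>\<^sub>M N) (\<lambda>(t, s). ?K t s)"
  proof (rule Bochner_Integration.integrable_bound)
    have 2: "integrable N (\<lambda>s. s * exp (- s))"
      using integrable_moment[of 1 1] by simp
    show "integrable (lborel \<Otimes>\<^sub>M N) (\<lambda>(t, s). norm (?F t) * (s * exp (- s)))"
      by (rule P.Fubini_integrable)
        (use int 2 integrable_norm[OF 2] in \<open>auto simp: abs_mult intro!: integrable_mult_left integrable_mult_right\<close>)
    show "(\<lambda>(t, s). ?K t s) \<in> borel_measurable (lborel \<Otimes>\<^sub>M N)" by measurable
  qed (auto simp: norm_mult abs_mult)
  have "(CLINT t|lborel. cmoment (1 - \<i> * complex_of_real t) * (?e t * ?F t))
    = (CLINT t|lborel. CLINT s|N. ?K t s)"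
  proof (rule Bochner_Integration.integral_cong[OF refl])
    fix t :: real
    have "of_real s * exp (- (1 - \<i> * complex_of_real t) * complex_of_real s) * (?e t * ?F t) = ?K t s" for s
    proof -
      have "exp (- (1 - \<i> * complex_of_real t) * complex_of_real s) * ?e t
        = of_real (exp (- s)) * iexp (- (t * (x - s)))"
        unfolding exp_of_real[symmetric] mult_exp_exp by (simp add: algebra_simps)
      then show ?thesis by (simp add: mult_ac)
    qed
    then show "cmoment (1 - \<i> * complex_of_real t) * (?e t * ?F t) = (CLINT s|N. ?K t s)"
      unfolding cmoment_def by (subst integral_mult_left_zero[symmetric]) (simp only:)
  qed
  also have "\<dots> = (CLINT s|N. CLINT t|lborel. ?K t s)"
    by (rule P.Fubini_integral[OF fub, symmetric])
  also have "\<dots> = (CLINT s|N. complex_of_real (s * exp (- s)) * (CLINT t|lborel. iexp (- (t * (x - s))) * ?F t))"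
    by (simp only: integral_mult_right_zero)
  finally have eq2: "(CLINT t|lborel. cmoment (1 - \<i> * complex_of_real t) * (?e t * ?F t))
    = (CLINT s|N. complex_of_real (s * exp (- s)) * (CLINT t|lborel. iexp (- (t * (x - s))) * ?F t))" .
  have intR: "integrable N (\<lambda>s. complex_of_real (s * exp (- s)) * (CLINT t|lborel. iexp (- (t * (x - s))) * ?F t))"
    using P.integrable_snd[OF fub] by simp
  have "x * tilted.inverse_char x = Re (1 / (2 * pi) * (x * (CLINT t|lborel. ?e t * ?F t)))"
    unfolding tilted.inverse_char_def by simp
  also have "\<dots> = Re (1 / (2 * pi) * (b * (CLINT t|lborel. ?e t * ?F t)))
    + Re (1 / (2 * pi) * (CLINT s|N. complex_of_real (s * exp (- s)) * (CLINT t|lborel. iexp (- (t * (x - s))) * ?F t)))"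
    unfolding eq1 eq2 by (simp add: distrib_left)
  also have "Re (1 / (2 * pi) * (b * (CLINT t|lborel. ?e t * ?F t))) = b * tilted.inverse_char x"
    unfolding tilted.inverse_char_def by simp
  also have "Re (1 / (2 * pi) * (CLINT s|N. complex_of_real (s * exp (- s)) * (CLINT t|lborel. iexp (- (t * (x - s))) * ?F t)))
    = (\<integral>s. Re (1 / (2 * pi) * (complex_of_real (s * exp (- s)) * (CLINT t|lborel. iexp (- (t * (x - s))) * ?F t))) \<partial>N)"
    using integral_Re[OF integrable_mult_right[OF intR, of "1 / (2 * pi)"]] by simp
  also have "\<dots> = (\<integral>s. s * exp (- s) * tilted.inverse_char (x - s) \<partial>N)"
    unfolding tilted.inverse_char_def by (intro Bochner_Integration.integral_cong) auto
  finally show ?thesis .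
qed

end

section \<open>Propagation of lower bounds\<close>

text \<open>In the application \<open>g\<close> is the tilted density recentred at its mean and
  \<eta> is \<open>s * exp (- s) N(ds)\<close>. The bound with \<open>sqrt \<epsilon>\<close> is
  what upper scaling with exponent \<open>- 1 / 2\<close> yields, and the one with
  \<open>\<epsilon>\<^sup>2\<close> follows from lower scaling with any positive \<alpha>.\<close>

locale steutel_equation =
  fixes \<eta> :: "real measure" and g :: "real \<Rightarrow> real" and A B V L :: real
  assumes sets_eta: "sets \<eta> = sets borel"
    and pos_eta: "AE s in \<eta>. 0 < s"
    and finite_eta: "finite_measure \<eta>"
    and integrable_id: "integrable \<eta> (\<lambda>s. s)"
    and small_jumps_upper:
      "\<And>\<epsilon>. 0 < \<epsilon> \<Longrightarrow> \<epsilon> \<le> 1 \<Longrightarrow> (\<integral>s. s * indicator {..\<epsilon>} s \<partial>\<eta>) \<le> A * sqrt \<epsilon>"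
    and small_jumps_lower:
      "\<And>\<epsilon>. 0 < \<epsilon> \<Longrightarrow> \<epsilon> \<le> 1 \<Longrightarrow> B * \<epsilon>\<^sup>2 \<le> (\<integral>s. s * indicator {..\<epsilon>} s \<partial>\<eta>)"
    and jumps_upper: "(\<integral>s. s \<partial>\<eta>) \<le> V"
    and nonneg: "\<And>x. 0 \<le> g x"
    and lipschitz: "\<And>x y. \<bar>g x - g y\<bar> \<le> L * \<bar>x - y\<bar>"
    and equation: "\<And>y. y * g y = (\<integral>s. g (y - s) - g y \<partial>\<eta>)"
begin

declare sets_eta [measurable_cong]

lemma g_measurable [measurable]: "g \<in> borel_measurable borel"
proof (rule borel_measurable_continuous_onI)
  have L: "0 \<le> L" using order.trans[OF abs_ge_zero lipschitz[of 1 0]] by simp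
  then have "L-lipschitz_on UNIV g"
    using lipschitz by (auto simp: lipschitz_on_def dist_real_def)
  then show "continuous_on UNIV g" by (rule lipschitz_on_continuous_on)
qed

lemma integrable_increment: "integrable \<eta> (\<lambda>s. g (y - s) - g y)"
proof (rule Bochner_Integration.integrable_bound[OF integrable_mult_right[OF integrable_id, of L]])
  show "AE s in \<eta>. norm (g (y - s) - g y) \<le> norm (L * s)"
    using pos_eta
  proof eventually_elim
    case (elim s)
    then show ?case using lipschitz[of "y - s" y] by simp
  qed
qed measurable

lemma integrable_indicator_eta: "S \<in> sets borel \<Longrightarrow> integrable \<eta> (\<lambda>s. indicator S s :: real)"
  using finite_eta by (intro integrable_real_indicator) (auto simp: sets_eta finite_measure.emeasure_finite less_top[symmetric])

lemma integrable_id_indicator: "S \<in> sets borel \<Longrightarrow> integrable \<eta> (\<lambda>s. s * indicator S s)"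
  using integrable_real_mult_indicator[OF _ integrable_id, of S] by (simp add: sets_eta)

lemma tail_mass_le:
  assumes "0 < \<epsilon>"
  shows "(\<integral>s. indicator {\<epsilon><..} s \<partial>\<eta>) \<le> V / \<epsilon>"
proof -
  have "(\<integral>s. indicator {\<epsilon><..} s \<partial>\<eta>) \<le> (\<integral>s. s / \<epsilon> \<partial>\<eta>)"
  proof (rule integral_mono_AE)
    show "AE s in \<eta>. indicator {\<epsilon><..} s \<le> s / \<epsilon>"
      using pos_eta by eventually_elim (use assms in \<open>auto split: split_indicator\<close>)
  qed (use integrable_id integrable_indicator_eta in auto)
  also have "\<dots> \<le> V / \<epsilon>"
    using jumps_upper assms by (simp add: divide_right_mono)
  finally show ?thesis .
qed

text \<open>Jumps up to \<epsilon> carry at most half of the first moment guaranteed for jumps up to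
  \<delta>. The rest is carried by jumps of size at most \<delta>, so their mass is at least that
  remainder divided by \<delta>.\<close>

lemma middle_mass_ge:
  assumes "0 < \<epsilon>" "\<epsilon> \<le> \<delta>" "\<delta> \<le> 1" "A * sqrt \<epsilon> \<le> B * \<delta>\<^sup>2 / 2"
  shows "B * \<delta> / 2 \<le> (\<integral>s. indicator {\<epsilon><..\<delta>} s \<partial>\<eta>)"
proof -
  have "B * \<delta>\<^sup>2 - B * \<delta>\<^sup>2 / 2 \<le> (\<integral>s. s * indicator {..\<delta>} s \<partial>\<eta>) - (\<integral>s. s * indicator {..\<epsilon>} s \<partial>\<eta>)"
    using small_jumps_lower[of \<delta>] small_jumps_upper[of \<epsilon>] assms by linarith
  also have "\<dots> = (\<integral>s. s * indicator {..\<delta>} s - s * indicator {..\<epsilon>} s \<partial>\<eta>)"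
    by (intro Bochner_Integration.integral_diff[symmetric] integrable_id_indicator) auto
  also have "\<dots> \<le> (\<integral>s. \<delta> * indicator {\<epsilon><..\<delta>} s \<partial>\<eta>)"
  proof (rule integral_mono_AE)
    show "AE s in \<eta>. s * indicator {..\<delta>} s - s * indicator {..\<epsilon>} s \<le> \<delta> * indicator {\<epsilon><..\<delta>} s"
      using pos_eta by eventually_elim (use assms in \<open>auto split: split_indicator\<close>)
  qed (intro integrable_mult_right integrable_indicator_eta Bochner_Integration.integrable_diff
      integrable_id_indicator; simp)+
  finally have "B * \<delta> * \<delta> / 2 \<le> \<delta> * (\<integral>s. indicator {\<epsilon><..\<delta>} s \<partial>\<eta>)"
    by (simp add: power2_eq_square)
  then show ?thesis using assms by (simp add: field_simps)
qed

text \<open>In the equation at \<open>y\<close>, jumps in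
  \<open>{\<epsilon>\<^sub>0<..\<delta>}\<close> land between \<open>y0\<close> and
  \<open>z\<close>, where \<open>g\<close> is at least \<open>a\<close>; jumps up to \<epsilon> lose
  at most \<open>L * s\<close>; each jump above \<epsilon> loses at most \<open>g y\<close>.
  Collecting the terms with \<open>g y\<close> gives the denominator: \<open>K\<close> bounds the
  factor \<open>y\<close> on the left, \<open>V / \<epsilon>\<close> the mass of the jumps above
  \<epsilon>.\<close>

lemma lower_bound_step:
  assumes L: "0 < L" and B: "0 < B" and V: "0 \<le> V" and a: "0 < a" and K: "0 < K"
    and e0: "0 < \<epsilon>\<^sub>0" "\<epsilon>\<^sub>0 \<le> \<delta>" "\<delta> \<le> 1" "A * sqrt \<epsilon>\<^sub>0 \<le> B * \<delta>\<^sup>2 / 2"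
    and e: "0 < \<epsilon>" "\<epsilon> \<le> \<epsilon>\<^sub>0" "L * (A * sqrt \<epsilon>) \<le> a * (B * \<delta> / 2) / 2"
    and lower: "\<And>x. y0 \<le> x \<Longrightarrow> x \<le> z \<Longrightarrow> a \<le> g x" and z: "y0 + \<delta> \<le> z"
    and y: "z < y" "y \<le> z + \<epsilon>\<^sub>0" "y \<le> K"
  shows "a * (B * \<delta> / 2) / 2 / (K + V / \<epsilon>) \<le> g y"
proof -
  have "a * (B * \<delta> / 2) - g y * (V / \<epsilon>) - L * (A * sqrt \<epsilon>)
    \<le> a * (\<integral>s. indicator {\<epsilon>\<^sub>0<..\<delta>} s \<partial>\<eta>) - g y * (\<integral>s. indicator {\<epsilon><..} s \<partial>\<eta>)
      - L * (\<integral>s. s * indicator {..\<epsilon>} s \<partial>\<eta>)"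
    by (intro diff_mono mult_left_mono middle_mass_ge tail_mass_le small_jumps_upper)
      (use e0 e a L nonneg in auto)
  also have "\<dots> = (\<integral>s. a * indicator {\<epsilon>\<^sub>0<..\<delta>} s - g y * indicator {\<epsilon><..} s - L * (s * indicator {..\<epsilon>} s) \<partial>\<eta>)"
    by (simp add: integrable_indicator_eta integrable_id_indicator)
  also have "\<dots> \<le> (\<integral>s. g (y - s) - g y \<partial>\<eta>)"
  proof (rule integral_mono_AE)
    show "AE s in \<eta>. a * indicator {\<epsilon>\<^sub>0<..\<delta>} s - g y * indicator {\<epsilon><..} s - L * (s * indicator {..\<epsilon>} s)
        \<le> g (y - s) - g y"
      using pos_eta
    proof eventually_elim
      case (elim s)
      consider "s \<le> \<epsilon>" | "\<epsilon> < s" "s \<notin> {\<epsilon>\<^sub>0<..\<delta>}" | "\<epsilon> < s" "s \<in> {\<epsilon>\<^sub>0<..\<delta>}" by linarith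
      then show ?case
      proof cases
        case 1
        then show ?thesis using lipschitz[of "y - s" y] elim e by (auto split: split_indicator)
      next
        case 2
        then show ?thesis using nonneg[of "y - s"] by (auto split: split_indicator)
      next
        case 3
        then have "a \<le> g (y - s)" using y z by (intro lower) auto
        then show ?thesis using 3 by (auto split: split_indicator)
      qed
    qed
  qed (intro integrable_mult_right integrable_indicator_eta Bochner_Integration.integrable_diff
      integrable_id_indicator integrable_increment; simp)+
  also have "\<dots> = y * g y" by (rule equation[symmetric])
  also have "\<dots> \<le> K * g y" using y nonneg by (intro mult_right_mono) auto
  finally have "a * (B * \<delta> / 2) / 2 \<le> K * g y + g y * (V / \<epsilon>)"
    using e(3) by linarith
  then have "a * (B * \<delta> / 2) / 2 \<le> g y * (K + V / \<epsilon>)"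
    by (simp only: distrib_left mult.commute[of K])
  moreover have "0 < K + V / \<epsilon>" using K V e(1) by (simp add: add_pos_nonneg)
  ultimately show ?thesis by (simp only: pos_divide_le_eq)
qed

end

lemma exists_small_sqrt:
  fixes A d m :: real
  assumes "0 < d" "0 < m"
  obtains \<epsilon> where "0 < \<epsilon>" "\<epsilon> \<le> d" "A * sqrt \<epsilon> \<le> m"
proof
  let ?e = "min d ((m / (\<bar>A\<bar> + 1))\<^sup>2)"
  show "0 < ?e" "?e \<le> d" using assms by auto
  have "A * sqrt ?e \<le> \<bar>A\<bar> * sqrt ?e" using assms by (intro mult_right_mono) auto
  also have "\<dots> \<le> \<bar>A\<bar> * (m / (\<bar>A\<bar> + 1))"
    using assms by (intro mult_left_mono real_le_lsqrt) auto
  also have "\<dots> \<le> m" using assms by (simp add: field_simps)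
  finally show "A * sqrt ?e \<le> m" .
qed

text \<open>The step length \<open>\<epsilon>\<^sub>0\<close> does not depend on the current lower bound, so finitely many steps
  suffice; only the cut-off \<open>\<epsilon>\<close> for the very small jumps shrinks from step to step.\<close>

lemma steutel_lower_bound:
  fixes A B V L c0 K :: real
  assumes L: "0 < L" and B: "0 < B" and V: "0 \<le> V" and c0: "0 < c0" and K: "0 < K"
  obtains a where "0 < a"
    "\<And>\<eta> g y0 y. steutel_equation \<eta> g A B V L \<Longrightarrow> - K \<le> y0 \<Longrightarrow> c0 \<le> g y0 \<Longrightarrow> y0 \<le> y \<Longrightarrow> y \<le> K \<Longrightarrow> a \<le> g y"
proof -
  \<comment> \<open>Within distance \<delta> of \<open>y0\<close> the Lipschitz bound loses at most
    half of \<open>c0\<close>, which starts the induction.\<close>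
  define \<delta> where "\<delta> = min 1 (c0 / (2 * L))"
  have \<delta>: "0 < \<delta>" "\<delta> \<le> 1" "L * \<delta> \<le> c0 / 2"
    using L c0 by (auto simp: \<delta>_def min_def field_simps)
  obtain \<epsilon>\<^sub>0 where e0: "0 < \<epsilon>\<^sub>0" "\<epsilon>\<^sub>0 \<le> \<delta>" "A * sqrt \<epsilon>\<^sub>0 \<le> B * \<delta>\<^sup>2 / 2"
    using exists_small_sqrt[of \<delta> "B * \<delta>\<^sup>2 / 2" A] \<delta> B by auto
  \<comment> \<open>The bound \<open>a\<close> is chosen before \<eta> and \<open>g\<close>: it may
    depend on the number of steps but not on the individual equation.\<close>
  have ex: "\<exists>a>0. \<forall>\<eta> g y0 y. steutel_equation \<eta> g A B V L \<longrightarrow> c0 \<le> g y0 \<longrightarrow>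
      y0 \<le> y \<longrightarrow> y \<le> y0 + \<delta> + real n * \<epsilon>\<^sub>0 \<longrightarrow> y \<le> K \<longrightarrow> a \<le> g y" for n
  proof (induction n)
    case 0
    have "c0 / 2 \<le> g y"
      if "steutel_equation \<eta> g A B V L" "c0 \<le> g y0" "y0 \<le> y" "y \<le> y0 + \<delta>" for \<eta> g y0 y
    proof -
      have "L * \<bar>y - y0\<bar> \<le> L * \<delta>" using that L by (intro mult_left_mono) auto
      then show ?thesis using steutel_equation.lipschitz[OF that(1), of y y0] that(2) \<delta>(3) by linarith
    qed
    then show ?case using c0 by (intro exI[of _ "c0 / 2"]) auto
  next
    case (Suc n)
    then obtain a where a: "0 < a" and IH: "\<And>\<eta> g y0 y. steutel_equation \<eta> g A B V L \<Longrightarrow> c0 \<le> g y0 \<Longrightarrow>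
      y0 \<le> y \<Longrightarrow> y \<le> y0 + \<delta> + real n * \<epsilon>\<^sub>0 \<Longrightarrow> y \<le> K \<Longrightarrow> a \<le> g y"
      by blast
    obtain \<epsilon> where e: "0 < \<epsilon>" "\<epsilon> \<le> \<epsilon>\<^sub>0" "L * A * sqrt \<epsilon> \<le> a * (B * \<delta> / 2) / 2"
      using exists_small_sqrt[of \<epsilon>\<^sub>0 "a * (B * \<delta> / 2) / 2" "L * A"] \<delta> e0 B a by auto
    define a' where "a' = a * (B * \<delta> / 2) / 2 / (K + V / \<epsilon>)"
    have "0 < K + V / \<epsilon>" using K V e(1) by (simp add: add_pos_nonneg)
    then have a': "0 < a'" using a B \<delta> by (simp add: a'_def)
    have "min a a' \<le> g y"
      if S: "steutel_equation \<eta> g A B V L" and y0: "c0 \<le> g y0" "y0 \<le> y" "y \<le> y0 + \<delta> + real (Suc n) * \<epsilon>\<^sub>0" "y \<le> K"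
      for \<eta> g y0 y
    proof (cases "y \<le> y0 + \<delta> + real n * \<epsilon>\<^sub>0")
      case True
      then show ?thesis using IH[OF S y0(1,2) _ y0(4)] by simp
    next
      case False
      have "a' \<le> g y"
        unfolding a'_def
      proof (rule steutel_equation.lower_bound_step[OF S L B V a K e0(1,2) \<delta>(2) e0(3) e(1,2)])
        show "a \<le> g x" if "y0 \<le> x" "x \<le> y0 + \<delta> + real n * \<epsilon>\<^sub>0" for x
          using IH[OF S y0(1) that] that False y0 by linarith
      qed (use e False y0 \<delta> e0 in \<open>auto simp: algebra_simps\<close>)
      then show ?thesis by simp
    qed
    then show ?case using a a' by (intro exI[of _ "min a a'"]) auto
  qed
  \<comment> \<open>From \<open>- K \<le> y0\<close> to \<open>y \<le> K\<close> a distance of at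
    most \<open>2 * K\<close> has to be covered in steps of length
    \<open>\<epsilon>\<^sub>0\<close>.\<close>
  obtain n where n: "2 * K / \<epsilon>\<^sub>0 \<le> real n" using real_arch_simple by blast
  then have "2 * K \<le> real n * \<epsilon>\<^sub>0" using e0 by (simp add: field_simps)
  obtain a where a: "0 < a" and low: "\<And>\<eta> g y0 y. steutel_equation \<eta> g A B V L \<Longrightarrow> c0 \<le> g y0 \<Longrightarrow>
      y0 \<le> y \<Longrightarrow> y \<le> y0 + \<delta> + real n * \<epsilon>\<^sub>0 \<Longrightarrow> y \<le> K \<Longrightarrow> a \<le> g y"
    using ex[of n] by blast
  show ?thesis
  proof (rule that[OF a])
    fix \<eta> g y0 y
    assume "steutel_equation \<eta> g A B V L" "- K \<le> y0" "c0 \<le> g y0" "y0 \<le> y" "y \<le> K"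
    then show "a \<le> g y"
      using \<open>2 * K \<le> real n * \<epsilon>\<^sub>0\<close> \<delta> by (intro low[of \<eta> g y0]) auto
  qed
qed

section \<open>Decay of the characteristic function\<close>

lemma one_minus_cos_ge:
  fixes u :: real
  assumes "\<bar>u\<bar> \<le> 1"
  shows "u\<^sup>2 / 4 \<le> 1 - cos u"
proof -
  have "Re (iexp u - (\<Sum>k\<le>3. (\<i> * u) ^ k / fact k)) \<le> \<bar>u\<bar> ^ Suc 3 / fact (Suc 3)"
    by (rule order.trans[OF complex_Re_le_cmod iexp_approx1])
  then have "cos u - (1 - u\<^sup>2 / 2) \<le> u ^ 4 / 24"
    by (simp add: Re_exp numeral_eq_Suc power2_eq_square fact_num_eq_if)
  moreover have "u ^ 4 \<le> u\<^sup>2"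
    using power_decreasing[of 2 4 "\<bar>u\<bar>"] assms by simp
  ultimately show ?thesis using zero_le_power2[of u] by linarith
qed

text \<open>From \<open>exp v \<ge> (v / n) ^ n\<close> with \<open>n \<ge> 3 / \<alpha>\<close>. Of
  the three powers gained, one pays for the factor \<open>t\<close> in the Lipschitz constant and
  two for integrability.\<close>

lemma exp_neg_powr_bound:
  fixes k \<alpha> :: real
  assumes "0 < k" "0 < \<alpha>"
  obtains K where "0 < K" "\<And>t. 1 \<le> t \<Longrightarrow> exp (- k * t powr \<alpha>) \<le> K / t ^ 3"
proof -
  obtain n :: nat where n: "3 / \<alpha> \<le> real n" using real_arch_simple by blast
  then have n3: "3 \<le> \<alpha> * real n" using assms by (simp add: field_simps)
  then have n0: "0 < n" by (cases n) auto
  define K where "K = (real n / k) ^ n"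
  show ?thesis
  proof (rule that[of K])
    show "0 < K" using n0 assms by (simp add: K_def)
    fix t :: real assume t: "1 \<le> t"
    have "k * t powr \<alpha> / n \<le> exp (k * t powr \<alpha> / n)"
      using exp_ge_add_one_self[of "k * t powr \<alpha> / n"] by linarith
    then have "(k * t powr \<alpha> / n) ^ n \<le> exp (k * t powr \<alpha> / n) ^ n"
      using assms by (intro power_mono) auto
    also have "\<dots> = exp (k * t powr \<alpha>)"
      using n0 by (simp flip: exp_of_nat_mult)
    finally have 1: "(k * t powr \<alpha> / n) ^ n \<le> exp (k * t powr \<alpha>)" .
    have "t ^ 3 = t powr 3" using t by (simp add: powr_numeral)
    also have "\<dots> \<le> t powr (\<alpha> * real n)" using t n3 by (intro powr_mono) auto
    also have "\<dots> = (t powr \<alpha>) ^ n" using t by (simp add: powr_powr[symmetric] powr_realpow)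
    finally have "t ^ 3 \<le> (t powr \<alpha>) ^ n" .
    also have "\<dots> = K * (k * t powr \<alpha> / n) ^ n"
      using n0 assms by (simp add: K_def power_mult_distrib power_divide)
    also have "\<dots> \<le> K * exp (k * t powr \<alpha>)"
      using 1 \<open>0 < K\<close> by (intro mult_left_mono) auto
    finally show "exp (- k * t powr \<alpha>) \<le> K / t ^ 3"
      using t by (simp add: exp_minus field_simps)
  qed
qed

section \<open>Second moments of truncated Levy measures\<close>

context subordinator_levy_measure
begin

lemma truncated_pointwise:
  fixes R s :: real
  assumes "0 < R" "0 < s"
  shows "s\<^sup>2 * indicator {..1 / R} s \<le> exp 1 * (s ^ 2 * exp (- R * s))"
proof (cases "s \<le> 1 / R")
  case True
  then have "R * s \<le> 1" using assms pos_le_divide_eq[of R s 1] by (simp add: mult.commute)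
  then have "1 \<le> exp (1 - R * s)" by simp
  then have "s\<^sup>2 * 1 \<le> s\<^sup>2 * exp (1 - R * s)" by (intro mult_left_mono) auto
  then show ?thesis using True by (simp add: exp_diff exp_minus field_simps)
qed (use assms in auto)

lemma integrable_truncated:
  assumes "0 < R"
  shows "integrable N (\<lambda>s. s\<^sup>2 * indicator {..1 / R} s)"
proof (rule Bochner_Integration.integrable_bound)
  show "integrable N (\<lambda>s. exp 1 * (s ^ 2 * exp (- R * s)))"
    by (intro integrable_mult_right integrable_moment) (use assms in auto)
  show "AE s in N. norm (s\<^sup>2 * indicator {..1 / R} s) \<le> norm (exp 1 * (s ^ 2 * exp (- R * s)))"
    using pos_N
  proof eventually_elim
    case (elim s)
    then show ?case using truncated_pointwise[OF assms elim] by (simp add: abs_mult)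
  qed
qed measurable

lemma truncated_le:
  assumes "0 < R"
  shows "(\<integral>s. s\<^sup>2 * indicator {..1 / R} s \<partial>N) \<le> exp 1 * moment 2 R"
proof -
  have "(\<integral>s. s\<^sup>2 * indicator {..1 / R} s \<partial>N) \<le> (\<integral>s. exp 1 * (s ^ 2 * exp (- R * s)) \<partial>N)"
  proof (rule integral_mono_AE)
    show "AE s in N. s\<^sup>2 * indicator {..1 / R} s \<le> exp 1 * (s ^ 2 * exp (- R * s))"
      using pos_N by eventually_elim (rule truncated_pointwise[OF assms])
    show "integrable N (\<lambda>s. exp 1 * (s ^ 2 * exp (- R * s)))"
      by (intro integrable_mult_right integrable_moment) (use assms in auto)
  qed (rule integrable_truncated[OF assms])
  then show ?thesis by (simp add: moment_def)
qed

text \<open>Beyond \<open>1 / R\<close> the weight with rate \<open>l * R\<close> is at most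
  \<open>exp (- (l - 1))\<close> times the weight with rate \<open>R\<close>. For suitable
  \<open>l\<close> those jumps account for at most half of \<open>\<kappa> * moment 2 R\<close>, and
  the jumps up to \<open>1 / R\<close> must supply the other half.\<close>

lemma truncated_ge:
  assumes R: "0 < R" and l: "1 \<le> l" and lower: "\<kappa> * moment 2 R \<le> moment 2 (l * R)"
    and small: "exp (- (l - 1)) \<le> \<kappa> / 2"
  shows "\<kappa> / 2 * moment 2 R \<le> (\<integral>s. s\<^sup>2 * indicator {..1 / R} s \<partial>N)"
proof -
  have "moment 2 (l * R) \<le> (\<integral>s. s\<^sup>2 * indicator {..1 / R} s + exp (- (l - 1)) * (s ^ 2 * exp (- R * s)) \<partial>N)"
    unfolding moment_def
  proof (rule integral_mono_AE)
    show "AE s in N. s ^ 2 * exp (- (l * R) * s)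
        \<le> s\<^sup>2 * indicator {..1 / R} s + exp (- (l - 1)) * (s ^ 2 * exp (- R * s))"
      using pos_N
    proof eventually_elim
      case (elim s)
      show ?case
      proof (cases "s \<le> 1 / R")
        case True
        have "s ^ 2 * exp (- (l * R) * s) \<le> s ^ 2 * 1"
          using l R elim by (intro mult_left_mono) auto
        moreover have "0 \<le> exp (- (l - 1)) * (s ^ 2 * exp (- R * s))" by (intro mult_nonneg_nonneg) auto
        moreover have "s\<^sup>2 * indicator {..1 / R} s = s\<^sup>2 * (1::real)" using True by simp
        ultimately show ?thesis by linarith
      next
        case False
        then have "1 \<le> R * s" using R by (simp add: field_simps)
        then have "(l - 1) * 1 \<le> (l - 1) * (R * s)" using l by (intro mult_left_mono) auto
        then have "- (l * R) * s \<le> - (l - 1) + - R * s" by (simp add: algebra_simps)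
        then have "exp (- (l * R) * s) \<le> exp (- (l - 1)) * exp (- R * s)"
          by (simp only: mult_exp_exp exp_le_cancel_iff)
        then have "s ^ 2 * exp (- (l * R) * s) \<le> s ^ 2 * (exp (- (l - 1)) * exp (- R * s))"
          by (intro mult_left_mono) auto
        then show ?thesis using False by (simp add: mult_ac)
      qed
    qed
  qed (intro Bochner_Integration.integrable_add integrable_mult_right integrable_moment integrable_truncated; use l R in simp)+
  also have "\<dots> = (\<integral>s. s\<^sup>2 * indicator {..1 / R} s \<partial>N) + exp (- (l - 1)) * moment 2 R"
    unfolding moment_def
    by (subst Bochner_Integration.integral_add, rule integrable_truncated[OF R],
        intro integrable_mult_right integrable_moment, simp, rule R, simp only: integral_mult_right_zero)
  also have "\<dots> \<le> (\<integral>s. s\<^sup>2 * indicator {..1 / R} s \<partial>N) + \<kappa> / 2 * moment 2 R"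
    by (intro add_left_mono mult_right_mono small moment_nonneg)
  finally show ?thesis using lower by argo
qed

end

text \<open>Provides the \<open>l\<close> for \<open>truncated_ge\<close> in terms of
  \<open>c\<close> and \<alpha> only: exponential decay beats \<open>l powr (- 2)\<close>, and a
  positive \<alpha> makes the right-hand side at least a multiple of that.\<close>

lemma exists_scale:
  fixes c \<alpha> :: real
  assumes "0 < c" "0 < \<alpha>"
  obtains l where "1 \<le> l" "exp (- (l - 1)) \<le> c * l powr (\<alpha> - 2) / 2"
proof -
  have "((\<lambda>l::real. exp (- (l - 1)) * l ^ 2) \<longlongrightarrow> 0) at_top" by real_asymp
  then have "eventually (\<lambda>l::real. exp (- (l - 1)) * l ^ 2 < c / 2) at_top"
    using assms by (intro order_tendstoD) auto
  with eventually_ge_at_top[of "1::real"]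
  have "eventually (\<lambda>l::real. 1 \<le> l \<and> exp (- (l - 1)) * l ^ 2 < c / 2) at_top"
    by (rule eventually_conj)
  then obtain l :: real where l: "1 \<le> l" "exp (- (l - 1)) * l ^ 2 < c / 2"
    by (metis (mono_tags, lifting) eventually_at_top_linorder order_refl)
  have "exp (- (l - 1)) \<le> c / 2 * l powr (- 2)"
    using l by (simp add: powr_minus powr_numeral field_simps)
  also have "\<dots> \<le> c / 2 * l powr (\<alpha> - 2)"
    using l assms by (intro mult_left_mono powr_mono) auto
  finally show ?thesis using l by (intro that[of l]) auto
qed

text \<open>The exponent \<open>- 1 / 2\<close> serves both alternatives of the theorem: it is larger than \<open>\<beta> - 2\<close> in (i),
  and any exponent larger than \<open>- 1\<close> is possible in (ii).\<close>

locale normalized_subordinator_law = subordinator_law +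
  fixes \<alpha> c C V\<^sub>0 V\<^sub>1 :: real
  assumes variance: "V\<^sub>0 \<le> moment 2 1" "moment 2 1 \<le> V\<^sub>1"
    and weak_lower_scaling:
      "\<And>l x. 1 \<le> l \<Longrightarrow> 1 \<le> x \<Longrightarrow> c * l powr (\<alpha> - 2) * moment 2 x \<le> moment 2 (l * x)"
    and weak_upper_scaling:
      "\<And>l x. 1 \<le> l \<Longrightarrow> 1 \<le> x \<Longrightarrow> moment 2 (l * x) \<le> C * l powr (- 1 / 2) * moment 2 x"
begin

lemma truncated_lower:
  assumes "0 < c" "1 \<le> l" "exp (- (l - 1)) \<le> c * l powr (\<alpha> - 2) / 2" "1 \<le> R"
  shows "c * l powr (\<alpha> - 2) / 2 * c * V\<^sub>0 * R powr (\<alpha> - 2) \<le> (\<integral>s. s\<^sup>2 * indicator {..1 / R} s \<partial>N)"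
proof -
  let ?k = "c * l powr (\<alpha> - 2) / 2"
  have "?k * (c * R powr (\<alpha> - 2) * V\<^sub>0) \<le> ?k * (c * R powr (\<alpha> - 2) * moment 2 1)"
    using assms variance by (intro mult_left_mono) auto
  also have "\<dots> \<le> ?k * moment 2 R"
    using weak_lower_scaling[of R 1] assms by (intro mult_left_mono) auto
  also have "\<dots> \<le> (\<integral>s. s\<^sup>2 * indicator {..1 / R} s \<partial>N)"
    using assms by (intro truncated_ge[of R l] weak_lower_scaling) auto
  finally show ?thesis by (simp add: mult_ac)
qed

text \<open>Jumps longer than \<open>1 / \<bar>t\<bar>\<close> are dropped, the integrand being
  nonnegative. On the others \<open>1 - cos (t * s)\<close> is at least
  \<open>(t * s)\<^sup>2 / 4\<close>, and \<open>1 \<le> \<bar>t\<bar>\<close> gives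
  \<open>exp (- s) \<ge> exp (- 1)\<close>.\<close>

lemma norm_char_tilted_le:
  assumes t: "1 \<le> \<bar>t\<bar>"
  shows "norm (char tilted t) \<le> exp (- (t\<^sup>2 * exp (- 1) / 4 * (\<integral>s. s\<^sup>2 * indicator {..1 / \<bar>t\<bar>} s \<partial>N)))"
proof -
  have "(\<integral>s. t\<^sup>2 * exp (- 1) / 4 * (s\<^sup>2 * indicator {..1 / \<bar>t\<bar>} s) \<partial>N) \<le> (\<integral>s. (1 - cos (t * s)) * exp (- s) \<partial>N)"
  proof (rule integral_mono_AE)
    show "integrable N (\<lambda>s. t\<^sup>2 * exp (- 1) / 4 * (s\<^sup>2 * indicator {..1 / \<bar>t\<bar>} s))"
      using t by (intro integrable_mult_right integrable_truncated) auto
    show "integrable N (\<lambda>s. (1 - cos (t * s)) * exp (- s))"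
    proof -
      have "integrable N (\<lambda>s. (1 - exp (- (1 - \<i> * complex_of_real t) * complex_of_real s)) - (1 - exp (- 1 * complex_of_real s)))"
        by (intro Bochner_Integration.integrable_diff integrable_one_minus_exp_complex) auto
      then have "integrable N (\<lambda>s. Re ((1 - exp (- (1 - \<i> * complex_of_real t) * complex_of_real s)) - (1 - exp (- 1 * complex_of_real s))))"
        by (rule integrable_Re)
      moreover have "Re ((1 - exp (- (1 - \<i> * complex_of_real t) * complex_of_real s)) - (1 - exp (- 1 * complex_of_real s)))
          = (1 - cos (t * s)) * exp (- s)" for s
        by (simp add: Re_exp algebra_simps)
      ultimately show ?thesis by (simp only:)
    qed
    show "AE s in N. t\<^sup>2 * exp (- 1) / 4 * (s\<^sup>2 * indicator {..1 / \<bar>t\<bar>} s) \<le> (1 - cos (t * s)) * exp (- s)"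
      using pos_N
    proof eventually_elim
      case (elim s)
      show ?case
      proof (cases "s \<le> 1 / \<bar>t\<bar>")
        case True
        then have "\<bar>t * s\<bar> \<le> 1" using t elim by (simp add: abs_mult field_simps)
        then have "(t * s)\<^sup>2 / 4 \<le> 1 - cos (t * s)" by (rule one_minus_cos_ge)
        moreover have "1 / \<bar>t\<bar> \<le> 1" using t by simp
        then have "exp (- 1) \<le> exp (- s)" using True by (simp del: divide_le_eq_1)
        ultimately have "(t * s)\<^sup>2 / 4 * exp (- 1) \<le> (1 - cos (t * s)) * exp (- s)"
          by (intro mult_mono) auto
        then show ?thesis using True by (simp add: power_mult_distrib mult_ac)
      qed auto
    qed
  qed
  then show ?thesis unfolding norm_char_tilted by simp
qed

end

text \<open>The factor \<open>max 1 \<bar>t\<bar>\<close> lets one integrable majorant control both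
  the characteristic function and its product with \<open>t\<close>. As \<open>K\<close> precedes
  the law, the Lipschitz constant of the density will be uniform.\<close>

lemma char_tilted_decay:
  fixes \<alpha> c C V\<^sub>0 V\<^sub>1 :: real
  assumes "0 < c" "0 < \<alpha>" "0 < V\<^sub>0"
  obtains K where "0 < K" "\<And>N M b t. normalized_subordinator_law N M b \<alpha> c C V\<^sub>0 V\<^sub>1 \<Longrightarrow>
    max 1 \<bar>t\<bar> * norm (char (subordinator_law.tilted N M b) t) \<le> K * inverse (1 + t\<^sup>2)"
proof -
  obtain l where l: "1 \<le> l" "exp (- (l - 1)) \<le> c * l powr (\<alpha> - 2) / 2"
    using exists_scale[OF assms(1,2)] .
  define B where "B = c * l powr (\<alpha> - 2) / 2 * c * V\<^sub>0"
  have B: "0 < B" using assms l by (simp add: B_def)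
  define k where "k = exp (- 1) / 4 * B"
  have k: "0 < k" using B by (simp add: k_def)
  obtain K where K: "0 < K" "\<And>t. 1 \<le> t \<Longrightarrow> exp (- k * t powr \<alpha>) \<le> K / t ^ 3"
    using exp_neg_powr_bound[OF k assms(2)] by blast
  show ?thesis
  proof (rule that[of "2 * (K + 1)"])
    fix N M :: "real measure" and b t :: real
    assume "normalized_subordinator_law N M b \<alpha> c C V\<^sub>0 V\<^sub>1"
    then interpret normalized_subordinator_law N M b \<alpha> c C V\<^sub>0 V\<^sub>1 .
    show "max 1 \<bar>t\<bar> * norm (char tilted t) \<le> 2 * (K + 1) * inverse (1 + t\<^sup>2)"
    proof (cases "1 \<le> \<bar>t\<bar>")
      case True
      have "t\<^sup>2 * \<bar>t\<bar> powr (\<alpha> - 2) = \<bar>t\<bar> powr 2 * \<bar>t\<bar> powr (\<alpha> - 2)"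
        using True by (simp add: powr_numeral)
      also have "\<dots> = \<bar>t\<bar> powr \<alpha>"
        by (subst powr_add[symmetric]) simp
      finally have eq: "t\<^sup>2 * \<bar>t\<bar> powr (\<alpha> - 2) = \<bar>t\<bar> powr \<alpha>" .
      have "k * \<bar>t\<bar> powr \<alpha> = t\<^sup>2 * exp (- 1) / 4 * (B * \<bar>t\<bar> powr (\<alpha> - 2))"
        unfolding eq[symmetric] by (simp add: k_def mult_ac)
      also have "\<dots> \<le> t\<^sup>2 * exp (- 1) / 4 * (\<integral>s. s\<^sup>2 * indicator {..1 / \<bar>t\<bar>} s \<partial>N)"
        using truncated_lower[OF assms(1) l True] by (intro mult_left_mono) (auto simp: B_def)
      finally have "exp (- (t\<^sup>2 * exp (- 1) / 4 * (\<integral>s. s\<^sup>2 * indicator {..1 / \<bar>t\<bar>} s \<partial>N))) \<le> exp (- k * \<bar>t\<bar> powr \<alpha>)"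
        unfolding exp_le_cancel_iff by linarith
      with norm_char_tilted_le[OF True] have "norm (char tilted t) \<le> exp (- k * \<bar>t\<bar> powr \<alpha>)"
        by (rule order.trans)
      also have "\<dots> \<le> K / \<bar>t\<bar> ^ 3" using K(2)[OF True] .
      finally have "\<bar>t\<bar> * norm (char tilted t) \<le> \<bar>t\<bar> * (K / \<bar>t\<bar> ^ 3)"
        by (intro mult_left_mono) auto
      also have "\<dots> = K / t\<^sup>2" using True by (simp add: power3_eq_cube power2_eq_square divide_simps)
      also have "\<dots> \<le> 2 * (K + 1) * inverse (1 + t\<^sup>2)"
      proof -
        have "1 \<le> t\<^sup>2" using True by (simp add: abs_square_less_1 flip: not_less)
        then show ?thesis using K(1) by (simp add: divide_simps) (simp add: algebra_simps add_increasing2)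
      qed
      finally show ?thesis using True by simp
    next
      case False
      then have t: "t\<^sup>2 \<le> 1" by (simp add: abs_square_le_1)
      have "max 1 \<bar>t\<bar> * norm (char tilted t) \<le> 1" using False tilted.cmod_char_le_1[of t] by simp
      also have "1 \<le> 2 * inverse (1 + t\<^sup>2)" using t by (simp add: field_simps add_pos_nonneg)
      also have "\<dots> \<le> 2 * (K + 1) * inverse (1 + t\<^sup>2)" using K by (intro mult_right_mono) auto
      finally show ?thesis .
    qed
  qed (use K in simp)
qed

section \<open>The normalized density\<close>

context subordinator_law
begin

text \<open>The kernel of Steutel's equation; the factor \<open>s * exp (- s)\<close> makes it
  finite even if \<open>N\<close> is not.\<close>

definition jumps :: "real measure" where
  "jumps = density N (\<lambda>s. ennreal (s * exp (- s)))"

lemma sets_jumps [measurable_cong]: "sets jumps = sets borel"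
  by (simp add: jumps_def sets_N)

lemma nonneg_weight: "AE s in N. 0 \<le> s * exp (- s)"
  using pos_N by eventually_elim simp

lemma integral_jumps:
  fixes f :: "real \<Rightarrow> real"
  assumes "f \<in> borel_measurable borel"
  shows "(\<integral>s. f s \<partial>jumps) = (\<integral>s. s * exp (- s) * f s \<partial>N)"
  unfolding jumps_def
  by (subst integral_density) (use assms nonneg_weight in \<open>auto simp: measurable_cong_sets[OF sets_N refl]\<close>)

lemma integrable_jumps:
  fixes f :: "real \<Rightarrow> real"
  assumes "f \<in> borel_measurable borel"
  shows "integrable jumps f \<longleftrightarrow> integrable N (\<lambda>s. s * exp (- s) * f s)"
  unfolding jumps_def
  by (subst integrable_density) (use assms nonneg_weight in \<open>auto simp: measurable_cong_sets[OF sets_N refl]\<close>)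

lemma finite_jumps: "finite_measure jumps"
proof (rule finite_measureI)
  have "emeasure jumps (space jumps) = (\<integral>\<^sup>+s. ennreal (s * exp (- s)) \<partial>N)"
    unfolding jumps_def by (simp add: emeasure_density cong: nn_integral_cong)
  also have "\<dots> = ennreal (\<integral>s. s * exp (- s) \<partial>N)"
    using integrable_moment[of 1 1] nonneg_weight by (intro nn_integral_eq_integral) auto
  finally show "emeasure jumps (space jumps) \<noteq> \<infinity>" by simp
qed

end

context normalized_subordinator_law
begin

text \<open>If the density stayed below \<open>1 / (8 * sqrt V\<^sub>1)\<close> on an interval four
  standard deviations long, the mass there would be at most 1/2, whereas Chebyshev's inequality
  gives at least 3/4.\<close>

lemma tilted_lower_bound_somewhere:
  assumes int: "integrable lborel (char tilted)" and V: "0 < V\<^sub>0"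
  obtains y where "\<bar>y\<bar> \<le> 2 * sqrt (moment 2 1)" "1 / (8 * sqrt V\<^sub>1) \<le> tilted.inverse_char (mean + y)"
proof (rule ccontr)
  note obtained = that
  assume neg: "\<not> thesis"
  let ?d = "2 * sqrt (moment 2 1)"
  define V where "V = moment 2 1"
  have V0: "0 < V" "V \<le> V\<^sub>1" using V variance by (auto simp: V_def)
  let ?q = "tilted.inverse_char"
  let ?A = "{mean - ?d..mean + ?d}"
  have d: "0 < ?d" using V0 by (simp add: V_def)
  have small: "?q x \<le> 1 / (8 * sqrt V\<^sub>1)" if "x \<in> ?A" for x
    using neg that by (intro leI notI) (auto intro!: obtained[of "x - mean"] simp: abs_le_iff)
  have "measure tilted {mean - ?d<..mean + ?d} = (\<integral>x. indicator ?A x * ?q x \<partial>lborel)"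
    using d by (intro tilted.measure_Ioc_inverse_char int) auto
  also have "\<dots> \<le> (\<integral>x. indicator ?A x * (1 / (8 * sqrt V\<^sub>1)) \<partial>lborel)"
  proof (rule integral_mono[OF tilted.integrable_indicator_inverse_char[OF int]])
    show "integrable lborel (\<lambda>y. indicator ?A y * (1 / (8 * sqrt V\<^sub>1)))"
      by (intro integrable_mult_left integrable_real_indicator) (auto simp: emeasure_lborel_Icc_eq)
    show "indicator ?A y * ?q y \<le> indicator ?A y * (1 / (8 * sqrt V\<^sub>1))" for y
      using small[of y] by (auto split: split_indicator)
  qed
  also have "\<dots> = 2 * ?d * (1 / (8 * sqrt V\<^sub>1))"
    using d by simp
  also have "\<dots> = 1 / 2 * (sqrt V / sqrt V\<^sub>1)"
    by (simp add: V_def)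
  also have "\<dots> \<le> 1 / 2 * 1"
    using V0 by (intro mult_left_mono) auto
  finally have up: "measure tilted {mean - ?d<..mean + ?d} \<le> 1 / 2" by simp
  \<comment> \<open>The constant equals \<open>?d\<^sup>2\<close>, which is four times the
    variance.\<close>
  have "(\<integral>x. (?d / 2)\<^sup>2 * 4 * (1 - indicator {mean - ?d<..mean + ?d} x) \<partial>tilted) \<le> (\<integral>x. (x - mean)\<^sup>2 \<partial>tilted)"
  proof (rule integral_mono[OF _ tilted_variance(1)])
    show "integrable tilted (\<lambda>x. (?d / 2)\<^sup>2 * 4 * (1 - indicator {mean - ?d<..mean + ?d} x))"
      by (intro integrable_mult_right Bochner_Integration.integrable_diff integrable_real_indicator) (auto simp: less_top[symmetric])
    fix x
    show "(?d / 2)\<^sup>2 * 4 * (1 - indicator {mean - ?d<..mean + ?d} x) \<le> (x - mean)\<^sup>2"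
    proof (cases "x \<in> {mean - ?d<..mean + ?d}")
      case False
      then have "?d \<le> \<bar>x - mean\<bar>" by auto
      then have "?d\<^sup>2 \<le> \<bar>x - mean\<bar>\<^sup>2" using d by (intro power_mono) auto
      then show ?thesis using False by (simp add: power_divide)
    qed auto
  qed
  moreover have "(\<integral>x. 1 - indicator {mean - ?d<..mean + ?d} x \<partial>tilted) = 1 - measure tilted {mean - ?d<..mean + ?d}"
    by (subst Bochner_Integration.integral_diff) (use tilted.prob_space in \<open>auto simp: less_top[symmetric]\<close>)
  ultimately have "4 * V * (1 - measure tilted {mean - ?d<..mean + ?d}) \<le> V"
    unfolding tilted_variance(2) integral_mult_right_zero using V0 by (simp add: V_def)
  then have "1 - measure tilted {mean - ?d<..mean + ?d} \<le> 1 / 4"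
    using V0 by (simp add: field_simps)
  with up show False by linarith
qed

lemma integrable_of_decay:
  fixes f :: "real \<Rightarrow> complex"
  assumes "f \<in> borel_measurable borel" "\<And>t. norm (f t) \<le> K * inverse (1 + t\<^sup>2)"
  shows "integrable lborel f" "(\<integral>t. norm (f t) \<partial>lborel) \<le> K * pi"
proof -
  have *: "integrable lborel (\<lambda>t::real. inverse (1 + t\<^sup>2))" "(\<integral>t. inverse (1 + (t::real)\<^sup>2) \<partial>lborel) = pi"
    using integrable_inverse_1_plus_square LBINT_inverse_1_plus_square
    by (simp_all add: set_integrable_def interval_lebesgue_integral_def set_lebesgue_integral_def)
  have K: "integrable lborel (\<lambda>t::real. K * inverse (1 + t\<^sup>2))"
    by (intro integrable_mult_right *)
  show int: "integrable lborel f"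
    by (rule Bochner_Integration.integrable_bound[OF K]) (use assms in \<open>auto intro: order.trans[OF _ abs_ge_self]\<close>)
  have "(\<integral>t. norm (f t) \<partial>lborel) \<le> (\<integral>t. K * inverse (1 + t\<^sup>2) \<partial>lborel)"
    by (intro integral_mono K assms integrable_norm int)
  also have "\<dots> = K * pi"
    by (simp only: integral_mult_right_zero *)
  finally show "(\<integral>t. norm (f t) \<partial>lborel) \<le> K * pi" .
qed

context
  fixes K :: real
  assumes decay: "\<And>t. max 1 \<bar>t\<bar> * norm (char tilted t) \<le> K * inverse (1 + t\<^sup>2)"
begin

lemma decay_0: "norm (char tilted t) \<le> K * inverse (1 + t\<^sup>2)"
  using mult_right_mono[of 1 "max 1 \<bar>t\<bar>" "norm (char tilted t)"] decay[of t] by simp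

lemma decay_1: "norm (t * char tilted t) \<le> K * inverse (1 + t\<^sup>2)"
  using mult_right_mono[of "\<bar>t\<bar>" "max 1 \<bar>t\<bar>" "norm (char tilted t)"] decay[of t] by (simp add: norm_mult)

lemma integrable_char_tilted:
  "integrable lborel (char tilted)" "integrable lborel (\<lambda>t. t * char tilted t)"
  "(\<integral>t. \<bar>t\<bar> * norm (char tilted t) \<partial>lborel) \<le> K * pi"
  using integrable_of_decay[OF _ decay_0] integrable_of_decay[OF _ decay_1] by (auto simp: norm_mult)

lemma char_tilted_tendsto_0: "(char tilted \<longlongrightarrow> 0) at_top" "(char tilted \<longlongrightarrow> 0) at_bot"
proof -
  have "((\<lambda>t::real. K * inverse (1 + t\<^sup>2)) \<longlongrightarrow> K * 0) at_top" "((\<lambda>t::real. K * inverse (1 + t\<^sup>2)) \<longlongrightarrow> K * 0) at_bot"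
    by (intro tendsto_mult tendsto_const; real_asymp)+
  then show "(char tilted \<longlongrightarrow> 0) at_top" "(char tilted \<longlongrightarrow> 0) at_bot"
    by (auto intro!: Lim_null_comparison[OF always_eventually[OF allI[OF decay_0]]])
qed

text \<open>The factor \<open>exp 1\<close> comes from comparing the cut-off at \<open>1 / R\<close>
  with \<open>exp (- R * s)\<close>, and \<open>exp (- 1)\<close> from the tilt on jumps of size at
  most 1. Given the decay constant \<open>K\<close>, all four parameters are common to the whole
  class of laws.\<close>

lemma steutel_equation_tilted:
  assumes c: "0 < c" "0 < \<alpha>" and V: "0 < V\<^sub>0" and C: "0 \<le> C"
    and l: "1 \<le> l" "exp (- (l - 1)) \<le> c * l powr (\<alpha> - 2) / 2"
  shows "steutel_equation jumps (\<lambda>y. tilted.inverse_char (mean + y))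
    (exp 1 * C * V\<^sub>1) (exp (- 1) * (c * l powr (\<alpha> - 2) / 2 * c * V\<^sub>0)) V\<^sub>1 (K * pi)"
proof (rule steutel_equation.intro)
  let ?q = tilted.inverse_char
  note int = integrable_char_tilted(1)
  have [measurable]: "?q \<in> borel_measurable borel"
    by (intro borel_measurable_continuous_onI continuous_at_imp_continuous_on ballI tilted.isCont_inverse_char[OF int])
  show "sets jumps = sets borel" by (rule sets_jumps)
  show "AE s in jumps. 0 < s"
    unfolding jumps_def using pos_N by (subst AE_density) (auto simp: measurable_cong_sets[OF sets_N refl])
  show "finite_measure jumps" by (rule finite_jumps)
  have id: "(\<lambda>s. s * exp (- s) * s) = (\<lambda>s::real. s ^ 2 * exp (- 1 * s))"
    by (auto simp: power2_eq_square)
  have intid: "integrable jumps (\<lambda>s. s)"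
    using integrable_moment[of 2 1] by (subst integrable_jumps) (auto simp: id)
  show "integrable jumps (\<lambda>s. s)" by (rule intid)
  show "(\<integral>s. s \<partial>jumps) \<le> V\<^sub>1"
    using variance(2) by (subst integral_jumps) (auto simp: id moment_def)
  have trunc: "(\<integral>s. s * indicator {..\<epsilon>} s \<partial>jumps) = (\<integral>s. exp (- s) * (s\<^sup>2 * indicator {..\<epsilon>} s) \<partial>N)" for \<epsilon>
    by (subst integral_jumps) (auto simp: power2_eq_square mult_ac)
  show "(\<integral>s. s * indicator {..\<epsilon>} s \<partial>jumps) \<le> exp 1 * C * V\<^sub>1 * sqrt \<epsilon>" if e: "0 < \<epsilon>" "\<epsilon> \<le> 1" for \<epsilon>
  proof -
    have "(\<integral>s. s * indicator {..\<epsilon>} s \<partial>jumps) \<le> (\<integral>s. s\<^sup>2 * indicator {..\<epsilon>} s \<partial>N)"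
      unfolding trunc
    proof (rule integral_mono_AE')
      show "AE s in N. exp (- s) * (s\<^sup>2 * indicator {..\<epsilon>} s) \<le> s\<^sup>2 * indicator {..\<epsilon>} s"
        using pos_N by eventually_elim (auto split: split_indicator simp: mult_left_le_one_le)
      show "AE s in N. 0 \<le> s\<^sup>2 * indicator {..\<epsilon>} s" by auto
      show "integrable N (\<lambda>s. s\<^sup>2 * indicator {..\<epsilon>} s)"
        using integrable_truncated[of "1 / \<epsilon>"] e by simp
    qed
    also have "\<dots> \<le> exp 1 * moment 2 (1 / \<epsilon> * 1)"
      using truncated_le[of "1 / \<epsilon>"] e by simp
    also have "\<dots> \<le> exp 1 * (C * (1 / \<epsilon>) powr (- 1 / 2) * moment 2 1)"
      using e by (intro mult_left_mono weak_upper_scaling) auto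
    also have "\<dots> \<le> exp 1 * (C * (1 / \<epsilon>) powr (- 1 / 2) * V\<^sub>1)"
      using C variance(2) by (intro mult_left_mono) auto
    also have "(1 / \<epsilon>) powr (- 1 / 2) = sqrt \<epsilon>"
      using e by (simp add: powr_divide powr_minus powr_half_sqrt)
    finally show ?thesis by (simp add: mult_ac)
  qed
  show "exp (- 1) * (c * l powr (\<alpha> - 2) / 2 * c * V\<^sub>0) * \<epsilon>\<^sup>2 \<le> (\<integral>s. s * indicator {..\<epsilon>} s \<partial>jumps)"
    if e: "0 < \<epsilon>" "\<epsilon> \<le> 1" for \<epsilon>
  proof -
    let ?B = "c * l powr (\<alpha> - 2) / 2 * c * V\<^sub>0"
    have "\<epsilon>\<^sup>2 = (1 / \<epsilon>) powr (- 2)" using e by (simp add: powr_minus powr_numeral power_divide)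
    also have "\<dots> \<le> (1 / \<epsilon>) powr (\<alpha> - 2)" using e c by (intro powr_mono) auto
    finally have "?B * \<epsilon>\<^sup>2 \<le> ?B * (1 / \<epsilon>) powr (\<alpha> - 2)"
      using c V l by (intro mult_left_mono) auto
    also have "\<dots> \<le> (\<integral>s. s\<^sup>2 * indicator {..\<epsilon>} s \<partial>N)"
      using truncated_lower[OF c(1) l, of "1 / \<epsilon>"] e by simp
    finally have "exp (- 1) * (?B * \<epsilon>\<^sup>2) \<le> exp (- 1) * (\<integral>s. s\<^sup>2 * indicator {..\<epsilon>} s \<partial>N)"
      by (intro mult_left_mono) auto
    also have "\<dots> = (\<integral>s. exp (- 1) * (s\<^sup>2 * indicator {..\<epsilon>} s) \<partial>N)"
      by (rule integral_mult_right_zero[symmetric])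
    also have "\<dots> \<le> (\<integral>s. s * indicator {..\<epsilon>} s \<partial>jumps)"
      unfolding trunc
    proof (rule integral_mono_AE)
      have i: "integrable N (\<lambda>s. s\<^sup>2 * indicator {..\<epsilon>} s)"
        using integrable_truncated[of "1 / \<epsilon>"] e by simp
      show "integrable N (\<lambda>s. exp (- 1) * (s\<^sup>2 * indicator {..\<epsilon>} s))"
        by (intro integrable_mult_right i)
      show "integrable N (\<lambda>s. exp (- s) * (s\<^sup>2 * indicator {..\<epsilon>} s))"
      proof (rule Bochner_Integration.integrable_bound[OF i])
        show "AE s in N. norm (exp (- s) * (s\<^sup>2 * indicator {..\<epsilon>} s)) \<le> norm (s\<^sup>2 * indicator {..\<epsilon>} s)"
          using pos_N by eventually_elim (auto split: split_indicator simp: abs_mult mult_left_le_one_le)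
      qed measurable
      show "AE s in N. exp (- 1) * (s\<^sup>2 * indicator {..\<epsilon>} s) \<le> exp (- s) * (s\<^sup>2 * indicator {..\<epsilon>} s)"
        using pos_N by eventually_elim (use e in \<open>auto split: split_indicator intro!: mult_right_mono\<close>)
    qed
    finally show ?thesis by (simp add: mult_ac)
  qed
  show "0 \<le> ?q (mean + x)" for x
    by (rule tilted.inverse_char_nonneg[OF int])
  show "\<bar>?q (mean + x) - ?q (mean + y)\<bar> \<le> K * pi * \<bar>x - y\<bar>" for x y
  proof -
    have "\<bar>?q (mean + x) - ?q (mean + y)\<bar>
      \<le> (\<integral>t. \<bar>t\<bar> * norm (char tilted t) \<partial>lborel) * \<bar>(mean + x) - (mean + y)\<bar>"
      by (rule tilted.inverse_char_lipschitz[OF integrable_char_tilted(1,2)])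
    also have "\<dots> \<le> K * pi * \<bar>(mean + x) - (mean + y)\<bar>"
      by (intro mult_right_mono integrable_char_tilted(3)) auto
    finally show ?thesis by simp
  qed
  \<comment> \<open>Steutel's equation is used at \<open>mean + y\<close>. Moving
    \<open>mean * ?q (mean + y)\<close> to the right cancels the drift; what remains of the mean,
    \<open>moment 1 1\<close>, is the total mass of \<open>jumps\<close>, and this turns values into
    increments.\<close>
  show "y * ?q (mean + y) = (\<integral>s. ?q (mean + (y - s)) - ?q (mean + y) \<partial>jumps)" for y
  proof -
    have i1: "integrable N (\<lambda>s. s * exp (- s))" using integrable_moment[of 1 1] by simp
    have i2: "integrable N (\<lambda>s. s * exp (- s) * ?q (mean + y - s))"
    proof (rule Bochner_Integration.integrable_bound[OF integrable_mult_left[OF i1]])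
      show "AE s in N. norm (s * exp (- s) * ?q (mean + y - s))
          \<le> norm (s * exp (- s) * (\<integral>t. norm (char tilted t) \<partial>lborel))"
        using tilted.inverse_char_bound[OF int]
        by (intro AE_I2) (auto simp: abs_mult intro!: mult_left_mono order.trans[OF _ abs_ge_self])
    qed measurable
    have "(mean + y) * ?q (mean + y) = b * ?q (mean + y) + (\<integral>s. s * exp (- s) * ?q (mean + y - s) \<partial>N)"
      by (rule steutel[OF int char_tilted_tendsto_0])
    moreover have "moment 1 1 = (\<integral>s. s * exp (- s) \<partial>N)" by (simp add: moment_def)
    ultimately have "y * ?q (mean + y) = (\<integral>s. s * exp (- s) * ?q (mean + y - s) \<partial>N)
        - (\<integral>s. s * exp (- s) \<partial>N) * ?q (mean + y)"
      by (simp add: mean_def algebra_simps)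
    also have "\<dots> = (\<integral>s. s * exp (- s) * ?q (mean + y - s) \<partial>N) - (\<integral>s. s * exp (- s) * ?q (mean + y) \<partial>N)"
      by (simp only: integral_mult_left_zero)
    also have "\<dots> = (\<integral>s. s * exp (- s) * ?q (mean + y - s) - s * exp (- s) * ?q (mean + y) \<partial>N)"
      by (rule Bochner_Integration.integral_diff[symmetric, OF i2 integrable_mult_left[OF i1]])
    also have "\<dots> = (\<integral>s. ?q (mean + (y - s)) - ?q (mean + y) \<partial>jumps)"
      by (subst integral_jumps) (auto simp: right_diff_distrib add_diff_eq)
    finally show ?thesis .
  qed
qed

lemma density_M:
  "M = density lborel (\<lambda>x. ennreal (exp (x - exponent b 1) * tilted.inverse_char x))"
proof -
  let ?q = tilted.inverse_char
  note int = integrable_char_tilted(1)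
  have [measurable]: "?q \<in> borel_measurable borel"
    by (intro borel_measurable_continuous_onI continuous_at_imp_continuous_on ballI tilted.isCont_inverse_char[OF int])
  have "M = density M (\<lambda>x. ennreal (exp (exponent b 1) * exp (- x)) * ennreal (exp (x - exponent b 1)))"
    by (simp add: mult_exp_exp flip: ennreal_mult' ennreal_1 del: ennreal_1) (simp add: density_1)
  also have "\<dots> = density tilted (\<lambda>x. ennreal (exp (x - exponent b 1)))"
    unfolding tilted_def by (subst density_density_eq) auto
  also have "\<dots> = density (density lborel (\<lambda>x. ennreal (?q x))) (\<lambda>x. ennreal (exp (x - exponent b 1)))"
    by (subst tilted.density_inverse_char[OF int]) (rule refl)
  also have "\<dots> = density lborel (\<lambda>x. ennreal (?q x) * ennreal (exp (x - exponent b 1)))"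
    by (subst density_density_eq) auto
  also have "\<dots> = density lborel (\<lambda>x. ennreal (exp (x - exponent b 1) * ?q x))"
    by (intro density_cong) (auto simp: ennreal_mult'' tilted.inverse_char_nonneg[OF int] mult.commute)
  finally show ?thesis .
qed

end

end

text \<open>The lower limit for \<open>y\<close> puts it to the right of whichever point Chebyshev's
  inequality supplies. The exponential factor undoes the tilt at the mean and only grows further to
  the right.\<close>

lemma normalized_density_lower_bound:
  fixes \<alpha> c C V\<^sub>0 V\<^sub>1 K G :: real
  assumes "0 < c" "0 < \<alpha>" "0 < V\<^sub>0" "V\<^sub>0 \<le> V\<^sub>1" "0 \<le> C" "0 < K"
  obtains a where "0 < a"
    "\<And>N M b. normalized_subordinator_law N M b \<alpha> c C V\<^sub>0 V\<^sub>1 \<Longrightarrow>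
      \<exists>p. continuous_on UNIV p \<and> (\<forall>x. 0 \<le> p x) \<and> M = density lborel (\<lambda>x. ennreal (p x)) \<and>
        (\<forall>y. 2 * sqrt (subordinator_levy_measure.moment N 2 1) \<le> y \<longrightarrow> y \<le> K \<longrightarrow>
           a * exp (b + subordinator_levy_measure.moment N 1 1 - subordinator_levy_measure.exponent N b 1)
           \<le> p (b + subordinator_levy_measure.moment N 1 1 + y))"
proof -
  obtain D where D: "0 < D" "\<And>N M b t. normalized_subordinator_law N M b \<alpha> c C V\<^sub>0 V\<^sub>1 \<Longrightarrow>
    max 1 \<bar>t\<bar> * norm (char (subordinator_law.tilted N M b) t) \<le> D * inverse (1 + t\<^sup>2)"
    using char_tilted_decay[OF assms(1-3)] by blast
  obtain l where l: "1 \<le> l" "exp (- (l - 1)) \<le> c * l powr (\<alpha> - 2) / 2"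
    using exists_scale[OF assms(1,2)] .
  \<comment> \<open>Including \<open>2 * sqrt V\<^sub>1\<close> places the starting point, which may
    lie to the left of the mean, above \<open>- K'\<close>.\<close>
  define K' where "K' = max K (2 * sqrt V\<^sub>1)"
  obtain a where a: "0 < a" "\<And>\<eta> g y0 y. steutel_equation \<eta> g (exp 1 * C * V\<^sub>1)
      (exp (- 1) * (c * l powr (\<alpha> - 2) / 2 * c * V\<^sub>0)) V\<^sub>1 (D * pi) \<Longrightarrow>
      - K' \<le> y0 \<Longrightarrow> 1 / (8 * sqrt V\<^sub>1) \<le> g y0 \<Longrightarrow> y0 \<le> y \<Longrightarrow> y \<le> K' \<Longrightarrow> a \<le> g y"
    by (rule steutel_lower_bound[of "D * pi" "exp (- 1) * (c * l powr (\<alpha> - 2) / 2 * c * V\<^sub>0)" V\<^sub>1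
          "1 / (8 * sqrt V\<^sub>1)" K' "exp 1 * C * V\<^sub>1"])
      (use assms D(1) l(1) in \<open>auto simp: K'_def\<close>)
  show ?thesis
  proof (rule that[OF a(1)])
    fix N M :: "real measure" and b :: real
    assume NL: "normalized_subordinator_law N M b \<alpha> c C V\<^sub>0 V\<^sub>1"
    then interpret normalized_subordinator_law N M b \<alpha> c C V\<^sub>0 V\<^sub>1 .
    note dec = D(2)[OF NL]
    note int = integrable_char_tilted(1)[OF dec]
    let ?p = "\<lambda>x. exp (x - exponent b 1) * tilted.inverse_char x"
    have "continuous_on UNIV ?p"
      by (intro continuous_at_imp_continuous_on ballI continuous_intros tilted.isCont_inverse_char[OF int])
    moreover have "\<forall>x. 0 \<le> ?p x"
      using tilted.inverse_char_nonneg[OF int] by simp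
    moreover have "M = density lborel (\<lambda>x. ennreal (?p x))" by (rule density_M[OF dec])
    moreover have "a * exp (b + moment 1 1 - exponent b 1) \<le> ?p (b + moment 1 1 + y)"
      if y: "2 * sqrt (moment 2 1) \<le> y" "y \<le> K" for y
    proof -
      obtain y0 where y0: "\<bar>y0\<bar> \<le> 2 * sqrt (moment 2 1)" "1 / (8 * sqrt V\<^sub>1) \<le> tilted.inverse_char (mean + y0)"
        using tilted_lower_bound_somewhere[OF int assms(3)] .
      have "sqrt (moment 2 1) \<le> sqrt V\<^sub>1" using variance by simp
      then have "a \<le> tilted.inverse_char (mean + y)"
        using y y0
        by (intro a(2)[OF steutel_equation_tilted[OF dec assms(1-3,5) l], of y0]) (auto simp: K'_def)
      moreover have "0 \<le> y" using y(1) real_sqrt_ge_zero[OF moment_nonneg[of 2 1]] by linarith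
      then have "exp (b + moment 1 1 - exponent b 1) \<le> exp (b + moment 1 1 + y - exponent b 1)" by simp
      ultimately show ?thesis
        unfolding mult.commute[of a] using a(1) by (intro mult_mono) (auto simp: mean_def)
    qed
    ultimately show "\<exists>p. continuous_on UNIV p \<and> (\<forall>x. 0 \<le> p x) \<and> M = density lborel (\<lambda>x. ennreal (p x)) \<and>
        (\<forall>y. 2 * sqrt (moment 2 1) \<le> y \<longrightarrow> y \<le> K \<longrightarrow>
           a * exp (b + moment 1 1 - exponent b 1) \<le> p (b + moment 1 1 + y))"
      by (intro exI[of _ ?p]) auto
  qed
qed

section \<open>Rescaling and weak scaling\<close>

text \<open>The set where two continuous functions differ is open; being Lebesgue null, it contains
  no ball.\<close>

lemma continuous_density_unique:
  fixes f g :: "real \<Rightarrow> real"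
  assumes f: "continuous_on UNIV f" "\<And>x. 0 \<le> f x" and g: "continuous_on UNIV g" "\<And>x. 0 \<le> g x"
    and eq: "density lborel (\<lambda>x. ennreal (f x)) = density lborel (\<lambda>x. ennreal (g x))"
  shows "f = g"
proof (rule ccontr)
  assume "f \<noteq> g"
  then obtain x where x: "f x \<noteq> g x" by auto
  have [measurable]: "f \<in> borel_measurable borel" "g \<in> borel_measurable borel"
    using f g by (auto intro: borel_measurable_continuous_onI)
  have "AE x in lborel. ennreal (f x) = ennreal (g x)"
    using sigma_finite_lborel eq
    by (intro sigma_finite_measure.density_unique[OF sigma_finite_lborel]) auto
  then have "AE x in lborel. f x = g x"
    by eventually_elim (use f g in simp)
  then have null: "{x. f x \<noteq> g x} \<in> null_sets lborel"
    by (subst (asm) AE_iff_null) auto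
  have "open {x. f x \<noteq> g x}"
    using open_Collect_neq[of f g] f g by simp
  then obtain d where d: "0 < d" "ball x d \<subseteq> {x. f x \<noteq> g x}"
    using x unfolding open_contains_ball by blast
  have "ball x d \<in> null_sets lborel"
    by (rule null_sets_subset[OF null _ d(2)]) simp
  then show False
    using d(1) by (simp add: null_sets_def ball_eq_greaterThanLessThan)
qed

lemma transition_density_eq:
  assumes T: "T t \<in> borel_measurable M"
    and p: "continuous_on UNIV p" "\<And>x. 0 \<le> p x"
    and distr: "distr M borel (T t) = density lborel (\<lambda>x. ennreal (p x))"
  shows "transition_density M T t = p"
proof -
  have lb: "distr M lborel (T t) = distr M borel (T t)" by (rule distr_cong) auto
  have [measurable]: "p \<in> borel_measurable borel"
    using p by (auto intro: borel_measurable_continuous_onI)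
  show ?thesis
    unfolding transition_density_def
  proof (rule the_equality)
    show "continuous_on UNIV p \<and> (\<forall>x. 0 \<le> p x) \<and> distributed M lborel (T t) (\<lambda>x. ennreal (p x))"
      using T p distr by (auto simp: distributed_def lb)
    show "f = p" if "continuous_on UNIV f \<and> (\<forall>x. 0 \<le> f x) \<and> distributed M lborel (T t) (\<lambda>x. ennreal (f x))" for f
      using that p distr by (intro continuous_density_unique) (auto simp: distributed_def lb)
  qed
qed

lemma density_rescale:
  fixes p :: "real \<Rightarrow> real" and w :: real
  assumes w: "0 < w" and X: "X \<in> borel_measurable M" and p: "p \<in> borel_measurable borel" "\<And>x. 0 \<le> p x"
    and eq: "distr M borel (\<lambda>\<omega>. w * X \<omega>) = density lborel (\<lambda>x. ennreal (p x))"
  shows "distr M borel X = density lborel (\<lambda>x. ennreal (w * p (w * x)))"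
proof (rule measure_eqI)
  fix A :: "real set" assume "A \<in> sets (distr M borel X)"
  then have A[measurable]: "A \<in> sets borel" by simp
  note [measurable] = X p(1)
  let ?B = "(\<lambda>x. x / w) -` A"
  have B[measurable]: "?B \<in> sets borel"
    using measurable_sets[of "\<lambda>x. x / w" borel borel A] by simp
  have "emeasure (distr M borel X) A = emeasure (distr M borel (\<lambda>\<omega>. w * X \<omega>)) ?B"
    using w by (simp add: emeasure_distr vimage_def)
  also have "\<dots> = (\<integral>\<^sup>+x. ennreal (p x) * indicator ?B x \<partial>lborel)"
    unfolding eq by (rule emeasure_density) auto
  also have "\<dots> = ennreal \<bar>w\<bar> * (\<integral>\<^sup>+x. ennreal (p (0 + w * x)) * indicator ?B (0 + w * x) \<partial>lborel)"
    using w by (intro nn_integral_real_affine) auto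
  also have "\<dots> = (\<integral>\<^sup>+x. ennreal (w * p (w * x)) * indicator A x \<partial>lborel)"
    using w p(2) by (subst nn_integral_cmult[symmetric])
      (auto intro!: nn_integral_cong simp: ennreal_mult' mult.assoc split: split_indicator)
  also have "\<dots> = emeasure (density lborel (\<lambda>x. ennreal (w * p (w * x)))) A"
    by (rule emeasure_density[symmetric]) auto
  finally show "emeasure (distr M borel X) A = emeasure (density lborel (\<lambda>x. ennreal (w * p (w * x)))) A" .
qed simp

section \<open>Dilations in time and space, and the cost of tilting\<close>

context subordinator_levy_measure
begin

text \<open>The Levy measure of \<open>w * T t\<close> when \<open>N\<close> is that of the
  subordinator; the corresponding drift is \<open>t * w * b\<close>.\<close>

definition scaled :: "real \<Rightarrow> real \<Rightarrow> real measure" where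
  "scaled t w = distr (density N (\<lambda>_. ennreal t)) borel (\<lambda>s. w * s)"

lemma integral_scaled:
  fixes f :: "real \<Rightarrow> real"
  assumes "0 \<le> t" "f \<in> borel_measurable borel"
  shows "(\<integral>s. f s \<partial>scaled t w) = t * (\<integral>s. f (w * s) \<partial>N)"
proof -
  have "(\<integral>s. f s \<partial>scaled t w) = (\<integral>s. f (w * s) \<partial>density N (\<lambda>_. ennreal t))"
    unfolding scaled_def by (intro integral_distr) (use assms in auto)
  also have "\<dots> = (\<integral>s. t *\<^sub>R f (w * s) \<partial>N)"
    by (intro integral_density) (use assms in \<open>auto simp: measurable_cong_sets[OF sets_N refl]\<close>)
  finally show ?thesis by simp
qed

lemma subordinator_levy_measure_scaled:
  assumes "0 \<le> t" "0 < w"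
  shows "subordinator_levy_measure (scaled t w)"
proof
  show "sets (scaled t w) = sets borel" by (simp add: scaled_def)
  have [measurable]: "(\<lambda>s. w * s) \<in> borel_measurable N" by measurable
  show "AE s in scaled t w. 0 < s"
    unfolding scaled_def using pos_N assms
    by (subst AE_distr_iff) (auto simp: AE_density measurable_cong_sets[OF sets_N refl] sets_eq_imp_space_eq[OF sets_N]
        intro!: AE_I2 elim!: eventually_mono)
  have "(\<integral>\<^sup>+ s. ennreal (min 1 s) \<partial>scaled t w) = (\<integral>\<^sup>+ s. ennreal t * ennreal (min 1 (w * s)) \<partial>N)"
    unfolding scaled_def by (subst nn_integral_distr, simp, simp, subst nn_integral_density, auto)
  also have "\<dots> \<le> (\<integral>\<^sup>+ s. ennreal (t * max 1 w) * ennreal (min 1 s) \<partial>N)"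
  proof (rule nn_integral_mono_AE)
    show "AE s in N. ennreal t * ennreal (min 1 (w * s)) \<le> ennreal (t * max 1 w) * ennreal (min 1 s)"
      using pos_N
    proof eventually_elim
      case (elim s)
      have "min 1 (w * s) \<le> max 1 w * min 1 s"
      proof (cases "s \<le> 1")
        case True
        then have "w * s \<le> max 1 w * s" using elim by (intro mult_right_mono) auto
        then show ?thesis using True by simp
      qed simp
      then have "t * min 1 (w * s) \<le> t * max 1 w * min 1 s"
        using assms by (simp only: mult.assoc) (rule mult_left_mono)
      then show ?case using assms elim by (simp add: ennreal_leI flip: ennreal_mult)
    qed
  qed
  also have "\<dots> = ennreal (t * max 1 w) * (\<integral>\<^sup>+ s. ennreal (min 1 s) \<partial>N)"
    by (rule nn_integral_cmult) simp
  also have "\<dots> < \<infinity>" using fin_N by (simp add: ennreal_mult_less_top)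
  finally show "(\<integral>\<^sup>+ s. ennreal (min 1 s) \<partial>scaled t w) < \<infinity>" .
qed

lemma moment_scaled:
  assumes "0 \<le> t"
  shows "(\<integral>s. s ^ k * exp (- u * s) \<partial>scaled t w) = t * w ^ k * moment k (w * u)"
proof -
  have "(\<integral>s. s ^ k * exp (- u * s) \<partial>scaled t w) = t * (\<integral>s. w ^ k * (s ^ k * exp (- (w * u) * s)) \<partial>N)"
    by (subst integral_scaled[OF assms]) (auto simp: power_mult_distrib mult_ac)
  then show ?thesis by (simp only: integral_mult_right_zero moment_def mult.assoc)
qed

lemma exponent_scaled:
  assumes "0 \<le> t"
  shows "t * w * b * u + (\<integral>s. (1 - exp (- u * s)) \<partial>scaled t w) = t * exponent b (w * u)"
  by (subst integral_scaled[OF assms]) (auto simp: exponent_def algebra_simps)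

text \<open>The left-hand side governs the factor lost on undoing the tilt. As a function of its
  argument it has derivative \<open>v * moment 2 v\<close>, which lower scaling bounds by a multiple
  of \<open>v powr (\<alpha> - 1)\<close>, and a positive \<alpha> makes the integral of this
  comparable with its value at the upper end. Integration starts at \<open>u\<close> because scaling
  may fail near 0.\<close>

lemma exponent_defect_le:
  assumes b: "0 \<le> b" and c: "0 < c" "0 < \<alpha>" and u: "0 < u" "u \<le> w"
    and lower: "\<And>v. u \<le> v \<Longrightarrow> v \<le> w \<Longrightarrow> c * (w / v) powr (\<alpha> - 2) * moment 2 v \<le> moment 2 w"
  shows "exponent b w - w * (b + moment 1 w) \<le> exponent b u + w\<^sup>2 * moment 2 w / (c * \<alpha>)"
proof -
  \<comment> \<open>\<open>k\<close> makes the derivative of \<open>k * v powr \<alpha>\<close>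
    dominate \<open>v * moment 2 v\<close>, so that \<open>h\<close> is nondecreasing; at
    \<open>w\<close> the power term becomes
    \<open>w\<^sup>2 * moment 2 w / (c * \<alpha>)\<close>.\<close>
  define k where "k = w powr (2 - \<alpha>) * moment 2 w / (c * \<alpha>)"
  define h where "h v = k * v powr \<alpha> - (exponent b v - v * (b + moment 1 v))" for v
  have w: "0 < w" using u by simp
  have "h u \<le> h w"
  proof (rule DERIV_nonneg_imp_nondecreasing[OF u(2)])
    fix v assume v: "u \<le> v" "v \<le> w"
    then have v0: "0 < v" using u by simp
    have "(h has_real_derivative (k * (\<alpha> * v powr (\<alpha> - 1))
        - ((b + moment 1 v) - (1 * (b + moment 1 v) + (0 + - moment (Suc 1) v) * v)))) (at v)"
      unfolding h_def
      by (intro DERIV_diff DERIV_mult DERIV_add DERIV_const DERIV_ident DERIV_cmult has_real_derivative_powr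
          exponent_deriv moment_deriv v0) auto
    moreover have "v * moment 2 v \<le> k * (\<alpha> * v powr (\<alpha> - 1))"
    proof -
      have eq: "w powr (2 - \<alpha>) * (w / v) powr (\<alpha> - 2) * v powr (\<alpha> - 1) = v"
      proof -
        have "w powr (2 - \<alpha>) * w powr (\<alpha> - 2) = 1" using w by (simp flip: powr_add)
        moreover have "v powr (\<alpha> - 1) = v * v powr (\<alpha> - 2)"
          using v0 powr_add[of v 1 "\<alpha> - 2"] by simp
        ultimately show ?thesis using v0 w by (simp add: powr_divide)
      qed
      have "w powr (2 - \<alpha>) / c * v powr (\<alpha> - 1) * (c * (w / v) powr (\<alpha> - 2) * moment 2 v)
          \<le> w powr (2 - \<alpha>) / c * v powr (\<alpha> - 1) * moment 2 w"
        using c by (intro mult_left_mono lower v) auto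
      moreover have "w powr (2 - \<alpha>) / c * v powr (\<alpha> - 1) * (c * (w / v) powr (\<alpha> - 2) * moment 2 v)
        = (w powr (2 - \<alpha>) * (w / v) powr (\<alpha> - 2) * v powr (\<alpha> - 1)) * moment 2 v"
        using c by simp
      moreover have "w powr (2 - \<alpha>) / c * v powr (\<alpha> - 1) * moment 2 w = k * (\<alpha> * v powr (\<alpha> - 1))"
        using c by (simp add: k_def)
      ultimately show ?thesis by (simp only: eq)
    qed
    ultimately show "\<exists>y. (h has_real_derivative y) (at v) \<and> 0 \<le> y"
      by (intro exI[of _ "k * (\<alpha> * v powr (\<alpha> - 1))
        - ((b + moment 1 v) - (1 * (b + moment 1 v) + (0 + - moment (Suc 1) v) * v))"])
        (simp add: numeral_2_eq_2 mult.commute)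
  qed
  moreover have "k * w powr \<alpha> = w\<^sup>2 * moment 2 w / (c * \<alpha>)"
  proof -
    have "w powr (2 - \<alpha>) * w powr \<alpha> = w\<^sup>2" using w powr_add[of w "2 - \<alpha>" \<alpha>] by (simp add: powr_numeral)
    then show ?thesis by (simp add: k_def mult_ac flip: \<open>w powr (2 - \<alpha>) * w powr \<alpha> = w\<^sup>2\<close>)
  qed
  moreover have "0 \<le> k * u powr \<alpha>" using c moment_nonneg by (simp add: k_def)
  moreover have "0 \<le> u * (b + moment 1 u)" using u b moment_nonneg[of 1 u] by simp
  ultimately show ?thesis unfolding h_def by linarith
qed

lemma moment_1_diff:
  assumes "0 < r" "r < w"
  shows "(w - r) * moment 2 w \<le> moment 1 r - moment 1 w" "moment 1 r - moment 1 w \<le> (w - r) * moment 2 r"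
proof -
  have "\<exists>z>r. z < w \<and> moment 1 w - moment 1 r = (w - r) * (- moment (Suc 1) z)"
    by (rule MVT2) (use assms moment_deriv in auto)
  then obtain z where z: "r < z" "z < w" "moment 1 r - moment 1 w = (w - r) * moment 2 z"
    by (auto simp: numeral_2_eq_2 algebra_simps)
  show "(w - r) * moment 2 w \<le> moment 1 r - moment 1 w" "moment 1 r - moment 1 w \<le> (w - r) * moment 2 r"
    unfolding z(3) using z assms by (auto intro!: mult_left_mono moment_antimono)
qed

end

text \<open>Between \<open>x1\<close> and \<open>X\<close> the monotone \<psi> is comparable to a
  constant, and \<open>\<alpha> \<le> 2\<close> makes the power of \<open>l\<close> at most 1, so
  only the constant deteriorates. A range straddling \<open>X\<close> is handled by starting the
  scaling at \<open>X\<close>.\<close>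

lemma lower_scaling_extend:
  fixes \<psi> :: "real \<Rightarrow> real"
  assumes pos: "\<And>x. 0 < x \<Longrightarrow> 0 < \<psi> x" and anti: "\<And>x y. 0 < x \<Longrightarrow> x \<le> y \<Longrightarrow> \<psi> y \<le> \<psi> x"
    and c: "0 < c" "c \<le> 1" "\<alpha> \<le> 2" and x: "0 < x1" "x1 \<le> x0"
    and low: "\<And>l x. 1 \<le> l \<Longrightarrow> x0 < x \<Longrightarrow> c * l powr (\<alpha> - 2) * \<psi> x \<le> \<psi> (l * x)"
  obtains c' where "0 < c'" "c' \<le> 1" "\<And>l x. 1 \<le> l \<Longrightarrow> x1 < x \<Longrightarrow> c' * l powr (\<alpha> - 2) * \<psi> x \<le> \<psi> (l * x)"
proof
  \<comment> \<open>Scaling is available strictly above \<open>x0\<close>, hence a base point beyond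
    it.\<close>
  define X where "X = x0 + 1"
  define c' where "c' = c * (\<psi> X / \<psi> x1)"
  have X: "x1 < X" "0 < X" using x by (auto simp: X_def)
  have q: "0 < \<psi> X / \<psi> x1" "\<psi> X / \<psi> x1 \<le> 1" using pos anti[of x1 X] X x by auto
  show c': "0 < c'" unfolding c'_def using c(1) q(1) by (rule mult_pos_pos)
  have c'c: "c' \<le> c * 1" unfolding c'_def using c q by (intro mult_left_mono) auto
  then show "c' \<le> 1" using c by simp
  have c'q: "c' \<le> 1 * (\<psi> X / \<psi> x1)" unfolding c'_def using c q by (intro mult_right_mono) auto
  fix l x :: real assume l: "1 \<le> l" and xx: "x1 < x"
  have x0: "0 < x" using xx x by simp
  have le: "\<psi> X / \<psi> x1 * \<psi> x \<le> \<psi> X"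
  proof -
    have "\<psi> X / \<psi> x1 * \<psi> x \<le> \<psi> X / \<psi> x1 * \<psi> x1"
      using q anti[of x1 x] x xx by (intro mult_left_mono) auto
    then show ?thesis using pos[OF x(1)] by simp
  qed
  consider "x0 < x" | "x \<le> x0" "l * x \<le> X" | "x \<le> x0" "X < l * x" by linarith
  then show "c' * l powr (\<alpha> - 2) * \<psi> x \<le> \<psi> (l * x)"
  proof cases
    case 1
    have "c' * l powr (\<alpha> - 2) * \<psi> x \<le> c * l powr (\<alpha> - 2) * \<psi> x"
      using c'c pos[OF x0] by (intro mult_right_mono) auto
    also have "\<dots> \<le> \<psi> (l * x)" using low l 1 by simp
    finally show ?thesis .
  next
    case 2
    have "l powr (\<alpha> - 2) \<le> l powr 0" using l c by (intro powr_mono) auto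
    then have "c' * l powr (\<alpha> - 2) \<le> (1 * (\<psi> X / \<psi> x1)) * 1"
      using c'q c' q l by (intro mult_mono) auto
    then have "c' * l powr (\<alpha> - 2) * \<psi> x \<le> \<psi> X / \<psi> x1 * \<psi> x"
      using pos[OF x0] by (intro mult_right_mono) auto
    also have "\<dots> \<le> \<psi> X" by (rule le)
    also have "\<dots> \<le> \<psi> (l * x)" using 2 x0 l by (intro anti) auto
    finally show ?thesis .
  next
    case 3
    have "l powr (\<alpha> - 2) \<le> (l * x / X) powr (\<alpha> - 2)"
      using 3 X l x0 c by (intro powr_mono2') (auto simp: X_def divide_simps)
    have nn: "0 \<le> \<psi> X / \<psi> x1 * \<psi> x"
      using q(1) pos[OF x0] by (intro mult_nonneg_nonneg) linarith+
    have "c' * l powr (\<alpha> - 2) * \<psi> x = c * l powr (\<alpha> - 2) * (\<psi> X / \<psi> x1 * \<psi> x)"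
      by (simp add: c'_def)
    also have "\<dots> \<le> c * (l * x / X) powr (\<alpha> - 2) * \<psi> X"
      using c(1) le nn \<open>l powr (\<alpha> - 2) \<le> (l * x / X) powr (\<alpha> - 2)\<close>
      by (intro mult_mono) auto
    also have "\<dots> \<le> \<psi> (l * x / X * X)"
      using 3 X by (intro low) (auto simp: X_def field_simps)
    finally show ?thesis using X by simp
  qed
qed

text \<open>On the bounded range from \<open>x1\<close> to \<open>Y\<close> monotonicity suffices:
  there \<open>l\<close> is at most \<open>Y / x1\<close>, and the missing power of \<open>l\<close>
  is made up for by the factor \<open>(Y / x1) powr \<gamma>\<close>.\<close>

lemma upper_scaling_extend:
  fixes \<psi> :: "real \<Rightarrow> real"
  assumes pos: "\<And>x. 0 < x \<Longrightarrow> 0 < \<psi> x" and anti: "\<And>x y. 0 < x \<Longrightarrow> x \<le> y \<Longrightarrow> \<psi> y \<le> \<psi> x"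
    and C: "0 \<le> C" "0 < X" "0 < x1" and \<gamma>: "0 \<le> \<gamma>"
    and up: "\<And>l x. 1 \<le> l \<Longrightarrow> X \<le> x \<Longrightarrow> \<psi> (l * x) \<le> C * l powr - \<gamma> * \<psi> x"
  obtains C' where "0 \<le> C'" "\<And>l x. 1 \<le> l \<Longrightarrow> x1 \<le> x \<Longrightarrow> \<psi> (l * x) \<le> C' * l powr - \<gamma> * \<psi> x"
proof
  define Y where "Y = max X x1"
  define D where "D = max C 1"
  define C' where "C' = D * (Y / x1) powr \<gamma>"
  have Y: "0 < Y" "x1 \<le> Y" "X \<le> Y" "1 \<le> Y / x1" using C by (auto simp: Y_def)
  have D: "C \<le> D" "1 \<le> D" by (auto simp: D_def)
  have q: "1 \<le> (Y / x1) powr \<gamma>" using Y \<gamma> by (simp add: ge_one_powr_ge_zero)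
  have DC: "D * 1 \<le> C'" unfolding C'_def using D q by (intro mult_left_mono) auto
  show "0 \<le> C'" using D DC by simp
  fix l x :: real assume l: "1 \<le> l" and xx: "x1 \<le> x"
  have x0: "0 < x" using xx C by simp
  consider "Y \<le> x" | "x < Y" "l * x \<le> Y" | "x < Y" "Y < l * x" by linarith
  then show "\<psi> (l * x) \<le> C' * l powr - \<gamma> * \<psi> x"
  proof cases
    case 1
    then have "\<psi> (l * x) \<le> C * l powr - \<gamma> * \<psi> x" using l Y by (intro up) auto
    also have "\<dots> \<le> C' * l powr - \<gamma> * \<psi> x"
      using D DC pos[OF x0] by (intro mult_right_mono) auto
    finally show ?thesis .
  next
    case 2
    have "l * x1 \<le> l * x" using xx l by (intro mult_left_mono) auto
    then have "l \<le> Y / x1" using 2 C by (simp add: field_simps)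
    then have "l powr \<gamma> \<le> (Y / x1) powr \<gamma>" using l \<gamma> by (intro powr_mono2) auto
    then have "1 \<le> (Y / x1) powr \<gamma> * l powr - \<gamma>" using l by (simp add: powr_minus field_simps)
    moreover have "1 * ((Y / x1) powr \<gamma> * l powr - \<gamma>) \<le> D * ((Y / x1) powr \<gamma> * l powr - \<gamma>)"
      using D by (intro mult_right_mono) auto
    ultimately have "1 \<le> C' * l powr - \<gamma>" by (simp add: C'_def mult_ac)
    then have "1 * \<psi> x \<le> C' * l powr - \<gamma> * \<psi> x" using pos[OF x0] by (intro mult_right_mono) auto
    moreover have "\<psi> (l * x) \<le> \<psi> x" using l x0 by (intro anti) auto
    ultimately show ?thesis by simp
  next
    case 3
    have "\<psi> (l * x / Y * Y) \<le> C * (l * x / Y) powr - \<gamma> * \<psi> Y"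
      using 3 Y by (intro up) auto
    also have "\<dots> \<le> D * (l * x / Y) powr - \<gamma> * \<psi> x"
      using D C anti[of x Y] 3 x0 pos[OF Y(1)] by (intro mult_mono) auto
    also have "(l * x / Y) powr - \<gamma> = l powr - \<gamma> * (Y / x) powr \<gamma>"
      using l x0 Y by (simp add: powr_mult powr_divide powr_minus field_simps)
    also have "D * (l powr - \<gamma> * (Y / x) powr \<gamma>) * \<psi> x \<le> D * (l powr - \<gamma> * (Y / x1) powr \<gamma>) * \<psi> x"
      using D Y xx x0 C \<gamma> pos[OF x0] by (intro mult_left_mono mult_right_mono powr_mono2 divide_left_mono) auto
    finally show ?thesis using Y by (simp add: C'_def mult_ac)
  qed
qed

text \<open>Dyadic iteration: \<open>n\<close> doublings reach the largest power of 2 not exceeding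
  \<open>l\<close>, monotonicity covers the rest, and the leading factor 2 compensates for the
  incomplete last doubling. Doubling is asked only within \<open>{x..l * x}\<close>, so that the
  lemma works near 0 as well as near infinity.\<close>

lemma doubling_upper_scaling:
  fixes \<psi> :: "real \<Rightarrow> real"
  assumes pos: "\<And>x. 0 < x \<Longrightarrow> 0 < \<psi> x" and anti: "\<And>x y. 0 < x \<Longrightarrow> x \<le> y \<Longrightarrow> \<psi> y \<le> \<psi> x"
    and l: "1 \<le> l" and x: "0 < x"
    and dbl: "\<And>y. x \<le> y \<Longrightarrow> 2 * y \<le> l * x \<Longrightarrow> \<psi> (2 * y) \<le> 2 powr (- 1 / 2) * \<psi> y"
  shows "\<psi> (l * x) \<le> 2 * l powr (- 1 / 2) * \<psi> x"
proof -
  define n where "n = nat \<lfloor>log 2 l\<rfloor>"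
  have "0 \<le> log 2 l" using l by simp
  then have n: "real n \<le> log 2 l" "log 2 l < real n + 1"
    unfolding n_def by linarith+
  have nl: "2 ^ n \<le> l"
    using n(1) l by (simp add: le_log_iff powr_realpow)
  have ln: "l \<le> 2 powr (real n + 1)"
    using n(2) l by (simp add: log_less_iff less_imp_le)
  have "\<psi> (2 ^ k * x) \<le> 2 powr (- real k / 2) * \<psi> x" if "k \<le> n" for k
    using that
  proof (induction k)
    case (Suc k)
    have "2 ^ Suc k \<le> (2::real) ^ n" using Suc.prems by (intro power_increasing) auto
    then have "2 ^ Suc k * x \<le> l * x" using nl x by (intro mult_right_mono) auto
    then have "\<psi> (2 * (2 ^ k * x)) \<le> 2 powr (- 1 / 2) * \<psi> (2 ^ k * x)"
      using x by (intro dbl) auto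
    also have "\<dots> \<le> 2 powr (- 1 / 2) * (2 powr (- real k / 2) * \<psi> x)"
      using Suc by (intro mult_left_mono) auto
    also have "\<dots> = (2 powr (- 1 / 2) * 2 powr (- real k / 2)) * \<psi> x"
      by (simp only: mult.assoc)
    also have "2 powr (- 1 / 2) * 2 powr (- real k / 2) = (2::real) powr (- real (Suc k) / 2)"
      by (simp only: powr_add[symmetric]) (simp add: field_simps)
    finally show ?case by (simp only: power_Suc mult.assoc)
  qed auto
  then have "\<psi> (2 ^ n * x) \<le> 2 powr (- real n / 2) * \<psi> x" by simp
  moreover have "\<psi> (l * x) \<le> \<psi> (2 ^ n * x)"
    using nl x by (intro anti) auto
  moreover have "2 powr (- real n / 2) \<le> 2 * l powr (- 1 / 2)"
  proof -
    have "(2 powr (real n + 1)) powr (- 1 / 2) \<le> l powr (- 1 / 2)"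
      using ln l by (intro powr_mono2') auto
    moreover have "(2 powr (real n + 1)) powr (- 1 / 2) = (2::real) powr (- (real n + 1) / 2)"
      unfolding powr_powr by (rule arg_cong[where f = "\<lambda>x. 2 powr x"]) (simp add: field_simps)
    ultimately have "2 * 2 powr (- (real n + 1) / 2) \<le> 2 * l powr (- 1 / 2)"
      by linarith
    moreover have "2 powr (- real n / 2) \<le> 2 powr (1 + - (real n + 1) / 2)"
      by (intro powr_mono) (auto simp: field_simps)
    moreover have "2 powr (1 + - (real n + 1) / 2) = 2 * (2::real) powr (- (real n + 1) / 2)"
      unfolding powr_add by simp
    ultimately show ?thesis by linarith
  qed
  ultimately show ?thesis
    using pos[OF x] by (smt (verit) mult_right_mono)
qed

text \<open>The ratio for \<open>l = 2\<close> tends to 1/2, strictly below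
  \<open>2 powr (- 1 / 2)\<close>; this margin gives the doubling bound from some point on.\<close>

lemma regularly_varying_at_infinity_upper_scaling:
  fixes \<psi> :: "real \<Rightarrow> real"
  assumes pos: "\<And>x. 0 < x \<Longrightarrow> 0 < \<psi> x" and anti: "\<And>x y. 0 < x \<Longrightarrow> x \<le> y \<Longrightarrow> \<psi> y \<le> \<psi> x"
    and rv: "regularly_varying_at_infinity (- 1) \<psi>"
  obtains X where "0 < X" "\<And>l x. 1 \<le> l \<Longrightarrow> X \<le> x \<Longrightarrow> \<psi> (l * x) \<le> 2 * l powr (- 1 / 2) * \<psi> x"
proof -
  have "((\<lambda>x. \<psi> (2 * x) / \<psi> x) \<longlongrightarrow> 2 powr (- 1)) at_top"
    using rv by (simp add: regularly_varying_at_infinity_def)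
  moreover have "(2::real) powr (- 1) < 2 powr (- 1 / 2)" by (intro powr_less_mono) auto
  ultimately have "eventually (\<lambda>x. \<psi> (2 * x) / \<psi> x < 2 powr (- 1 / 2)) at_top"
    by (rule order_tendstoD)
  then obtain X where X: "\<And>x. X \<le> x \<Longrightarrow> \<psi> (2 * x) / \<psi> x < 2 powr (- 1 / 2)"
    by (auto simp: eventually_at_top_linorder)
  show ?thesis
  proof (rule that[of "max X 1"])
    fix l x :: real assume l: "1 \<le> l" and x: "max X 1 \<le> x"
    show "\<psi> (l * x) \<le> 2 * l powr (- 1 / 2) * \<psi> x"
    proof (rule doubling_upper_scaling[OF pos anti l])
      show "\<psi> (2 * y) \<le> 2 powr (- 1 / 2) * \<psi> y" if "x \<le> y" for y
        using X[of y] pos[of y] that x by (simp add: field_simps)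
    qed (use x in auto)
  qed simp
qed

lemma regularly_varying_at_zero_upper_scaling:
  fixes \<psi> :: "real \<Rightarrow> real"
  assumes pos: "\<And>x. 0 < x \<Longrightarrow> 0 < \<psi> x" and anti: "\<And>x y. 0 < x \<Longrightarrow> x \<le> y \<Longrightarrow> \<psi> y \<le> \<psi> x"
    and rv: "regularly_varying_at_zero (- 1) \<psi>"
  obtains e where "0 < e"
    "\<And>l x. 1 \<le> l \<Longrightarrow> 0 < x \<Longrightarrow> l * x \<le> e \<Longrightarrow> \<psi> (l * x) \<le> 2 * l powr (- 1 / 2) * \<psi> x"
proof -
  have "((\<lambda>x. \<psi> (2 * x) / \<psi> x) \<longlongrightarrow> 2 powr (- 1)) (at_right 0)"
    using rv by (simp add: regularly_varying_at_zero_def)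
  moreover have "(2::real) powr (- 1) < 2 powr (- 1 / 2)" by (intro powr_less_mono) auto
  ultimately have "eventually (\<lambda>x. \<psi> (2 * x) / \<psi> x < 2 powr (- 1 / 2)) (at_right 0)"
    by (rule order_tendstoD)
  then obtain e where e: "0 < e" "\<And>x. 0 < x \<Longrightarrow> x < e \<Longrightarrow> \<psi> (2 * x) / \<psi> x < 2 powr (- 1 / 2)"
    by (auto simp: eventually_at_right_field)
  show ?thesis
  proof (rule that[OF e(1)])
    fix l x :: real assume l: "1 \<le> l" and x: "0 < x" "l * x \<le> e"
    show "\<psi> (l * x) \<le> 2 * l powr (- 1 / 2) * \<psi> x"
    proof (rule doubling_upper_scaling[OF pos anti l x(1)])
      show "\<psi> (2 * y) \<le> 2 powr (- 1 / 2) * \<psi> y" if "x \<le> y" "2 * y \<le> l * x" for y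
        using e(2)[of y] pos[of y] that x by (simp add: field_simps)
    qed
  qed
qed

section \<open>The running supremum of \<open>varphi\<close> and its generalized inverse\<close>

context subordinator_levy_measure
begin

lemma varphi_bounds:
  assumes "0 \<le> b" "0 < x" "x \<le> r"
  shows "x\<^sup>2 * moment 2 x \<le> 2 * exponent b r"
  using moment_2_le_exponent[OF assms(1,2)] exponent_mono[OF assms(1) _ assms(3)] assms(2) by simp

lemma isCont_moment_2: "0 < x \<Longrightarrow> isCont (\<lambda>x. x\<^sup>2 * moment 2 x) x"
  by (intro continuous_intros DERIV_isCont[OF moment_deriv]) auto

text \<open>At \<^term>\<open>r\<close> the function may lie strictly below its running supremum, which is then attained
  further to the left, at \<open>r1\<close>.\<close>

lemma running_sup_inverse:
  fixes y :: real
  defines "F \<equiv> \<lambda>x. x\<^sup>2 * moment 2 x"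
  assumes b: "0 \<le> b" and x1: "0 \<le> x1" "2 * exponent b x1 < y"
    and c: "0 < c" "0 < \<alpha>" and pos: "\<And>x. 0 < x \<Longrightarrow> 0 < moment 2 x"
    and lower: "\<And>l x. 1 \<le> l \<Longrightarrow> x1 < x \<Longrightarrow> c * l powr (\<alpha> - 2) * moment 2 x \<le> moment 2 (l * x)"
    and r: "r = Sup {r. 0 < r \<and> (SUP x\<in>{0<..r}. F x) = y}"
  obtains r1 u where "x1 < u" "u < r1" "2 * exponent b u < y" "r1 \<le> r" "F r1 = y" "F r \<le> y"
proof -
  have F_lower: "c * l powr \<alpha> * F x \<le> F (l * x)" if "1 \<le> l" "x1 < x" for l x
  proof -
    have "c * l powr \<alpha> * F x = (l * x)\<^sup>2 * (c * l powr (\<alpha> - 2) * moment 2 x)"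
      using that powr_add[of l 2 "\<alpha> - 2"] by (simp add: F_def power_mult_distrib powr_numeral)
    also have "\<dots> \<le> F (l * x)"
      unfolding F_def using lower[OF that] by (intro mult_left_mono) auto
    finally show ?thesis .
  qed
  have F_cont: "isCont F x" if "0 < x" for x
    unfolding F_def using that by (rule isCont_moment_2)
  have F_pos: "0 < F x" if "0 < x" for x
    unfolding F_def using that pos by simp
  have F_le: "F x \<le> 2 * exponent b r" if "0 < x" "x \<le> r" for x r
    unfolding F_def using varphi_bounds[OF b that] .
  \<comment> \<open>At \<open>x1 = 0\<close> the exponent is small near 0, otherwise it is
    continuous at \<open>x1\<close>; either way there is room to the right. Up to \<open>u\<close>
    the function \<open>F\<close> stays below \<open>y\<close>.\<close>
  obtain u where u: "x1 < u" "2 * exponent b u < y"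
  proof (cases "x1 = 0")
    case True
    then have "0 < y / 2" using x1 by simp
    then obtain u where "0 < u" "exponent b u < y / 2" using exponent_small[OF b] by blast
    then show ?thesis using True by (intro that[of u]) auto
  next
    case False
    then have "isCont (exponent b) x1" using x1 by (intro DERIV_isCont[OF exponent_deriv]) auto
    then have "(exponent b \<longlongrightarrow> exponent b x1) (at_right x1)"
      unfolding isCont_def by (rule tendsto_within_subset) auto
    moreover have "exponent b x1 < y / 2" using x1 by simp
    ultimately have "eventually (\<lambda>u. exponent b u < y / 2) (at_right x1)" by (rule order_tendstoD)
    then obtain d where d: "x1 < d" "\<And>u. x1 < u \<Longrightarrow> u < d \<Longrightarrow> exponent b u < y / 2"
      by (auto simp: eventually_at_right_field)
    show ?thesis using d(2)[of "(x1 + d) / 2"] d(1) by (intro that[of "(x1 + d) / 2"]) auto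
  qed
  have u0: "0 < u" using u x1 by simp
  have Fu: "F x < y" if "0 < x" "x \<le> u" for x
    using F_le[OF that] u by simp
  have y0: "0 < y" using Fu[OF u0] F_pos[OF u0] by simp
  \<comment> \<open>By lower scaling \<open>F (l * x)\<close> is at least
    \<open>c * l powr \<alpha> * F x\<close>, which exceeds \<open>y\<close> once \<open>l\<close>
    is large. This bounds the set under the supremum from above, so that \<open>Sup\<close> is a
    genuine supremum.\<close>
  have unbounded: "\<exists>X. x \<le> X \<and> (\<forall>z>X. y < F z)" if x: "x1 < x" for x
  proof -
    define l where "l = max 1 ((y / (c * F x)) powr (1 / \<alpha>))"
    have xp: "0 < x" using x x1 by simp
    have cF: "0 < c * F x" using c F_pos[OF xp] by simp
    have "y < F z" if z: "l * x < z" for z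
    proof -
      have lz: "l < z / x" using z xp by (simp add: field_simps)
      then have "(y / (c * F x)) powr (1 / \<alpha>) < z / x" by (simp add: l_def)
      then have "((y / (c * F x)) powr (1 / \<alpha>)) powr \<alpha> < (z / x) powr \<alpha>"
        using c by (intro powr_less_mono2) auto
      then have "y / (c * F x) < (z / x) powr \<alpha>"
        using c y0 cF by (simp add: powr_powr)
      then have "y < (z / x) powr \<alpha> * (c * F x)" using cF by (simp only: pos_divide_less_eq)
      also have "\<dots> \<le> F (z / x * x)"
        using F_lower[of "z / x" x] x lz by (simp add: l_def mult_ac)
      finally show ?thesis using xp by simp
    qed
    moreover have "1 * x \<le> l * x" using xp by (intro mult_right_mono) (auto simp: l_def)
    ultimately show ?thesis by (intro exI[of _ "l * x"]) auto
  qed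
  obtain X where X: "u \<le> X" "\<And>z. X < z \<Longrightarrow> y < F z" using unbounded[OF u(1)] by auto
  \<comment> \<open>Its least element \<open>r1\<close> is the first point at which \<open>F\<close>
    reaches \<open>y\<close>, hence a member of the set under the supremum.\<close>
  let ?A = "{x \<in> {u..X + 1}. y \<le> F x}"
  have contF: "continuous_on {u..X + 1} F"
    using u0 by (intro continuous_at_imp_continuous_on ballI F_cont) auto
  have "compact ?A"
  proof -
    have "closed ?A"
      using continuous_on_closed_Collect_le[OF continuous_on_const contF, of y] by (simp add: conj_commute)
    then show ?thesis
      using compact_Int_closed[OF compact_Icc[of u "X + 1"], of ?A] by (simp add: Int_absorb1 subset_iff Collect_conj_eq)
  qed
  moreover have "X + 1 \<in> ?A" using X by (auto intro: less_imp_le)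
  ultimately obtain r1 where r1: "r1 \<in> ?A" "\<And>x. x \<in> ?A \<Longrightarrow> r1 \<le> x"
    using compact_attains_inf[of ?A] by blast
  have ur1: "u < r1" using r1(1) Fu[of u] u0 by (cases "r1 = u") auto
  have below: "F x < y" if "0 < x" "x < r1" for x
  proof (cases "x \<le> u")
    case False
    show ?thesis
    proof (rule ccontr)
      assume "\<not> F x < y"
      then have "x \<in> ?A" using that r1(1) False by auto
      from r1(2)[OF this] that show False by simp
    qed
  qed (use Fu that in auto)
  \<comment> \<open>Used at \<open>r1\<close>, and at \<open>r\<close>, which as a supremum need not
    be attained.\<close>
  have left_lim: "F s \<le> y" if s: "0 < s" and le: "\<And>x. 0 < x \<Longrightarrow> x < s \<Longrightarrow> F x \<le> y" for s
  proof (rule tendsto_upperbound)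
    show "(F \<longlongrightarrow> F s) (at_left s)"
      using F_cont[OF s] unfolding isCont_def by (rule tendsto_within_subset) auto
    show "eventually (\<lambda>x. F x \<le> y) (at_left s)"
      using eventually_at_left[OF s] le by (auto intro!: exI[of _ 0] s)
  qed simp
  have Fr1: "F r1 = y"
    using left_lim[of r1] below ur1 u0 r1(1) by (intro antisym) (auto intro: less_imp_le)
  let ?S = "{r. 0 < r \<and> (SUP x\<in>{0<..r}. F x) = y}"
  have "(SUP x\<in>{0<..r1}. F x) = y"
    by (rule cSup_eq_maximum) (use Fr1 below ur1 u0 in \<open>force intro: less_imp_le simp: le_less\<close>)+
  then have r1S: "r1 \<in> ?S" using ur1 u0 by simp
  have S_le: "F x \<le> y" if "s \<in> ?S" "0 < x" "x \<le> s" for s x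
  proof -
    have "F x \<le> (SUP x\<in>{0<..s}. F x)"
      by (rule cSUP_upper) (use that F_le in \<open>auto intro!: bdd_aboveI[of _ "2 * exponent b s"]\<close>)
    then show ?thesis using that by simp
  qed
  have bdd: "bdd_above ?S"
  proof (rule bdd_aboveI[of _ X])
    fix s assume s: "s \<in> ?S"
    have "F s \<le> y" by (rule S_le[OF s]) (use s in auto)
    then show "s \<le> X" using X(2)[of s] by (intro leI notI) auto
  qed
  have r1r: "r1 \<le> r" unfolding r by (rule cSup_upper[OF r1S bdd])
  have "F r \<le> y"
  proof (rule left_lim)
    show "0 < r" using r1r ur1 u0 by simp
    fix x assume x: "0 < x" "x < r"
    then obtain s where "s \<in> ?S" "x < s"
      using less_cSupD[of ?S x] r1S unfolding r by blast
    then show "F x \<le> y" using S_le[of s x] x by simp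
  qed
  then show ?thesis using that[OF u(1) ur1 u(2) r1r Fr1] by simp
qed

end

section \<open>The lower bound\<close>

context subordinator_levy_measure
begin

lemma exponent_of_scaled:
  "0 \<le> t \<Longrightarrow> 0 < w \<Longrightarrow> subordinator_levy_measure.exponent (scaled t w) (t * w * b) u = t * exponent b (w * u)"
  using exponent_scaled subordinator_levy_measure.exponent_def[OF subordinator_levy_measure_scaled] by simp

lemma moment_of_scaled:
  "0 \<le> t \<Longrightarrow> 0 < w \<Longrightarrow> subordinator_levy_measure.moment (scaled t w) k u = t * w ^ k * moment k (w * u)"
  using moment_scaled subordinator_levy_measure.moment_def[OF subordinator_levy_measure_scaled] by simp

text \<open>\<open>r\<close> is the generalized inverse at \<open>1 / t\<close>. The horizon enters
  as \<open>2 * exponent b x1 < 1 / t\<close>: by \<open>varphi_bounds\<close> the running supremum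
  has not reached \<open>1 / t\<close> at \<open>x1\<close>, so \<open>r\<close> lies beyond
  \<open>x1\<close>, where scaling is available.\<close>

lemma transition_density_scaled_lower_bound:
  fixes M :: "'w measure" and T :: "real \<Rightarrow> 'w \<Rightarrow> real"
  assumes b: "0 \<le> b" and x1: "0 \<le> x1" and c: "0 < c" "c \<le> 1" "0 < \<alpha>" and C: "0 \<le> C"
    and pos: "\<And>x. 0 < x \<Longrightarrow> 0 < moment 2 x"
    and lower: "\<And>l x. 1 \<le> l \<Longrightarrow> x1 < x \<Longrightarrow> c * l powr (\<alpha> - 2) * moment 2 x \<le> moment 2 (l * x)"
    and upper: "\<And>l x. 1 \<le> l \<Longrightarrow> x1 < x \<Longrightarrow> moment 2 (l * x) \<le> C * l powr (- 1 / 2) * moment 2 x"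
    and meas: "\<And>t. 0 < t \<Longrightarrow> T t \<in> borel_measurable M"
    and law: "\<And>t w. 0 < t \<Longrightarrow> 0 < w \<Longrightarrow>
      subordinator_law (scaled t w) (distr M borel (\<lambda>\<omega>. w * T t \<omega>)) (t * w * b)"
  shows "\<exists>\<rho>\<^sub>0>0. \<forall>\<rho>\<^sub>1 \<rho>\<^sub>2. 0 < \<rho>\<^sub>1 \<and> \<rho>\<^sub>1 < \<rho>\<^sub>0 \<and> 0 < \<rho>\<^sub>2 \<longrightarrow> (\<exists>D>0. \<forall>t x r.
    0 < t \<and> 2 * exponent b x1 < 1 / t \<and>
    r = Sup {r. 0 < r \<and> (SUP x\<in>{0<..r}. x\<^sup>2 * moment 2 x) = 1 / t} \<and>
    - \<rho>\<^sub>1 / r \<le> x - t * (b + moment 1 r) \<and> x - t * (b + moment 1 r) \<le> \<rho>\<^sub>2 / r \<longrightarrow>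
    D * r \<le> transition_density M T t x)"
proof -
  \<comment> \<open>The power yields \<open>c\<^sup>2 * \<kappa> powr \<alpha> \<ge> 64\<close>; one
    factor \<open>c\<close> is lost between \<open>r1\<close> and \<open>r\<close>, the other
    between \<open>r\<close> and \<open>w\<close>. The bound \<open>\<kappa> \<ge> 2\<close> ensures
    \<open>1 - 1 / \<kappa> \<ge> 1 / 2\<close>.\<close>
  define \<kappa> where "\<kappa> = max 2 ((64 / c\<^sup>2) powr (1 / \<alpha>))"
  have \<kappa>2: "2 \<le> \<kappa>" by (simp add: \<kappa>_def)
  have \<kappa>64: "64 \<le> c\<^sup>2 * \<kappa> powr \<alpha>"
  proof -
    have "64 / c\<^sup>2 = ((64 / c\<^sup>2) powr (1 / \<alpha>)) powr \<alpha>"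
      using c by (simp add: powr_powr)
    also have "\<dots> \<le> \<kappa> powr \<alpha>"
      using c by (intro powr_mono2) (auto simp: \<kappa>_def)
    finally show ?thesis using c by (simp add: field_simps)
  qed
  \<comment> \<open>The variance is bounded by \<open>\<kappa>\<^sup>2\<close>; adding 64 keeps this
    upper bound above the lower bound 64.\<close>
  define V\<^sub>1 where "V\<^sub>1 = 64 + \<kappa>\<^sup>2"
  show ?thesis
  \<comment> \<open>With this choice \<open>x\<close> lies at most 16 to the left of
    \<open>t * (b + moment 1 r)\<close> in the scale \<open>w\<close>, a quarter of the smallest
    admissible variance.\<close>
  proof (rule exI[of _ "16 / \<kappa>"], intro conjI allI impI)
    show "0 < 16 / \<kappa>" using \<kappa>2 by simp
    fix \<rho>\<^sub>1 \<rho>\<^sub>2 :: real assume \<rho>: "0 < \<rho>\<^sub>1 \<and> \<rho>\<^sub>1 < 16 / \<kappa> \<and> 0 < \<rho>\<^sub>2"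
    \<comment> \<open>In the scale \<open>w\<close>, \<open>\<kappa>\<^sup>2\<close> bounds the
      displacement of the mean and \<open>\<kappa> * \<rho>\<^sub>2\<close> the extent of the window
      to the right.\<close>
    define K where "K = \<kappa>\<^sup>2 + \<kappa> * \<rho>\<^sub>2"
    have "0 < K" using \<kappa>2 \<rho> by (simp add: K_def add_pos_pos)
    obtain a where a: "0 < a"
      "\<And>N M b. normalized_subordinator_law N M b \<alpha> c C 64 V\<^sub>1 \<Longrightarrow>
        \<exists>p. continuous_on UNIV p \<and> (\<forall>x. 0 \<le> p x) \<and> M = density lborel (\<lambda>x. ennreal (p x)) \<and>
        (\<forall>y. 2 * sqrt (subordinator_levy_measure.moment N 2 1) \<le> y \<longrightarrow> y \<le> K \<longrightarrow>
           a * exp (b + subordinator_levy_measure.moment N 1 1 - subordinator_levy_measure.exponent N b 1)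
           \<le> p (b + subordinator_levy_measure.moment N 1 1 + y))"
      by (rule normalized_density_lower_bound[of c \<alpha> 64 V\<^sub>1 C K])
        (use c C \<open>0 < K\<close> in \<open>auto simp: V\<^sub>1_def\<close>)
    \<comment> \<open>\<open>1 / 2\<close> bounds \<open>t * exponent b u\<close>, the other term
      bounds what \<open>exponent_defect_le\<close> collects between \<open>u\<close> and
      \<open>w\<close>; \<open>exp (- G)\<close> is then a lower bound for the factor from undoing
      the tilt.\<close>
    define G where "G = 1 / 2 + V\<^sub>1 / (c * \<alpha>)"
    define D where "D = \<kappa> * a * exp (- G)"
    show "\<exists>D>0. \<forall>t x r.
      0 < t \<and> 2 * exponent b x1 < 1 / t \<and>
      r = Sup {r. 0 < r \<and> (SUP x\<in>{0<..r}. x\<^sup>2 * moment 2 x) = 1 / t} \<and>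
      - \<rho>\<^sub>1 / r \<le> x - t * (b + moment 1 r) \<and> x - t * (b + moment 1 r) \<le> \<rho>\<^sub>2 / r \<longrightarrow>
      D * r \<le> transition_density M T t x"
    proof (intro exI[of _ D] conjI allI impI; (elim conjE)?)
      show "0 < D" using \<kappa>2 a by (simp add: D_def)
      fix t x r
      assume t: "0 < t" and x1t: "2 * exponent b x1 < 1 / t"
        and r: "r = Sup {r. 0 < r \<and> (SUP x\<in>{0<..r}. x\<^sup>2 * moment 2 x) = 1 / t}"
        and xl: "- \<rho>\<^sub>1 / r \<le> x - t * (b + moment 1 r)" and xu: "x - t * (b + moment 1 r) \<le> \<rho>\<^sub>2 / r"
      obtain r1 u where u: "x1 < u" "u < r1" "2 * exponent b u < 1 / t" and r1: "r1 \<le> r"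
        and Fr1: "r1\<^sup>2 * moment 2 r1 = 1 / t" and Fr: "r\<^sup>2 * moment 2 r \<le> 1 / t"
        using running_sup_inverse[OF b x1 x1t c(1,3) pos lower r] by blast
      have r0: "0 < r" "x1 < r" and u0: "0 < u" using u r1 x1 by auto
      have square_lower: "c * l powr \<alpha> * (v\<^sup>2 * moment 2 v) \<le> (l * v)\<^sup>2 * moment 2 (l * v)"
        if "1 \<le> l" "x1 < v" for l v
      proof -
        have "c * l powr \<alpha> * (v\<^sup>2 * moment 2 v) = (l * v)\<^sup>2 * (c * l powr (\<alpha> - 2) * moment 2 v)"
          using that powr_add[of l 2 "\<alpha> - 2"] by (simp add: power_mult_distrib powr_numeral)
        also have "\<dots> \<le> (l * v)\<^sup>2 * moment 2 (l * v)"
          using lower[OF that] by (intro mult_left_mono) auto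
        finally show ?thesis .
      qed
      define w where "w = \<kappa> * r"
      have "1 * r < w" unfolding w_def using \<kappa>2 r0 by (intro mult_strict_right_mono) auto
      then have w: "0 < w" "r < w" "x1 < w" "u \<le> w" using r0 u r1 by auto
      define V where "V = t * w\<^sup>2 * moment 2 w"
      \<comment> \<open>Between \<open>r1\<close> and \<open>r\<close> the function may have dropped
        below \<open>1 / t\<close>; lower scaling limits the loss to a factor
        \<open>c\<close>.\<close>
      have cr: "c \<le> t * (r\<^sup>2 * moment 2 r)"
      proof -
        have "c * 1 * (1 / t) \<le> c * (r / r1) powr \<alpha> * (r1\<^sup>2 * moment 2 r1)"
          unfolding Fr1 using c t r1 u u0 by (intro mult_right_mono mult_left_mono ge_one_powr_ge_zero) auto
        also have "\<dots> \<le> (r / r1 * r1)\<^sup>2 * moment 2 (r / r1 * r1)"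
          using r1 u u0 by (intro square_lower) auto
        finally show ?thesis using u u0 t by (simp add: field_simps)
      qed
      have V_ge: "64 \<le> V"
      proof -
        have "64 \<le> c * \<kappa> powr \<alpha> * c" using \<kappa>64 by (simp add: power2_eq_square mult_ac)
        also have "\<dots> \<le> c * \<kappa> powr \<alpha> * (t * (r\<^sup>2 * moment 2 r))"
          using c cr by (intro mult_left_mono) auto
        also have "\<dots> = t * (c * \<kappa> powr \<alpha> * (r\<^sup>2 * moment 2 r))" by simp
        also have "\<dots> \<le> t * (w\<^sup>2 * moment 2 w)"
          unfolding w_def using t r0 \<kappa>2 by (intro mult_left_mono square_lower) auto
        finally show ?thesis by (simp add: V_def)
      qed
      have tr: "t * (r\<^sup>2 * moment 2 r) \<le> 1"
        using Fr t by (simp add: field_simps)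
      have V_le: "V \<le> \<kappa>\<^sup>2"
      proof -
        have "V \<le> t * w\<^sup>2 * moment 2 r"
          unfolding V_def using t w r0 by (intro mult_left_mono moment_antimono) auto
        also have "\<dots> = \<kappa>\<^sup>2 * (t * (r\<^sup>2 * moment 2 r))" by (simp add: w_def power_mult_distrib)
        also have "\<dots> \<le> \<kappa>\<^sup>2 * 1" by (intro mult_left_mono tr) auto
        finally show ?thesis by simp
      qed
      let ?N = "scaled t w" and ?b = "t * w * b"
      let ?m = "subordinator_levy_measure.moment ?N" and ?e = "subordinator_levy_measure.exponent ?N ?b"
      have m: "?m k v = t * w ^ k * moment k (w * v)" for k v
        using moment_of_scaled t w(1) by simp
      have NL: "normalized_subordinator_law ?N (distr M borel (\<lambda>\<omega>. w * T t \<omega>)) ?b \<alpha> c C 64 V\<^sub>1"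
      proof (intro normalized_subordinator_law.intro normalized_subordinator_law_axioms.intro)
        show "subordinator_law ?N (distr M borel (\<lambda>\<omega>. w * T t \<omega>)) ?b" by (rule law[OF t w(1)])
        show "64 \<le> ?m 2 1" "?m 2 1 \<le> V\<^sub>1"
          using V_ge V_le by (simp_all add: m V_def V\<^sub>1_def)
        fix l v :: real assume l: "1 \<le> l" and v: "1 \<le> v"
        have "w * 1 \<le> w * v" using w v by (intro mult_left_mono) auto
        then have wv: "x1 < w * v" using w(3) by linarith
        have eq: "w * (l * v) = l * (w * v)" by simp
        have "t * w\<^sup>2 * (c * l powr (\<alpha> - 2) * moment 2 (w * v)) \<le> t * w\<^sup>2 * moment 2 (l * (w * v))"
          using t by (intro mult_left_mono lower l wv) auto
        then show "c * l powr (\<alpha> - 2) * ?m 2 v \<le> ?m 2 (l * v)"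
          unfolding m eq by (simp add: mult_ac)
        have "t * w\<^sup>2 * moment 2 (l * (w * v)) \<le> t * w\<^sup>2 * (C * l powr (- 1 / 2) * moment 2 (w * v))"
          using t by (intro mult_left_mono upper l wv) auto
        then show "?m 2 (l * v) \<le> C * l powr (- 1 / 2) * ?m 2 v"
          unfolding m eq by (simp add: mult_ac)
      qed
      from a(2)[OF NL] obtain p where p: "continuous_on UNIV p" "\<And>x. 0 \<le> p x"
        and dens: "distr M borel (\<lambda>\<omega>. w * T t \<omega>) = density lborel (\<lambda>x. ennreal (p x))"
        and low: "\<And>y. 2 * sqrt (?m 2 1) \<le> y \<Longrightarrow> y \<le> K \<Longrightarrow> a * exp (?b + ?m 1 1 - ?e 1) \<le> p (?b + ?m 1 1 + y)"
        by blast
      have td: "transition_density M T t = (\<lambda>x. w * p (w * x))"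
      proof (rule transition_density_eq)
        show "T t \<in> borel_measurable M" by (rule meas[OF t])
        show "continuous_on UNIV (\<lambda>x. w * p (w * x))"
          by (intro continuous_intros continuous_on_compose2[OF p(1)]) auto
        show "0 \<le> w * p (w * x)" for x using p(2) w by simp
        show "distr M borel (T t) = density lborel (\<lambda>x. ennreal (w * p (w * x)))"
          using p by (intro density_rescale[OF w(1) meas[OF t] _ _ dens]) (auto intro: borel_measurable_continuous_onI)
      qed
      \<comment> \<open>The position of \<open>w * x\<close> relative to the tilted mean. In the
        decomposition that follows, the first term is the offset of \<open>x\<close> from the centre
        of the window, the second the displacement of the mean caused by tilting with
        \<open>w\<close> instead of \<open>r\<close>.\<close>
      define y where "y = w * x - (?b + ?m 1 1)"
      have y: "y = \<kappa> * (r * (x - t * (b + moment 1 r))) + w * t * (moment 1 r - moment 1 w)"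
        unfolding y_def m by (simp add: w_def algebra_simps)
      have wr: "w * t * ((w - r) * moment 2 w) = V * (1 - 1 / \<kappa>)"
        using \<kappa>2 r0 by (simp add: V_def w_def field_simps power2_eq_square)
      have "2 * sqrt V \<le> y"
      proof -
        have "- \<rho>\<^sub>1 \<le> r * (x - t * (b + moment 1 r))"
          using xl r0 by (simp add: field_simps)
        then have "\<kappa> * - \<rho>\<^sub>1 \<le> \<kappa> * (r * (x - t * (b + moment 1 r)))"
          using \<kappa>2 by (intro mult_left_mono) auto
        moreover have "\<kappa> * \<rho>\<^sub>1 \<le> 16" using \<rho> \<kappa>2 by (simp add: field_simps)
        moreover have "w * t * ((w - r) * moment 2 w) \<le> w * t * (moment 1 r - moment 1 w)"
          using w t r0 by (intro mult_left_mono moment_1_diff) auto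
        moreover have "V * (1 / 2) \<le> V * (1 - 1 / \<kappa>)"
          using V_ge \<kappa>2 by (intro mult_left_mono) (auto simp: field_simps)
        ultimately have "V / 2 - 16 \<le> y" unfolding y wr mult_minus_right by linarith
        \<comment> \<open>\<open>V - 4 * sqrt V - 32\<close> factors as
          \<open>(sqrt V - 8) * (sqrt V + 4)\<close>: this is the origin of the threshold
          64.\<close>
        moreover have "2 * sqrt V \<le> V / 2 - 16"
        proof -
          have "8 \<le> sqrt V" using V_ge by (intro real_le_rsqrt) simp
          then have "0 \<le> (sqrt V - 8) * (sqrt V + 4)" by (intro mult_nonneg_nonneg) auto
          moreover have "sqrt V * sqrt V = V" using V_ge by simp
          ultimately show ?thesis by (simp add: algebra_simps)
        qed
        ultimately show ?thesis by simp
      qed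
      then have y1: "2 * sqrt (?m 2 1) \<le> y" by (simp add: m V_def)
      have y2: "y \<le> K"
      proof -
        have "r * (x - t * (b + moment 1 r)) \<le> \<rho>\<^sub>2"
          using xu r0 by (simp add: field_simps)
        then have "\<kappa> * (r * (x - t * (b + moment 1 r))) \<le> \<kappa> * \<rho>\<^sub>2"
          using \<kappa>2 by (intro mult_left_mono) auto
        moreover have "w * t * (moment 1 r - moment 1 w) \<le> w * t * (w * moment 2 r)"
        proof (intro mult_left_mono)
          have "moment 1 r - moment 1 w \<le> (w - r) * moment 2 r" by (rule moment_1_diff(2)[OF r0(1) w(2)])
          also have "\<dots> \<le> w * moment 2 r" using r0 moment_nonneg by (intro mult_right_mono) auto
          finally show "moment 1 r - moment 1 w \<le> w * moment 2 r" .
        qed (use w t in auto)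
        moreover have "w * t * (w * moment 2 r) = \<kappa>\<^sup>2 * (t * (r\<^sup>2 * moment 2 r))"
          by (simp add: w_def power2_eq_square)
        moreover have "\<kappa>\<^sup>2 * (t * (r\<^sup>2 * moment 2 r)) \<le> \<kappa>\<^sup>2 * 1" by (intro mult_left_mono tr) auto
        ultimately show ?thesis unfolding y K_def by linarith
      qed
      have "?e 1 - (?b + ?m 1 1) \<le> G"
      proof -
        have "exponent b w - w * (b + moment 1 w) \<le> exponent b u + w\<^sup>2 * moment 2 w / (c * \<alpha>)"
        proof (rule exponent_defect_le[OF b c(1,3) u0 w(4)])
          fix v assume v: "u \<le> v" "v \<le> w"
          then show "c * (w / v) powr (\<alpha> - 2) * moment 2 v \<le> moment 2 w"
            using lower[of "w / v" v] u u0 by simp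
        qed
        then have "t * (exponent b w - w * (b + moment 1 w)) \<le> t * (exponent b u + w\<^sup>2 * moment 2 w / (c * \<alpha>))"
          using t by (intro mult_left_mono) auto
        also have "\<dots> = t * exponent b u + V / (c * \<alpha>)" by (simp add: V_def algebra_simps)
        also have "\<dots> \<le> 1 / 2 + V\<^sub>1 / (c * \<alpha>)"
          using u(3) t V_le c by (intro add_mono divide_right_mono) (auto simp: field_simps V\<^sub>1_def)
        finally have "t * (exponent b w - w * (b + moment 1 w)) \<le> G" by (simp add: G_def)
        moreover have "?e 1 = t * exponent b w" using exponent_of_scaled[of t w b 1] t w(1) by simp
        ultimately show ?thesis unfolding m by (simp add: algebra_simps)
      qed
      then have "a * exp (- G) \<le> a * exp (?b + ?m 1 1 - ?e 1)" using a(1) by simp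
      also have "\<dots> \<le> p (?b + ?m 1 1 + y)" by (rule low[OF y1 y2])
      also have "?b + ?m 1 1 + y = w * x" by (simp add: y_def)
      finally have "w * (a * exp (- G)) \<le> w * p (w * x)" using w by (intro mult_left_mono) auto
      then show "D * r \<le> transition_density M T t x"
        unfolding td by (simp add: D_def w_def mult_ac)
    qed
  qed
qed

end

text \<open>For positive \<open>x1\<close>, scaling at large arguments extends down to
  \<open>x1\<close> by monotonicity. For \<open>x1 = 0\<close> also \<open>x0 = 0\<close>, exactly
  the case in which the second alternative includes regular variation at zero; the bound near 0 and
  the bound from \<open>e\<close> onwards are then joined at \<open>e\<close>.\<close>

lemma upper_scaling_of_conditions:
  fixes \<psi> :: "real \<Rightarrow> real"
  assumes pos: "\<And>x. 0 < x \<Longrightarrow> 0 < \<psi> x" and anti: "\<And>x y. 0 < x \<Longrightarrow> x \<le> y \<Longrightarrow> \<psi> y \<le> \<psi> x"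
    and x: "0 \<le> x0" "0 \<le> x1" "x1 = 0 \<Longrightarrow> x0 = 0"
    and cond: "(\<exists>\<beta> C. 1 \<le> C \<and> \<beta> < 1 \<and> \<psi> \<in> WUSC (\<beta> - 2) C x0)
      \<or> (regularly_varying_at_infinity (- 1) \<psi> \<and> (x0 = 0 \<longrightarrow> regularly_varying_at_zero (- 1) \<psi>))"
  obtains C where "0 \<le> C" "\<And>l x. 1 \<le> l \<Longrightarrow> x1 < x \<Longrightarrow> \<psi> (l * x) \<le> C * l powr (- 1 / 2) * \<psi> x"
  using cond
proof (elim disjE exE conjE)
  fix \<beta> C assume \<beta>: "1 \<le> C" "\<beta> < 1" "\<psi> \<in> WUSC (\<beta> - 2) C x0"
  have up: "\<psi> (l * x) \<le> C * l powr (- 1 / 2) * \<psi> x" if "1 \<le> l" "x0 < x" for l x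
  proof -
    have "\<psi> (l * x) \<le> C * l powr (\<beta> - 2) * \<psi> x" using \<beta>(3) that by (simp add: WUSC_def)
    also have "\<dots> \<le> C * l powr (- 1 / 2) * \<psi> x"
      using \<beta> that x pos[of x] by (intro mult_right_mono mult_left_mono powr_mono) auto
    finally show ?thesis .
  qed
  show ?thesis
  proof (cases "x1 = 0")
    case True
    then show ?thesis using x up \<beta> by (intro that[of C]) auto
  next
    case False
    obtain C' where "0 \<le> C'" "\<And>l y. 1 \<le> l \<Longrightarrow> x1 \<le> y \<Longrightarrow> \<psi> (l * y) \<le> C' * l powr - (1 / 2) * \<psi> y"
      by (rule upper_scaling_extend[where \<psi> = \<psi> and C = C and X = "x0 + 1" and ?x1.0 = x1 and \<gamma> = "1 / 2"])
        (use pos anti \<beta> x False up in auto)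
    then show ?thesis using that[of C'] by simp
  qed
next
  assume rv: "regularly_varying_at_infinity (- 1) \<psi>" "x0 = 0 \<longrightarrow> regularly_varying_at_zero (- 1) \<psi>"
  obtain X where X: "0 < X" "\<And>l x. 1 \<le> l \<Longrightarrow> X \<le> x \<Longrightarrow> \<psi> (l * x) \<le> 2 * l powr (- 1 / 2) * \<psi> x"
    using regularly_varying_at_infinity_upper_scaling[OF pos anti rv(1)] by blast
  have ext: "\<exists>C'\<ge>0. \<forall>l y. 1 \<le> l \<longrightarrow> z \<le> y \<longrightarrow> \<psi> (l * y) \<le> C' * l powr (- 1 / 2) * \<psi> y" if z: "0 < z" for z
  proof -
    obtain C' where "0 \<le> C'" "\<And>l y. 1 \<le> l \<Longrightarrow> z \<le> y \<Longrightarrow> \<psi> (l * y) \<le> C' * l powr - (1 / 2) * \<psi> y"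
      by (rule upper_scaling_extend[where \<psi> = \<psi> and C = 2 and X = X and ?x1.0 = z and \<gamma> = "1 / 2"])
        (use pos anti X z in auto)
    then show ?thesis by auto
  qed
  show ?thesis
  proof (cases "x1 = 0")
    case False
    then obtain C' where "0 \<le> C'" "\<And>l y. 1 \<le> l \<Longrightarrow> x1 \<le> y \<Longrightarrow> \<psi> (l * y) \<le> C' * l powr (- 1 / 2) * \<psi> y"
      using ext[of x1] x by (metis less_eq_real_def)
    then show ?thesis using that[of C'] by simp
  next
    case True
    then have rv0: "regularly_varying_at_zero (- 1) \<psi>" using rv x by simp
    obtain e where e: "0 < e"
      "\<And>l x. 1 \<le> l \<Longrightarrow> 0 < x \<Longrightarrow> l * x \<le> e \<Longrightarrow> \<psi> (l * x) \<le> 2 * l powr (- 1 / 2) * \<psi> x"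
      using regularly_varying_at_zero_upper_scaling[OF pos anti rv0] by blast
    obtain C' where C': "0 \<le> C'" "\<And>l y. 1 \<le> l \<Longrightarrow> e \<le> y \<Longrightarrow> \<psi> (l * y) \<le> C' * l powr (- 1 / 2) * \<psi> y"
      using ext[OF e(1)] by blast
    show ?thesis
    proof (rule that[of "2 * C' + 2"])
      show "0 \<le> 2 * C' + 2" using C' by simp
      fix l y :: real assume l: "1 \<le> l" and y: "x1 < y"
      have y0: "0 < y" using y True by simp
      consider "l * y \<le> e" | "e \<le> y" | "y < e" "e < l * y" by linarith
      then show "\<psi> (l * y) \<le> (2 * C' + 2) * l powr (- 1 / 2) * \<psi> y"
      proof cases
        case 1
        have "\<psi> (l * y) \<le> 2 * l powr (- 1 / 2) * \<psi> y" using e(2)[OF l y0 1] .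
        also have "\<dots> \<le> (2 * C' + 2) * l powr (- 1 / 2) * \<psi> y"
          using C' pos[OF y0] by (intro mult_right_mono) auto
        finally show ?thesis .
      next
        case 2
        have "\<psi> (l * y) \<le> C' * l powr (- 1 / 2) * \<psi> y" using C'(2)[OF l 2] .
        also have "\<dots> \<le> (2 * C' + 2) * l powr (- 1 / 2) * \<psi> y"
          using C' pos[OF y0] by (intro mult_right_mono) auto
        finally show ?thesis .
      next
        case 3
        \<comment> \<open>The range is split at \<open>e\<close>, first from \<open>e\<close> to
          \<open>l * y\<close>, then from \<open>y\<close> to \<open>e\<close>; since both parts
          have the same exponent, the powers multiply to \<open>l powr (- 1 / 2)\<close>.\<close>
        have "\<psi> (l * y / e * e) \<le> C' * (l * y / e) powr (- 1 / 2) * \<psi> e"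
          using 3 e by (intro C') auto
        also have "\<psi> e = \<psi> (e / y * y)" using y0 by simp
        also have "C' * (l * y / e) powr (- 1 / 2) * \<psi> (e / y * y)
          \<le> C' * (l * y / e) powr (- 1 / 2) * (2 * (e / y) powr (- 1 / 2) * \<psi> y)"
          using 3 y0 C' by (intro mult_left_mono e) auto
        also have "\<dots> = 2 * C' * ((l * y / e) powr (- 1 / 2) * (e / y) powr (- 1 / 2)) * \<psi> y"
          by simp
        also have "(l * y / e) powr (- 1 / 2) * (e / y) powr (- 1 / 2) = (l * y / e * (e / y)) powr (- 1 / 2)"
          by (rule powr_mult[symmetric])
        also have "l * y / e * (e / y) = l" using y0 e by simp
        also have "2 * C' * l powr (- 1 / 2) * \<psi> y \<le> (2 * C' + 2) * l powr (- 1 / 2) * \<psi> y"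
          using C' pos[OF y0] by (intro mult_right_mono) auto
        finally show ?thesis using e by simp
      qed
    qed
  qed
qed

text \<open>Pushing \<nu> forward along the inclusion of \<open>{0<..}\<close> gives a measure on
  the whole line without changing any of the integrals.\<close>

lemma levy_khintchine_repr_imp:
  assumes "levy_khintchine_repr \<phi> b \<nu>"
  defines "N \<equiv> distr \<nu> borel (\<lambda>s. s)"
  shows "subordinator_levy_measure N" "0 \<le> b" "0 \<le> u \<Longrightarrow> \<phi> u = subordinator_levy_measure.exponent N b u"
proof -
  have \<nu>: "0 \<le> b" "sets \<nu> = sets (restrict_space borel {0<..})" "(\<integral>\<^sup>+ s. ennreal (min 1 s) \<partial>\<nu>) < \<infinity>"
    "\<And>u. 0 \<le> u \<Longrightarrow> \<phi> u = b * u + (\<integral>s. (1 - exp (- u * s)) \<partial>\<nu>)"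
    using assms(1) by (auto simp: levy_khintchine_repr_def)
  have m[measurable]: "(\<lambda>s. s) \<in> borel_measurable \<nu>"
    by (simp add: measurable_cong_sets[OF \<nu>(2) refl] measurable_restrict_space1)
  have space: "space \<nu> = {0<..}"
    using sets_eq_imp_space_eq[OF \<nu>(2)] by (simp add: space_restrict_space)
  show N: "subordinator_levy_measure N"
  proof
    show "sets N = sets borel" by (simp add: N_def)
    show "AE s in N. 0 < s" unfolding N_def by (subst AE_distr_iff) (auto simp: space)
    show "(\<integral>\<^sup>+ s. ennreal (min 1 s) \<partial>N) < \<infinity>" unfolding N_def using \<nu>(3) by (subst nn_integral_distr) auto
  qed
  show "0 \<le> b" by fact
  show "\<phi> u = subordinator_levy_measure.exponent N b u" if "0 \<le> u"
    unfolding subordinator_levy_measure.exponent_def[OF N] \<nu>(4)[OF that]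
    unfolding N_def
    by (subst integral_distr) auto
qed

lemma subordinator_law_scaled:
  fixes M :: "'w measure"
  assumes "subordinator M T" "laplace_exponent M T \<phi>"
    and N: "subordinator_levy_measure N" and b: "0 \<le> b"
    and \<phi>: "\<And>u. 0 \<le> u \<Longrightarrow> \<phi> u = subordinator_levy_measure.exponent N b u" and t: "0 < t" "0 < w"
  shows "subordinator_law (subordinator_levy_measure.scaled N t w) (distr M borel (\<lambda>\<omega>. w * T t \<omega>)) (t * w * b)"
proof -
  interpret S: subordinator M T by fact
  interpret N: subordinator_levy_measure N by fact
  interpret N': subordinator_levy_measure "N.scaled t w"
    using t by (intro N.subordinator_levy_measure_scaled) auto
  have [measurable]: "T t \<in> borel_measurable M" using S.random_variable t by simp
  interpret D: real_distribution "distr M borel (\<lambda>\<omega>. w * T t \<omega>)"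
    by (rule S.real_distribution_distr) simp
  show ?thesis
  proof
    show "0 \<le> t * w * b" using t b by simp
    have "AE \<omega> in M. 0 \<le> T t \<omega>"
      using S.start_zero S.nondecreasing_paths
    proof eventually_elim
      case (elim \<omega>)
      then show ?case using mono_onD[of "{0..}" "\<lambda>t. T t \<omega>" 0 t] t by simp
    qed
    then show "AE x in distr M borel (\<lambda>\<omega>. w * T t \<omega>). 0 \<le> x"
      using t by (subst AE_distr_iff) (auto elim!: eventually_mono)
    show "(\<integral>x. exp (- u * x) \<partial>distr M borel (\<lambda>\<omega>. w * T t \<omega>)) = exp (- N'.exponent (t * w * b) u)"
      if u: "0 < u" for u
    proof -
      have "(\<integral>x. exp (- u * x) \<partial>distr M borel (\<lambda>\<omega>. w * T t \<omega>)) = (\<integral>\<omega>. exp (- (w * u) * T t \<omega>) \<partial>M)"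
        by (subst integral_distr) (auto simp: mult_ac)
      also have "\<dots> = exp (- t * \<phi> (w * u))"
        using assms(2) t u unfolding laplace_exponent_def by (simp del: mult_minus_left)
      also have "\<dots> = exp (- N'.exponent (t * w * b) u)"
        using \<phi>[of "w * u"] t u N.exponent_of_scaled[of t w b u] by simp
      finally show ?thesis .
    qed
  qed
qed

theorem theorem4p11:
  fixes M :: "'w measure" and T :: "real \<Rightarrow> 'w \<Rightarrow> real"
    and \<phi> :: "real \<Rightarrow> real" and b :: real and \<nu> :: "real measure"
    and \<alpha> c x\<^sub>0 :: real
  assumes "subordinator M T"
    and "laplace_exponent M T \<phi>"
    and "levy_khintchine_repr \<phi> b \<nu>"
    and "\<exists>x>0. deriv (deriv \<phi>) x \<noteq> 0"
    and "0 < c" "c \<le> 1" "0 \<le> x\<^sub>0" "0 < \<alpha>"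
    and "(\<lambda>x. - deriv (deriv \<phi>) x) \<in> WLSC (\<alpha> - 2) c x\<^sub>0"
    and "(\<exists>\<beta> C. 1 \<le> C \<and> \<alpha> \<le> \<beta> \<and> \<beta> < 1 \<and>
             (\<lambda>x. - deriv (deriv \<phi>) x) \<in> WUSC (\<beta> - 2) C x\<^sub>0)
         \<or> (regularly_varying_at_infinity (-1) (\<lambda>x. - deriv (deriv \<phi>) x) \<and>
            (x\<^sub>0 = 0 \<longrightarrow> regularly_varying_at_zero (-1) (\<lambda>x. - deriv (deriv \<phi>) x)))"
  shows "\<exists>\<rho>\<^sub>0>0. \<forall>\<rho>\<^sub>1 \<rho>\<^sub>2. 0 < \<rho>\<^sub>1 \<and> \<rho>\<^sub>1 < \<rho>\<^sub>0 \<and> 0 < \<rho>\<^sub>2 \<longrightarrow>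
           (\<exists>C>0. \<forall>t x. 0 < t \<and> ereal t < time_horizon \<phi> x\<^sub>0 \<and> 0 < x \<and>
              - \<rho>\<^sub>1 / varphi_inv \<phi> (1 / t) \<le> x - t * deriv \<phi> (varphi_inv \<phi> (1 / t)) \<and>
              x - t * deriv \<phi> (varphi_inv \<phi> (1 / t)) \<le> \<rho>\<^sub>2 / varphi_inv \<phi> (1 / t) \<longrightarrow>
              transition_density M T t x \<ge> C * varphi_inv \<phi> (1 / t))"
proof -
  define N where "N = distr \<nu> borel (\<lambda>s. s)"
  note lk = levy_khintchine_repr_imp[OF assms(3), folded N_def]
  interpret S: subordinator M T by fact
  interpret subordinator_levy_measure N by (rule lk(1))
  define \<psi> where "\<psi> = (\<lambda>x. - deriv (deriv \<phi>) x)"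
  have d1: "deriv \<phi> u = b + moment 1 u" if "0 < u" for u
  proof (rule DERIV_imp_deriv, rule has_field_derivative_transform_within_open[OF exponent_deriv[OF that]])
    show "exponent b v = \<phi> v" if "v \<in> {0<..}" for v using lk(3)[of v] that by simp
  qed (use that in auto)
  have d2: "\<psi> u = moment 2 u" if "0 < u" for u
  proof -
    have "((\<lambda>u. b + moment 1 u) has_real_derivative 0 + - moment (Suc 1) u) (at u)"
      by (intro DERIV_add DERIV_const moment_deriv that) simp
    then have "(deriv \<phi> has_real_derivative 0 + - moment (Suc 1) u) (at u)"
      by (rule has_field_derivative_transform_within_open[where S = "{0<..}"]) (use that d1 in auto)
    then show ?thesis unfolding \<psi>_def by (simp add: DERIV_imp_deriv numeral_2_eq_2)
  qed
  obtain v where v: "0 < v" "moment 2 v \<noteq> 0"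
    using assms(4) d2 unfolding \<psi>_def by force
  have pos: "0 < moment 2 x" if "0 < x" for x
    using moment_2_pos[OF that, of v] v moment_nonneg[of 2 v] by simp
  have \<psi>pos: "0 < \<psi> x" if "0 < x" for x using pos that d2 by simp
  have \<psi>anti: "\<psi> y \<le> \<psi> x" if "0 < x" "x \<le> y" for x y
    using moment_antimono[of 2 x y] that d2 by simp
  \<comment> \<open>Extending the lower scaling requires \<open>\<alpha> \<le> 2\<close>; for
    \<open>l \<ge> 1\<close> a smaller \<alpha> only weakens the bound.\<close>
  define \<alpha>' where "\<alpha>' = min \<alpha> 2"
  have \<alpha>': "0 < \<alpha>'" "\<alpha>' \<le> 2" using assms(8) by (auto simp: \<alpha>'_def)
  have low0: "c * l powr (\<alpha>' - 2) * \<psi> x \<le> \<psi> (l * x)" if "1 \<le> l" "x\<^sub>0 < x" for l x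
  proof -
    have "c * l powr (\<alpha>' - 2) * \<psi> x \<le> c * l powr (\<alpha> - 2) * \<psi> x"
      using that assms(5,7) \<psi>pos[of x] by (intro mult_right_mono mult_left_mono powr_mono) (auto simp: \<alpha>'_def)
    also have "\<dots> \<le> \<psi> (l * x)" using assms(9) that by (simp add: WLSC_def \<psi>_def)
    finally show ?thesis .
  qed
  \<comment> \<open>The running supremum may reach \<open>1 / t\<close> before
    \<open>x\<^sub>0\<close> although \<open>varphi \<phi> x\<^sub>0 < 1 / t\<close>. For positive
    \<open>x\<^sub>0\<close> the new threshold is so small that
    \<open>2 * exponent b x1 < varphi \<phi> x\<^sub>0\<close>, and the scaling bounds are extended
    down to it; for \<open>x\<^sub>0 = 0\<close> it is 0, where the exponent vanishes.\<close>
  obtain x1 where x1: "0 \<le> x1" "x1 = 0 \<Longrightarrow> x\<^sub>0 = 0" "x1 \<le> x\<^sub>0"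
    and horizon: "\<And>t. 0 < t \<Longrightarrow> ereal t < time_horizon \<phi> x\<^sub>0 \<Longrightarrow> 2 * exponent b x1 < 1 / t"
  proof (cases "x\<^sub>0 = 0")
    case True
    then show ?thesis by (intro that[of 0]) auto
  next
    case False
    then have x0: "0 < x\<^sub>0" using assms(7) by simp
    have vp: "0 < varphi \<phi> x\<^sub>0"
      unfolding varphi_def using \<psi>pos[OF x0] x0 by (intro mult_pos_pos) (simp_all add: \<psi>_def)
    obtain u where u: "0 < u" "exponent b u < varphi \<phi> x\<^sub>0 / 2"
      using exponent_small[OF lk(2), of "varphi \<phi> x\<^sub>0 / 2"] vp by auto
    show ?thesis
    proof (rule that[of "min u x\<^sub>0"])
      fix t assume t: "0 < t" "ereal t < time_horizon \<phi> x\<^sub>0"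
      then have "t < 1 / varphi \<phi> x\<^sub>0"
        using vp by (simp add: time_horizon_def one_ereal_def)
      then have "varphi \<phi> x\<^sub>0 < 1 / t" using vp t by (simp add: field_simps)
      moreover have "exponent b (min u x\<^sub>0) \<le> exponent b u"
        using u x0 lk(2) by (intro exponent_mono) auto
      ultimately show "2 * exponent b (min u x\<^sub>0) < 1 / t" using u by simp
    qed (use u x0 in auto)
  qed
  obtain c' where c': "0 < c'" "c' \<le> 1"
    "\<And>l x. 1 \<le> l \<Longrightarrow> x1 < x \<Longrightarrow> c' * l powr (\<alpha>' - 2) * \<psi> x \<le> \<psi> (l * x)"
  proof (cases "x1 = 0")
    case True
    then show ?thesis using x1 low0 assms(5,6) by (intro that[of c]) auto
  next
    case False
    show ?thesis
      by (rule lower_scaling_extend[where \<psi> = \<psi> and c = c and \<alpha> = \<alpha>' and ?x1.0 = x1 and ?x0.0 = x\<^sub>0])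
        (use \<psi>pos \<psi>anti assms(5,6) \<alpha>' x1 False low0 that in auto)
  qed
  obtain C where C: "0 \<le> C" "\<And>l x. 1 \<le> l \<Longrightarrow> x1 < x \<Longrightarrow> \<psi> (l * x) \<le> C * l powr (- 1 / 2) * \<psi> x"
    by (rule upper_scaling_of_conditions[where \<psi> = \<psi> and ?x0.0 = x\<^sub>0 and ?x1.0 = x1])
      (use \<psi>pos \<psi>anti x1 assms(7,10) in \<open>auto simp: \<psi>_def\<close>)
  have vs: "varphi_star \<phi> r = (SUP x\<in>{0<..r}. x\<^sup>2 * moment 2 x)" for r
    unfolding varphi_star_def using d2 by (intro SUP_cong) (auto simp: varphi_def \<psi>_def)
  define R where "R t = Sup {r. 0 < r \<and> (SUP x\<in>{0<..r}. x\<^sup>2 * moment 2 x) = 1 / t}" for t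
  have vi: "varphi_inv \<phi> (1 / t) = R t" for t
    by (simp add: varphi_inv_def vs R_def)
  have low: "c' * l powr (\<alpha>' - 2) * moment 2 x \<le> moment 2 (l * x)"
    and up: "moment 2 (l * x) \<le> C * l powr (- 1 / 2) * moment 2 x" if "1 \<le> l" "x1 < x" for l x
  proof -
    have "0 < x" "0 < l * x" using that x1 by (auto intro!: mult_pos_pos)
    then show "c' * l powr (\<alpha>' - 2) * moment 2 x \<le> moment 2 (l * x)"
      "moment 2 (l * x) \<le> C * l powr (- 1 / 2) * moment 2 x"
      using c'(3)[OF that] C(2)[OF that] by (simp_all add: d2)
  qed
  \<comment> \<open>The formula \<open>d1\<close> for \<open>deriv \<phi>\<close> is available only
    at positive arguments.\<close>
  have R0: "0 < R t" if "0 < t" "2 * exponent b x1 < 1 / t" for t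
    using running_sup_inverse[OF lk(2) x1(1) that(2) c'(1) \<alpha>'(1) pos low R_def] x1(1) by force
  have meas: "T t \<in> borel_measurable M" if "0 < t" for t
    using S.random_variable[of t] that by simp
  have law: "subordinator_law (scaled t w) (distr M borel (\<lambda>\<omega>. w * T t \<omega>)) (t * w * b)"
    if "0 < t" "0 < w" for t w
    by (rule subordinator_law_scaled[OF assms(1,2) lk(1,2,3) that])
  obtain \<rho>\<^sub>0 where "0 < \<rho>\<^sub>0" and main: "\<And>\<rho>\<^sub>1 \<rho>\<^sub>2. 0 < \<rho>\<^sub>1 \<and> \<rho>\<^sub>1 < \<rho>\<^sub>0 \<and> 0 < \<rho>\<^sub>2 \<Longrightarrow> \<exists>D>0. \<forall>t x r.
    0 < t \<and> 2 * exponent b x1 < 1 / t \<and>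
    r = Sup {r. 0 < r \<and> (SUP x\<in>{0<..r}. x\<^sup>2 * moment 2 x) = 1 / t} \<and>
    - \<rho>\<^sub>1 / r \<le> x - t * (b + moment 1 r) \<and> x - t * (b + moment 1 r) \<le> \<rho>\<^sub>2 / r \<longrightarrow>
    D * r \<le> transition_density M T t x"
    using transition_density_scaled_lower_bound[OF lk(2) x1(1) c'(1,2) \<alpha>'(1) C(1) pos low up meas law]
    by blast
  show ?thesis
  proof (rule exI[of _ \<rho>\<^sub>0], intro conjI allI impI)
    fix \<rho>\<^sub>1 \<rho>\<^sub>2 :: real assume "0 < \<rho>\<^sub>1 \<and> \<rho>\<^sub>1 < \<rho>\<^sub>0 \<and> 0 < \<rho>\<^sub>2"
    from main[OF this] obtain D where "0 < D" and D: "\<And>t x. 0 < t \<Longrightarrow> 2 * exponent b x1 < 1 / t \<Longrightarrow>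
      - \<rho>\<^sub>1 / R t \<le> x - t * (b + moment 1 (R t)) \<Longrightarrow> x - t * (b + moment 1 (R t)) \<le> \<rho>\<^sub>2 / R t \<Longrightarrow>
      D * R t \<le> transition_density M T t x"
      unfolding R_def by blast
    show "\<exists>C>0. \<forall>t x. 0 < t \<and> ereal t < time_horizon \<phi> x\<^sub>0 \<and> 0 < x \<and>
              - \<rho>\<^sub>1 / varphi_inv \<phi> (1 / t) \<le> x - t * deriv \<phi> (varphi_inv \<phi> (1 / t)) \<and>
              x - t * deriv \<phi> (varphi_inv \<phi> (1 / t)) \<le> \<rho>\<^sub>2 / varphi_inv \<phi> (1 / t) \<longrightarrow>
              transition_density M T t x \<ge> C * varphi_inv \<phi> (1 / t)"
    proof (intro exI[of _ D] conjI allI impI \<open>0 < D\<close>; elim conjE)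
      fix t x assume t: "0 < t" "ereal t < time_horizon \<phi> x\<^sub>0"
        and x: "- \<rho>\<^sub>1 / varphi_inv \<phi> (1 / t) \<le> x - t * deriv \<phi> (varphi_inv \<phi> (1 / t))"
          "x - t * deriv \<phi> (varphi_inv \<phi> (1 / t)) \<le> \<rho>\<^sub>2 / varphi_inv \<phi> (1 / t)"
      note h = horizon[OF t]
      show "D * varphi_inv \<phi> (1 / t) \<le> transition_density M T t x"
        using D[OF t(1) h, of x] x d1[OF R0[OF t(1) h]] by (simp only: vi)
    qed
  qed (fact \<open>0 < \<rho>\<^sub>0\<close>)
qed

end
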